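(* There exists a sieve prior $\pi_n$ such that, if $Y^n=(Y_1,\dots,Y_n)$ is drawn from the density model described in the context, then for every $1/2<\beta_1\le\beta_2$ and $L>0$ there exist $M,B>0$ with $$\sup_{\theta_0\in\mathcal H'(\beta,L)}E^n_{\theta_0}\big[P^{\pi_n}\big(\theta:\ell_\infty(\theta,\theta_0)\ge M(n/\log n)^{-\beta/(2\beta+1)}\mid Y^n\big)\big]\le n^{-B}$$ uniformly in $\beta\in[\beta_1,\beta_2]$.
   Context: Let $(\Psi_{j,k})_{(j,k)\in\Lambda}$, $\Lambda=\{(j,k):j\in\mathbb N=\{0,1,\dots\},k\in I_j\}$, be a compactly supported orthonormal wavelet basis of $L^2([0,1])$ with boundary conditions, associated with a regular multiresolution analysis; the terms $j=0$ incorporate the scaling function and $|I_j|$ is of order $2^j$. Density model: for $\theta=(\theta_{j,k})\in\ell^2(\Lambda)$ with $\|\theta\|_{\ell^2}=1$ and $\sum_{(j,k)\in\Lambda}\theta_{j,k}\Psi_{j,k}\ge0$, let $f_\theta$ be the probability density on $[0,1]$ given by $\sqrt{f_\theta(x)}=\sum_{(j,k)\in\Lambda}\theta_{j,k}\Psi_{j,k}(x)$. Under $P^n_\theta$, $Y_1,\dots,Y_n$ are i.i.d. on $[0,1]$ with density $f_\theta$; $E^n_\theta$ is the corresponding expectation. Loss: $\ell_\infty(\theta,\theta')=\sum_{j\in\mathbb N}2^{j/2}\max_{k\in I_j}|\theta_{j,k}-\theta'_{j,k}|$. Classes: $\mathcal H(\beta,L)=\{\theta:|\theta_{j,k}|\le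 L2^{-j(\beta+1/2)}\ \text{for all }(j,k)\in\Lambda\}$, and $\mathcal H'(\beta,L)$ is the set of $\theta\in\mathcal H(\beta,L)$ with $\|\theta\|_{\ell^2}=1$ and $\sum_{(j,k)\in\Lambda}\theta_{j,k}\Psi_{j,k}$ larger than $c$ on $[0,1]$, where $c>0$ is some fixed constant. Sieve prior: for each $n$, a prior of the form $\pi_n=\frac1{N_n}\sum_{l=1}^{N_n}\delta_{\theta_{(l)}}$, i.e. uniform over a finite list of parameters $\theta_{(1)},\dots,\theta_{(N_n)}$. $P^{\pi_n}(\cdot\mid Y^n)$ is the corresponding posterior distribution. *)

theory Defs
  imports "HOL-Probability.Probability"
begin

section \<open>Square-integrable functions\<close>

text \<open>
  Elements of \<open>L\<^sup>2(A)\<close> are represented by Borel functions on the line; two functions that agree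
  almost everywhere on \<open>A\<close> are not identified, but every set of functions below is
  saturated under that relation.
\<close>

definition L2 :: "real set \<Rightarrow> (real \<Rightarrow> real) set" where
  "L2 A = {f. f \<in> borel_measurable borel \<and> set_integrable lborel A (\<lambda>x. (f x)\<^sup>2)}"

definition L2_inner :: "real set \<Rightarrow> (real \<Rightarrow> real) \<Rightarrow> (real \<Rightarrow> real) \<Rightarrow> real" where
  "L2_inner A f g = (LINT x:A|lborel. f x * g x)"

definition L2_dist :: "real set \<Rightarrow> (real \<Rightarrow> real) \<Rightarrow> (real \<Rightarrow> real) \<Rightarrow> real" where
  "L2_dist A f g = sqrt (L2_inner A (\<lambda>x. f x - g x) (\<lambda>x. f x - g x))"

definition orthonormal_family :: "real set \<Rightarrow> 'i set \<Rightarrow> ('i \<Rightarrow> real \<Rightarrow> real) \<Rightarrow> bool" where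
  "orthonormal_family A I e \<longleftrightarrow>
     (\<forall>i\<in>I. e i \<in> L2 A) \<and>
     (\<forall>i\<in>I. \<forall>j\<in>I. L2_inner A (e i) (e j) = (if i = j then 1 else 0))"

definition closed_span :: "real set \<Rightarrow> 'i set \<Rightarrow> ('i \<Rightarrow> real \<Rightarrow> real) \<Rightarrow> (real \<Rightarrow> real) set" where
  "closed_span A I e =
     {f \<in> L2 A. \<forall>\<epsilon>>0. \<exists>K a. finite K \<and> K \<subseteq> I \<and> L2_dist A f (\<lambda>x. \<Sum>i\<in>K. a i * e i x) < \<epsilon>}"

definition orthonormal_basis ::
  "real set \<Rightarrow> 'i set \<Rightarrow> ('i \<Rightarrow> real \<Rightarrow> real) \<Rightarrow> (real \<Rightarrow> real) set \<Rightarrow> bool" where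
  "orthonormal_basis A I e W \<longleftrightarrow> orthonormal_family A I e \<and> closed_span A I e = W"

definition orth_diff :: "real set \<Rightarrow> (real \<Rightarrow> real) set \<Rightarrow> (real \<Rightarrow> real) set \<Rightarrow> (real \<Rightarrow> real) set" where
  "orth_diff A W U = {f \<in> W. \<forall>g\<in>U. L2_inner A f g = 0}"


section \<open>Regular multiresolution analyses of the line\<close>

definition class_C :: "nat \<Rightarrow> (real \<Rightarrow> real) \<Rightarrow> bool" where
  "class_C r f \<longleftrightarrow>
     (\<forall>i<r. (deriv ^^ i) f differentiable_on UNIV) \<and> continuous_on UNIV ((deriv ^^ r) f)"

definition compactly_supported :: "(real \<Rightarrow> real) \<Rightarrow> bool" where
  "compactly_supported f \<longleftrightarrow> (\<exists>S. \<forall>x. \<bar>x\<bar> > S \<longrightarrow> f x = 0)"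

text \<open>
  Since the scaling function \<open>\<phi>\<close> and the wavelet \<open>\<psi>\<close> have compact support, Meyer's decay
  condition on the derivatives up to order \<open>r\<close> is implied by \<open>class_C r\<close>.
\<close>

definition regular_mra ::
  "nat \<Rightarrow> (real \<Rightarrow> real) \<Rightarrow> (real \<Rightarrow> real) \<Rightarrow> (int \<Rightarrow> (real \<Rightarrow> real) set) \<Rightarrow> bool" where
  "regular_mra r \<phi> \<psi> V \<longleftrightarrow>
     (\<forall>j. V j \<subseteq> V (j + 1)) \<and>
     (\<forall>j f. f \<in> V j \<longleftrightarrow> (\<lambda>x. f (2 * x)) \<in> V (j + 1)) \<and>
     (\<forall>f \<in> (\<Inter>j. V j). AE x in lborel. f x = 0) \<and>
     (\<forall>f \<in> L2 UNIV. \<forall>\<epsilon>>0. \<exists>g \<in> (\<Union>j. V j). L2_dist UNIV f g < \<epsilon>) \<and>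
     orthonormal_basis UNIV UNIV (\<lambda>m::int. \<lambda>x. \<phi> (x - of_int m)) (V 0) \<and>
     orthonormal_basis UNIV UNIV (\<lambda>m::int. \<lambda>x. \<psi> (x - of_int m)) (orth_diff UNIV (V 1) (V 0)) \<and>
     class_C r \<phi> \<and> class_C r \<psi> \<and> compactly_supported \<phi> \<and> compactly_supported \<psi>"

definition translate_span :: "(real \<Rightarrow> real) \<Rightarrow> (real \<Rightarrow> real) set" where
  "translate_span g = {u. \<exists>(K::int set) a. finite K \<and> u = (\<lambda>x. \<Sum>m\<in>K. a m * g (x - of_int m))}"


section \<open>Wavelet bases of \<open>[0,1]\<close> with boundary conditions\<close>

text \<open>
  At resolution level \<open>i\<close> a basis of \<open>[0,1]\<close> consists of the interior functions
  \<open>2\<^bsup>i/2\<^esup> g(2\<^bsup>i\<^esup> x - m)\<close>, \<open>p \<le> m < 2\<^bsup>i\<^esup> - q\<close>, and of finitely many boundary functions, whose number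
  and shape do not depend on \<open>i\<close>. A pair \<open>(u, w)\<close> in the list \<open>E\<close> stands for the boundary
  function \<open>2\<^bsup>i/2\<^esup> (u(2\<^bsup>i\<^esup> x) + w(2\<^bsup>i\<^esup> (x - 1)))\<close>. Left and right edge functions in the sense of Cohen,
  Daubechies and Vial are the cases \<open>w = 0\<close> and \<open>u = 0\<close>; functions wrapped around by periodic
  boundary conditions use both components. Only the restriction to \<open>[0,1]\<close> matters.
\<close>

type_synonym edges = "((real \<Rightarrow> real) \<times> (real \<Rightarrow> real)) list"

definition edge_fun :: "(real \<Rightarrow> real) \<times> (real \<Rightarrow> real) \<Rightarrow> nat \<Rightarrow> real \<Rightarrow> real" where
  "edge_fun uw i x = 2 powr (real i / 2) * (fst uw (2 ^ i * x) + snd uw (2 ^ i * (x - 1)))"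

definition level_size :: "edges \<Rightarrow> nat \<Rightarrow> nat \<Rightarrow> nat \<Rightarrow> nat" where
  "level_size E p q i = length E + (2 ^ i - p - q)"

definition level_fun ::
  "(real \<Rightarrow> real) \<Rightarrow> edges \<Rightarrow> nat \<Rightarrow> nat \<Rightarrow> nat \<Rightarrow> real \<Rightarrow> real" where
  "level_fun g E p i k x =
     (if k < length E then edge_fun (E ! k) i x
      else 2 powr (real i / 2) * g (2 ^ i * x - real (p + (k - length E))))"

text \<open>
  \<open>E\<close> lists the boundary scaling functions, \<open>F\<close> the boundary wavelets, and \<open>J\<close> is the coarsest
  resolution level. The spaces \<open>closed_span {0..1} _ (level_fun \<phi> E p i)\<close>, \<open>i \<ge> J\<close>, form the
  multiresolution analysis of \<open>[0,1]\<close>. The index \<open>j\<close> refers to the wavelets of level \<open>J + j\<close>, and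
  the scaling functions of level \<open>J\<close> are listed in front of the wavelets with \<open>j = 0\<close>.
\<close>

definition wavelet_index :: "edges \<Rightarrow> edges \<Rightarrow> nat \<Rightarrow> nat \<Rightarrow> nat \<Rightarrow> nat \<Rightarrow> nat set" where
  "wavelet_index E F p q J j =
     (if j = 0 then {..<level_size E p q J + level_size F p q J}
      else {..<level_size F p q (J + j)})"

definition wavelet_fun ::
  "(real \<Rightarrow> real) \<Rightarrow> (real \<Rightarrow> real) \<Rightarrow> edges \<Rightarrow> edges \<Rightarrow> nat \<Rightarrow> nat \<Rightarrow> nat \<Rightarrow> nat \<Rightarrow> nat \<Rightarrow> real \<Rightarrow> real" where
  "wavelet_fun \<phi> \<psi> E F p q J j k =
     (if j = 0 then
        (if k < level_size E p q J then level_fun \<phi> E p J k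
         else level_fun \<psi> F p J (k - level_size E p q J))
      else level_fun \<psi> F p (J + j) k)"

definition Lam :: "(nat \<Rightarrow> nat set) \<Rightarrow> (nat \<times> nat) set" where
  "Lam I = (SIGMA j:UNIV. I j)"

definition interval_wavelet_basis ::
  "nat \<Rightarrow> (nat \<Rightarrow> nat set) \<Rightarrow> (nat \<Rightarrow> nat \<Rightarrow> real \<Rightarrow> real) \<Rightarrow> bool" where
  "interval_wavelet_basis r I \<Psi> \<longleftrightarrow>
     (\<exists>\<phi> \<psi> V E F p q J.
        let U = (\<lambda>i. closed_span {0..1} {..<level_size E p q i} (level_fun \<phi> E p i)) in
        regular_mra r \<phi> \<psi> V \<and>
        p + q \<le> 2 ^ J \<and>
        (\<forall>x. x < - real p \<or> x > real q + 1 \<longrightarrow> \<phi> x = 0 \<and> \<psi> x = 0) \<and>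
        (\<forall>(u, w) \<in> set E. u \<in> translate_span \<phi> \<and> w \<in> translate_span \<phi>) \<and>
        (\<forall>(u, w) \<in> set F. \<exists>u' \<in> translate_span \<phi>. \<exists>w' \<in> translate_span \<phi>.
            u = (\<lambda>x. u' (2 * x)) \<and> w = (\<lambda>x. w' (2 * x))) \<and>
        (\<forall>i\<ge>J. orthonormal_family {0..1} {..<level_size E p q i} (level_fun \<phi> E p i)) \<and>
        (\<forall>i\<ge>J. U i \<subseteq> U (i + 1)) \<and>
        (\<forall>i\<ge>J. orthonormal_basis {0..1} {..<level_size F p q i} (level_fun \<psi> F p i)
                  (orth_diff {0..1} (U (i + 1)) (U i))) \<and>
        I = wavelet_index E F p q J \<and>
        \<Psi> = wavelet_fun \<phi> \<psi> E F p q J \<and>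
        orthonormal_basis {0..1} (Lam I) (\<lambda>(j, k). \<Psi> j k) (L2 {0..1}) \<and>
        (\<exists>a>0. \<exists>b. \<forall>j. a * 2 ^ j \<le> real (card (I j)) \<and> real (card (I j)) \<le> b * 2 ^ j))"


section \<open>Density model\<close>

text \<open>
  For \<open>\<theta>\<close> in \<open>\<ell>\<^sup>2(\<Lambda>)\<close> the partial sums over \<open>j\<close> are orthogonal projections with uniformly localised
  kernels, so that the series converges almost everywhere on \<open>[0,1]\<close>, and to the \<open>L\<^sup>2\<close>-limit.
\<close>

definition synth ::
  "(nat \<Rightarrow> nat set) \<Rightarrow> (nat \<Rightarrow> nat \<Rightarrow> real \<Rightarrow> real) \<Rightarrow> (nat \<times> nat \<Rightarrow> real) \<Rightarrow> real \<Rightarrow> real" where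
  "synth I \<Psi> \<theta> x = (\<Sum>j. \<Sum>k\<in>I j. \<theta> (j, k) * \<Psi> j k x)"

definition unit_l2 :: "(nat \<Rightarrow> nat set) \<Rightarrow> (nat \<times> nat \<Rightarrow> real) set" where
  "unit_l2 I = {\<theta>. ((\<lambda>jk. (\<theta> jk)\<^sup>2) has_sum 1) (Lam I)}"

definition density_params ::
  "(nat \<Rightarrow> nat set) \<Rightarrow> (nat \<Rightarrow> nat \<Rightarrow> real \<Rightarrow> real) \<Rightarrow> (nat \<times> nat \<Rightarrow> real) set" where
  "density_params I \<Psi> = {\<theta> \<in> unit_l2 I. AE x in lborel. x \<in> {0..1} \<longrightarrow> synth I \<Psi> \<theta> x \<ge> 0}"

definition dens ::
  "(nat \<Rightarrow> nat set) \<Rightarrow> (nat \<Rightarrow> nat \<Rightarrow> real \<Rightarrow> real) \<Rightarrow> (nat \<times> nat \<Rightarrow> real) \<Rightarrow> real \<Rightarrow> real" where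
  "dens I \<Psi> \<theta> x = (synth I \<Psi> \<theta> x)\<^sup>2"

definition sample_law ::
  "(nat \<Rightarrow> nat set) \<Rightarrow> (nat \<Rightarrow> nat \<Rightarrow> real \<Rightarrow> real) \<Rightarrow> nat \<Rightarrow> (nat \<times> nat \<Rightarrow> real) \<Rightarrow> (nat \<Rightarrow> real) measure" where
  "sample_law I \<Psi> n \<theta> =
     PiM {..<n} (\<lambda>_. density (restrict_space lborel {0..1}) (\<lambda>x. ennreal (dens I \<Psi> \<theta> x)))"


section \<open>Loss and classes\<close>

definition loss_inf ::
  "(nat \<Rightarrow> nat set) \<Rightarrow> (nat \<times> nat \<Rightarrow> real) \<Rightarrow> (nat \<times> nat \<Rightarrow> real) \<Rightarrow> ennreal" where
  "loss_inf I \<theta> \<theta>' =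
     (\<Sum>j. ennreal (2 powr (real j / 2) * Max ((\<lambda>k. \<bar>\<theta> (j, k) - \<theta>' (j, k)\<bar>) ` I j)))"

definition H_class :: "(nat \<Rightarrow> nat set) \<Rightarrow> real \<Rightarrow> real \<Rightarrow> (nat \<times> nat \<Rightarrow> real) set" where
  "H_class I \<beta> L =
     {\<theta>. \<forall>(j, k) \<in> Lam I. \<bar>\<theta> (j, k)\<bar> \<le> L * 2 powr (- real j * (\<beta> + 1/2))}"

definition H'_class ::
  "(nat \<Rightarrow> nat set) \<Rightarrow> (nat \<Rightarrow> nat \<Rightarrow> real \<Rightarrow> real) \<Rightarrow> real \<Rightarrow> real \<Rightarrow> real \<Rightarrow> (nat \<times> nat \<Rightarrow> real) set" where
  "H'_class I \<Psi> c \<beta> L = {\<theta> \<in> H_class I \<beta> L \<inter> unit_l2 I. \<forall>x\<in>{0..1}. synth I \<Psi> \<theta> x > c}"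


section \<open>Sieve priors and posterior\<close>

definition sieve_prior ::
  "(nat \<Rightarrow> nat set) \<Rightarrow> (nat \<Rightarrow> nat \<Rightarrow> real \<Rightarrow> real) \<Rightarrow> (nat \<times> nat \<Rightarrow> real) pmf \<Rightarrow> bool" where
  "sieve_prior I \<Psi> \<pi> \<longleftrightarrow>
     (\<exists>\<theta>s. \<theta>s \<noteq> [] \<and> set \<theta>s \<subseteq> density_params I \<Psi> \<and>
           \<pi> = map_pmf (\<lambda>l. \<theta>s ! l) (pmf_of_set {..<length \<theta>s}))"

definition likelihood ::
  "(nat \<Rightarrow> nat set) \<Rightarrow> (nat \<Rightarrow> nat \<Rightarrow> real \<Rightarrow> real) \<Rightarrow> nat \<Rightarrow> (nat \<Rightarrow> real) \<Rightarrow> (nat \<times> nat \<Rightarrow> real) \<Rightarrow> real" where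
  "likelihood I \<Psi> n y \<theta> = (\<Prod>i<n. dens I \<Psi> \<theta> (y i))"

definition evidence ::
  "(nat \<Rightarrow> nat set) \<Rightarrow> (nat \<Rightarrow> nat \<Rightarrow> real \<Rightarrow> real) \<Rightarrow> (nat \<times> nat \<Rightarrow> real) pmf \<Rightarrow> nat \<Rightarrow> (nat \<Rightarrow> real) \<Rightarrow> ennreal" where
  "evidence I \<Psi> \<pi> n y = (\<integral>\<^sup>+\<theta>. ennreal (likelihood I \<Psi> n y \<theta>) \<partial>measure_pmf \<pi>)"

text \<open>
  Bayes' formula does not determine the posterior at samples where the evidence vanishes. The prior
  is used there, so that the posterior is a probability measure for every sample: reading \<open>0 / 0\<close>
  as \<open>0\<close> would give the null measure and make concentration statements vacuous for priors whose
  densities vanish on parts of \<open>[0,1]\<close>.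
\<close>

definition posterior ::
  "(nat \<Rightarrow> nat set) \<Rightarrow> (nat \<Rightarrow> nat \<Rightarrow> real \<Rightarrow> real) \<Rightarrow> (nat \<times> nat \<Rightarrow> real) pmf \<Rightarrow> nat \<Rightarrow> (nat \<Rightarrow> real)
     \<Rightarrow> (nat \<times> nat \<Rightarrow> real) measure" where
  "posterior I \<Psi> \<pi> n y =
     (if evidence I \<Psi> \<pi> n y = 0 then measure_pmf \<pi>
      else density (measure_pmf \<pi>)
             (\<lambda>\<theta>. ennreal (likelihood I \<Psi> n y \<theta>) / evidence I \<Psi> \<pi> n y))"

end

theory Submission
  imports Defs "HOL-Real_Asymp.Real_Asymp"
begin

text \<open>
  The points of the sieve are the vectors \<open>u\<close> whose coefficients lie on a grid of mesh
  \<open>\<delta> = 256 (log n / n)\<^bsup>1/2\<^esup>\<close> for levels up to \<open>J\<close>, where \<open>N = 2\<^bsup>J\<^esup>\<close> is about \<open>n\<^bsup>1/2\<^esup> / (log n)\<^bsup>4\<^esup>\<close>,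
  and vanish beyond, subject to \<open>synth u \<ge> c / 2\<close>; the corresponding parameter is \<open>u / \<parallel>u\<parallel>\<close>. None
  of this involves \<open>\<beta>\<close> or \<open>L\<close>. A grid this coarse thresholds by itself: a true coefficient below
  \<open>\<delta> / 2\<close> is rounded to \<open>0\<close>, and if every coefficient of \<open>u\<close> is close to the nearest
  grid value of the true one, then \<open>u\<close> is within \<open>\<Sum>\<^sub>j 2\<^bsup>j/2\<^esup> min \<delta> (L 2\<^bsup>-j(\<beta>+1/2)\<^esup>)\<close> of the truth
  up to a constant, which is the rate (\<open>truncated_decay_sum\<close>, \<open>good_loss\<close>).

  The point \<open>u\<close> receives prior weight proportional, up to a factor two, to
  \<open>\<parallel>u\<parallel>\<^bsup>2n\<^esup> exp (- n \<parallel>u\<parallel>\<^sup>2)\<close> (\<open>sieve_prior_exists\<close>). Its posterior weight is then proportional to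
  \<open>score u = exp (- n \<parallel>u\<parallel>\<^sup>2) \<Prod>\<^sub>i (synth u (y\<^sub>i))\<^sup>2\<close>, in which the normalisation has disappeared: it is
  the likelihood of a Poissonised sample. Coordinates can therefore be changed one at a time,
  with no normalisation to restore.

  It has to be shown that the points with a badly placed coordinate carry little score. This is done
  in two steps. Let \<open>a\<close> be the square root of the true density.

  A pairwise comparison with the grid point nearest to the truth bounds the expected square root
  of the ratio of scores by \<open>exp (n (7 \<parallel>center - a\<parallel>\<^sup>2 - \<parallel>u - a\<parallel>\<^sup>2 / 4))\<close>
  (\<open>root_ratio_moment\<close>). The sieve has at most \<open>exp (O (N log n))\<close> points, hence only points within
  \<open>O (N\<^bsup>1/2\<^esup> \<delta>)\<close> of \<open>a\<close> in \<open>L\<^sup>2\<close> matter. This is far from the desired rate, but it makes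
  the uniform distance \<open>O (N \<delta>)\<close>, which still tends to zero.

  Such a crude union bound cannot detect a single misplaced coordinate, since the number of points is
  exponential in \<open>N log n\<close> whereas one coordinate of size \<open>\<delta>\<close> changes the log-score only by
  \<open>O (log n)\<close>. Instead every remaining bad point \<open>u\<close> is compared with \<open>reset u\<close>, in which its worst bad
  coordinate is moved to the grid value nearest to the truth. As the map is injective once the
  coordinate and its old value are known (\<open>reset_sum_le\<close>), it suffices to show
  \<open>score u \<le> exp (- n \<delta>\<^sup>2 / 2) score (reset u)\<close> for all such \<open>u\<close> at once (\<open>score_reset\<close>). The
  log-ratio is governed by \<open>\<Sum>\<^sub>i \<Psi> (y\<^sub>i) / synth (reset u) (y\<^sub>i)\<close>. Its main part \<open>\<Sum>\<^sub>i \<Psi> (y\<^sub>i) / a (y\<^sub>i)\<close>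
  does not depend on \<open>u\<close>, so that a deviation of probability \<open>n\<^bsup>-16\<^esup>\<close> per coordinate is
  affordable (\<open>coarse_test_moment\<close>). The rest has small variance because \<open>reset u\<close> is
  uniformly close to \<open>a\<close>, and its deviations are so improbable that a union bound over the whole sieve is
  possible (\<open>fine_test_moment\<close>): this needs \<open>N\<^sup>2\<close> to be small compared with \<open>n\<close>. On the other hand, \<open>N\<close> must be large
  enough for the coefficients beyond level \<open>J\<close> to be below \<open>\<delta>\<close>. Both are possible because
  \<open>\<beta> > 1/2\<close>.

  For small \<open>n\<close> the constant \<open>M\<close> is chosen so large that the event in question has prior
  probability zero. If the sieve is empty, the prior is a point mass; that there is some parameter at all
  is shown by expanding the constant function (\<open>density_params_nonempty\<close>).
\<close>

section \<open>Bounded functions on the unit interval\<close>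

abbreviation unit_measure :: "real measure" where
  "unit_measure \<equiv> restrict_space lborel {0..1}"

lemma space_unit_measure [simp]: "space unit_measure = {0..1}"
  by (simp add: space_restrict_space)

lemma prob_space_unit_measure: "prob_space unit_measure"
  by (rule prob_spaceI) (simp add: emeasure_restrict_space)

interpretation unit_measure: prob_space unit_measure
  by (rule prob_space_unit_measure)

lemma measurable_unit_measure [measurable (raw)]:
  "f \<in> borel_measurable borel \<Longrightarrow> f \<in> borel_measurable unit_measure"
  by (simp add: measurable_restrict_space1)

lemma integrable_unit_bounded:
  fixes f :: "real \<Rightarrow> real"
  assumes [measurable]: "f \<in> borel_measurable borel" and "\<And>x. x \<in> {0..1} \<Longrightarrow> \<bar>f x\<bar> \<le> B"
  shows "integrable unit_measure f"
  by (rule unit_measure.integrable_const_bound[where B=B]) (auto intro!: AE_I2 assms)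

lemma L2_inner_unit: "L2_inner {0..1} f g = (\<integral>x. f x * g x \<partial>unit_measure)"
  unfolding L2_inner_def set_lebesgue_integral_def by (subst integral_restrict_space) auto

lemma integral_unit_mono:
  fixes f g :: "real \<Rightarrow> real"
  assumes "integrable unit_measure f" "integrable unit_measure g"
    and "\<And>x. x \<in> {0..1} \<Longrightarrow> f x \<le> g x"
  shows "(\<integral>x. f x \<partial>unit_measure) \<le> (\<integral>x. g x \<partial>unit_measure)"
  using assms by (intro integral_mono) auto

lemma integral_unit_cong:
  fixes f g :: "real \<Rightarrow> real"
  assumes "\<And>x. x \<in> {0..1} \<Longrightarrow> f x = g x"
  shows "(\<integral>x. f x \<partial>unit_measure) = (\<integral>x. g x \<partial>unit_measure)"
  using assms by (intro Bochner_Integration.integral_cong) auto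

section \<open>Wavelet systems\<close>

text \<open>
  The properties of the basis on which the statistical argument rests: size and locality of the levels, and
  orthonormality.
\<close>
locale wavelet_system =
  fixes I :: "nat \<Rightarrow> nat set" and \<Psi> :: "nat \<Rightarrow> nat \<Rightarrow> real \<Rightarrow> real" and C :: real
  assumes finite_level [simp, intro]: "finite (I j)"
    and level_nonempty: "I j \<noteq> {}"
    and card_level: "real (card (I j)) \<le> C * 2 ^ j"
    and wavelet_measurable [measurable]: "\<Psi> j k \<in> borel_measurable borel"
    and wavelet_sum_bound:
      "x \<in> {0..1} \<Longrightarrow> (\<Sum>k\<in>I j. \<bar>\<Psi> j k x\<bar>) \<le> C * 2 powr (real j / 2)"
    and wavelet_L1_bound:
      "k \<in> I j \<Longrightarrow> (\<integral>x. \<bar>\<Psi> j k x\<bar> \<partial>unit_measure) \<le> C * 2 powr (- real j / 2)"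
    and wavelet_orthonormal:
      "k \<in> I j \<Longrightarrow> k' \<in> I j' \<Longrightarrow>
        (\<integral>x. \<Psi> j k x * \<Psi> j' k' x \<partial>unit_measure) = (if j = j' \<and> k = k' then 1 else 0)"
    and one_le_C: "1 \<le> C"
begin

text \<open>
  The contribution of level \<open>j\<close> to the loss. The sum over \<open>j\<close> controls the supremum of the
  synthesised function, which is why this norm governs the likelihood as well.
\<close>
definition level_norm :: "(nat \<times> nat \<Rightarrow> real) \<Rightarrow> nat \<Rightarrow> real" where
  "level_norm v j = 2 powr (real j / 2) * Max ((\<lambda>k. \<bar>v (j, k)\<bar>) ` I j)"

lemma C_nonneg [simp]: "0 \<le> C" using one_le_C by simp

lemma coeff_le_Max:
  fixes v :: "nat \<times> nat \<Rightarrow> real"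
  shows "k \<in> I j \<Longrightarrow> \<bar>v (j, k)\<bar> \<le> Max ((\<lambda>k. \<bar>v (j, k)\<bar>) ` I j)"
  by (intro Max_ge) auto

lemma Max_coeff_nonneg:
  fixes v :: "nat \<times> nat \<Rightarrow> real"
  shows "0 \<le> Max ((\<lambda>k. \<bar>v (j, k)\<bar>) ` I j)"
proof -
  obtain k where "k \<in> I j" using level_nonempty by blast
  from coeff_le_Max[OF this, of v] show ?thesis by linarith
qed

lemma level_norm_nonneg: "0 \<le> level_norm v j"
  unfolding level_norm_def using Max_coeff_nonneg by simp

lemma level_norm_le:
  assumes "\<And>k. k \<in> I j \<Longrightarrow> 2 powr (real j / 2) * \<bar>v (j, k)\<bar> \<le> B"
  shows "level_norm v j \<le> B"
proof -
  have "Max ((\<lambda>k. \<bar>v (j, k)\<bar>) ` I j) \<in> (\<lambda>k. \<bar>v (j, k)\<bar>) ` I j"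
    by (rule Max_in) (auto simp: level_nonempty)
  then show ?thesis using assms unfolding level_norm_def by auto
qed

lemma coeff_le_level_norm: "k \<in> I j \<Longrightarrow> 2 powr (real j / 2) * \<bar>v (j, k)\<bar> \<le> level_norm v j"
  unfolding level_norm_def using coeff_le_Max by (simp add: mult_left_mono)

lemma level_norm_diff_le: "level_norm (\<lambda>p. v p - w p) j \<le> level_norm v j + level_norm w j"
proof (rule level_norm_le)
  fix k assume k: "k \<in> I j"
  have "2 powr (real j / 2) * \<bar>v (j,k) - w (j,k)\<bar>
      \<le> 2 powr (real j / 2) * \<bar>v (j,k)\<bar> + 2 powr (real j / 2) * \<bar>w (j,k)\<bar>"
    unfolding distrib_left[symmetric] by (intro mult_left_mono) auto
  then show "2 powr (real j / 2) * \<bar>v (j,k) - w (j,k)\<bar> \<le> level_norm v j + level_norm w j"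
    using coeff_le_level_norm[OF k, of v] coeff_le_level_norm[OF k, of w] by linarith
qed

lemma summable_level_norm_diff:
  assumes "summable (level_norm v)" "summable (level_norm w)"
  shows "summable (level_norm (\<lambda>p. v p - w p))"
  by (rule summable_comparison_test'[OF summable_add[OF assms], where N=0])
    (simp add: level_norm_nonneg level_norm_diff_le)

lemma level_sum_bound:
  assumes "x \<in> {0..1}"
  shows "(\<Sum>k\<in>I j. \<bar>v (j, k) * \<Psi> j k x\<bar>) \<le> C * level_norm v j"
proof -
  let ?m = "Max ((\<lambda>k. \<bar>v (j, k)\<bar>) ` I j)"
  have "(\<Sum>k\<in>I j. \<bar>v (j, k) * \<Psi> j k x\<bar>) \<le> (\<Sum>k\<in>I j. ?m * \<bar>\<Psi> j k x\<bar>)"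
    unfolding abs_mult by (intro sum_mono mult_right_mono coeff_le_Max abs_ge_zero)
  also have "\<dots> = ?m * (\<Sum>k\<in>I j. \<bar>\<Psi> j k x\<bar>)" by (simp add: sum_distrib_left)
  also have "\<dots> \<le> ?m * (C * 2 powr (real j / 2))"
    by (intro mult_left_mono wavelet_sum_bound assms Max_coeff_nonneg)
  finally show ?thesis by (simp add: level_norm_def mult_ac)
qed

lemma level_abs_bound:
  assumes "x \<in> {0..1}"
  shows "\<bar>\<Sum>k\<in>I j. v (j, k) * \<Psi> j k x\<bar> \<le> C * level_norm v j"
  using level_sum_bound[OF assms, of v j] sum_abs[of "\<lambda>k. v (j, k) * \<Psi> j k x" "I j"] by linarith

lemma wavelet_bound:
  assumes "x \<in> {0..1}" "k \<in> I j"
  shows "\<bar>\<Psi> j k x\<bar> \<le> C * 2 powr (real j / 2)"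
proof -
  have "\<bar>\<Psi> j k x\<bar> \<le> (\<Sum>k\<in>I j. \<bar>\<Psi> j k x\<bar>)"
    by (rule member_le_sum[OF assms(2)]) auto
  with wavelet_sum_bound[OF assms(1), of j] show ?thesis by linarith
qed

lemma synth_summable:
  assumes "summable (level_norm v)" "x \<in> {0..1}"
  shows "summable (\<lambda>j. \<bar>\<Sum>k\<in>I j. v (j, k) * \<Psi> j k x\<bar>)"
  by (rule summable_comparison_test'[OF summable_mult[OF assms(1), of C], where N=0])
    (use level_abs_bound[OF assms(2)] in simp)

lemma synth_sums:
  assumes "summable (level_norm v)" "x \<in> {0..1}"
  shows "(\<lambda>j. \<Sum>k\<in>I j. v (j, k) * \<Psi> j k x) sums synth I \<Psi> v x"
  unfolding synth_def by (rule summable_sums[OF summable_rabs_cancel[OF synth_summable[OF assms]]])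

lemma synth_bound:
  assumes "summable (level_norm v)" "x \<in> {0..1}"
  shows "\<bar>synth I \<Psi> v x\<bar> \<le> C * (\<Sum>j. level_norm v j)"
proof -
  have "\<bar>synth I \<Psi> v x\<bar> \<le> (\<Sum>j. \<bar>\<Sum>k\<in>I j. v (j, k) * \<Psi> j k x\<bar>)"
    unfolding synth_def by (rule summable_rabs[OF synth_summable[OF assms]])
  also have "\<dots> \<le> (\<Sum>j. C * level_norm v j)"
    by (rule suminf_le[OF level_abs_bound[OF assms(2)] synth_summable[OF assms] summable_mult[OF assms(1)]])
  also have "\<dots> = C * (\<Sum>j. level_norm v j)"
    by (rule suminf_mult[OF assms(1)])
  finally show ?thesis .
qed

lemma synth_diff:
  assumes "summable (level_norm v)" "summable (level_norm w)" "x \<in> {0..1}"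
  shows "synth I \<Psi> (\<lambda>p. v p - w p) x = synth I \<Psi> v x - synth I \<Psi> w x"
proof -
  have "(\<lambda>j. (\<Sum>k\<in>I j. v (j, k) * \<Psi> j k x) - (\<Sum>k\<in>I j. w (j, k) * \<Psi> j k x)) sums
      (synth I \<Psi> v x - synth I \<Psi> w x)"
    by (rule sums_diff[OF synth_sums[OF assms(1,3)] synth_sums[OF assms(2,3)]])
  then show ?thesis
    unfolding synth_def by (simp add: sums_iff left_diff_distrib sum_subtractf)
qed

lemma synth_scale:
  assumes "summable (level_norm v)" "x \<in> {0..1}"
  shows "synth I \<Psi> (\<lambda>p. a * v p) x = a * synth I \<Psi> v x"
  using sums_mult[OF synth_sums[OF assms], of a]
  unfolding synth_def by (simp add: sums_iff sum_distrib_left mult.assoc)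

lemma synth_measurable [measurable]: "synth I \<Psi> v \<in> borel_measurable borel"
  unfolding synth_def by measurable

text \<open>
  The series converges uniformly, hence it may be integrated term by term. Both the reconstruction of the
  coefficients and Parseval's identity are instances.
\<close>

lemma synth_inner_sums:
  assumes v: "summable (level_norm v)" and [measurable]: "g \<in> borel_measurable borel"
    and g: "\<And>x. x \<in> {0..1} \<Longrightarrow> \<bar>g x\<bar> \<le> B"
  shows "(\<lambda>j. \<Sum>k\<in>I j. v (j, k) * (\<integral>x. \<Psi> j k x * g x \<partial>unit_measure)) sums
      (\<integral>x. synth I \<Psi> v x * g x \<partial>unit_measure)"
proof -
  define F where "F j x = (\<Sum>k\<in>I j. v (j, k) * \<Psi> j k x) * g x" for j x
  have B: "0 \<le> B" using g[of 0] by auto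
  have F_bound: "\<bar>F j x\<bar> \<le> C * level_norm v j * B" if "x \<in> {0..1}" for j x
    unfolding F_def abs_mult using that
    by (intro mult_mono level_abs_bound g) (auto simp: level_norm_nonneg)
  have Fm [measurable]: "F j \<in> borel_measurable borel" for j unfolding F_def by measurable
  have Fint: "integrable unit_measure (F j)" for j
    by (rule integrable_unit_bounded[OF Fm F_bound])
  have sumB: "summable (\<lambda>j. C * level_norm v j * B)" by (rule summable_mult2[OF summable_mult[OF v]])
  have "(\<lambda>j. \<integral>x. F j x \<partial>unit_measure) sums (\<integral>x. (\<Sum>j. F j x) \<partial>unit_measure)"
  proof (rule sums_integral[OF Fint])
    show "AE x in unit_measure. summable (\<lambda>j. norm (F j x))"
    proof (rule AE_I2)
      fix x assume "x \<in> space unit_measure"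
      then have "x \<in> {0..1}" by simp
      with F_bound show "summable (\<lambda>j. norm (F j x))"
        by (intro summable_comparison_test'[OF sumB, where N=0]) auto
    qed
    have "(\<integral>x. norm (F j x) \<partial>unit_measure) \<le> C * level_norm v j * B" for j
      using integral_unit_mono[of "\<lambda>x. norm (F j x)" "\<lambda>x. C * level_norm v j * B"]
        Fint[of j] F_bound by (simp add: unit_measure.prob_space[simplified])
    then show "summable (\<lambda>j. \<integral>x. norm (F j x) \<partial>unit_measure)"
      by (intro summable_comparison_test'[OF sumB, where N=0]) auto
  qed
  moreover have "(\<Sum>j. F j x) = synth I \<Psi> v x * g x" if "x \<in> {0..1}" for x
    using sums_mult2[OF synth_sums[OF v that], of "g x"] unfolding F_def by (simp add: sums_iff)
  then have "(\<integral>x. (\<Sum>j. F j x) \<partial>unit_measure) = (\<integral>x. synth I \<Psi> v x * g x \<partial>unit_measure)"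
    by (rule integral_unit_cong)
  moreover have "(\<integral>x. F j x \<partial>unit_measure)
      = (\<Sum>k\<in>I j. v (j, k) * (\<integral>x. \<Psi> j k x * g x \<partial>unit_measure))" for j
  proof -
    have "integrable unit_measure (\<lambda>x. \<Psi> j k x * g x)" if "k \<in> I j" for k
      by (rule integrable_unit_bounded[where B="C * 2 powr (real j / 2) * B"])
        (auto simp: abs_mult intro!: mult_mono wavelet_bound that g)
    then have "(\<integral>x. (\<Sum>k\<in>I j. v (j, k) * (\<Psi> j k x * g x)) \<partial>unit_measure)
        = (\<Sum>k\<in>I j. v (j, k) * (\<integral>x. \<Psi> j k x * g x \<partial>unit_measure))"
      by (subst Bochner_Integration.integral_sum) auto
    then show ?thesis unfolding F_def by (simp add: sum_distrib_right mult.assoc)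
  qed
  ultimately show ?thesis by simp
qed

lemma synth_coeff:
  assumes v: "summable (level_norm v)" and k: "k \<in> I j"
  shows "(\<integral>x. synth I \<Psi> v x * \<Psi> j k x \<partial>unit_measure) = v (j, k)"
proof -
  have "(\<Sum>k'\<in>I j'. v (j', k') * (\<integral>x. \<Psi> j' k' x * \<Psi> j k x \<partial>unit_measure))
      = (if j' = j then v (j, k) else 0)" for j'
  proof -
    have "(\<Sum>k'\<in>I j'. v (j', k') * (\<integral>x. \<Psi> j' k' x * \<Psi> j k x \<partial>unit_measure))
        = (\<Sum>k'\<in>I j'. if k' = k then (if j' = j then v (j, k) else 0) else 0)"
      using k by (intro sum.cong) (auto simp: wavelet_orthonormal)
    then show ?thesis using k by (auto simp: sum.delta')
  qed
  then have "(\<lambda>j'. if j' = j then v (j, k) else 0) sums (\<integral>x. synth I \<Psi> v x * \<Psi> j k x \<partial>unit_measure)"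
    using synth_inner_sums[OF v wavelet_measurable wavelet_bound[OF _ k]] by simp
  moreover have "(\<lambda>j'. if j' = j then v (j, k) else 0) sums v (j, k)"
    using sums_single[of j "\<lambda>_. v (j, k)"] by simp
  ultimately show ?thesis by (rule sums_unique2)
qed

lemma synth_sq_sums:
  assumes v: "summable (level_norm v)"
  shows "(\<lambda>j. \<Sum>k\<in>I j. (v (j, k))\<^sup>2) sums (\<integral>x. (synth I \<Psi> v x)\<^sup>2 \<partial>unit_measure)"
proof -
  have "(\<integral>x. \<Psi> j k x * synth I \<Psi> v x \<partial>unit_measure) = v (j, k)" if "k \<in> I j" for j k
    using synth_coeff[OF v that] by (simp add: mult.commute)
  then show ?thesis
    using synth_inner_sums[OF v synth_measurable synth_bound[OF v]] by (simp add: power2_eq_square)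
qed

lemma parseval_synth:
  assumes v: "summable (level_norm v)" and s: "((\<lambda>p. (v p)\<^sup>2) has_sum s) (Lam I)"
  shows "(\<integral>x. (synth I \<Psi> v x)\<^sup>2 \<partial>unit_measure) = s"
proof -
  have "((\<lambda>j. \<Sum>k\<in>I j. (v (j, k))\<^sup>2) has_sum s) UNIV"
    by (rule has_sum_SigmaD[OF s[unfolded Lam_def]]) (auto intro!: has_sum_finite)
  from has_sum_imp_sums[OF this] synth_sq_sums[OF v] show ?thesis by (rule sums_unique2[symmetric])
qed

end

section \<open>Wavelet bases of the interval are wavelet systems\<close>

text \<open>
  Scaling function, wavelet and boundary functions all belong to this class, which gives uniform bounds
  on their size and support.
\<close>
definition bump :: "(real \<Rightarrow> real) \<Rightarrow> bool" where
  "bump g \<longleftrightarrow> continuous_on UNIV g \<and> compactly_supported g"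

lemma bump_measurable: "bump g \<Longrightarrow> g \<in> borel_measurable borel"
  unfolding bump_def by (auto intro: borel_measurable_continuous_onI)

lemma bump_bounds:
  assumes "bump g"
  obtains B S where "0 \<le> B" "0 \<le> S" "\<And>x. \<bar>g x\<bar> \<le> B" "\<And>x. \<bar>x\<bar> > S \<Longrightarrow> g x = 0"
proof -
  from assms obtain S where S: "\<And>x. \<bar>x\<bar> > S \<Longrightarrow> g x = 0"
    unfolding bump_def compactly_supported_def by blast
  have "compact (g ` {-\<bar>S\<bar>..\<bar>S\<bar>})"
    using assms unfolding bump_def
    by (intro compact_continuous_image) (auto intro: continuous_on_subset)
  then obtain B where B: "\<And>x. x \<in> {-\<bar>S\<bar>..\<bar>S\<bar>} \<Longrightarrow> \<bar>g x\<bar> \<le> B"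
    using compact_imp_bounded bounded_iff by (metis (no_types, lifting) imageI real_norm_def)
  have "\<bar>g x\<bar> \<le> \<bar>B\<bar>" for x
  proof (cases "\<bar>x\<bar> > \<bar>S\<bar>")
    case True then show ?thesis using S by simp
  next
    case False then have "x \<in> {-\<bar>S\<bar>..\<bar>S\<bar>}" by auto
    from B[OF this] show ?thesis by linarith
  qed
  then show thesis using S by (intro that[of "\<bar>B\<bar>" "\<bar>S\<bar>"]) auto
qed

lemma bump_family_bounds:
  assumes "finite G" "\<And>g. g \<in> G \<Longrightarrow> bump g"
  shows "\<exists>B S. 0 \<le> B \<and> 0 \<le> S \<and> (\<forall>g\<in>G. (\<forall>x. \<bar>g x\<bar> \<le> B) \<and> (\<forall>x. \<bar>x\<bar> > S \<longrightarrow> g x = 0))"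
  using assms
proof (induction G rule: finite_induct)
  case empty show ?case by (auto intro: exI[of _ 0])
next
  case (insert g G)
  then obtain B S where BS: "0 \<le> B" "0 \<le> S" "\<forall>g\<in>G. (\<forall>x. \<bar>g x\<bar> \<le> B) \<and> (\<forall>x. \<bar>x\<bar> > S \<longrightarrow> g x = 0)"
    by auto
  from insert.prems have "bump g" by simp
  then obtain B' S' where g: "0 \<le> B'" "0 \<le> S'" "\<And>x. \<bar>g x\<bar> \<le> B'" "\<And>x. \<bar>x\<bar> > S' \<Longrightarrow> g x = 0"
    by (rule bump_bounds) blast
  show ?case
    by (rule exI[of _ "max B B'"], rule exI[of _ "max S S'"]) (use BS g in \<open>auto simp: le_max_iff_disj\<close>)
qed

lemma bump_translate_span:
  assumes "bump g" "u \<in> translate_span g"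
  shows "bump u"
proof -
  from assms(2) obtain K :: "int set" and a where K: "finite K"
    and u: "u = (\<lambda>x. \<Sum>m\<in>K. a m * g (x - of_int m))"
    unfolding translate_span_def by blast
  from assms(1) have cg: "continuous_on UNIV g" by (simp add: bump_def)
  obtain S where S: "0 \<le> S" "\<And>x. \<bar>x\<bar> > S \<Longrightarrow> g x = 0" using bump_bounds[OF assms(1)] by metis
  have "continuous_on UNIV (\<lambda>x. g (x - of_int m))" for m :: int
    by (rule continuous_on_compose2[OF cg]) (auto intro: continuous_intros)
  then have "continuous_on UNIV u" unfolding u by (intro continuous_intros)
  moreover have "u x = 0" if x: "\<bar>x\<bar> > S + (\<Sum>m\<in>K. \<bar>of_int m\<bar>)" for x
    unfolding u
  proof (rule sum.neutral, rule ballI)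
    fix m assume "m \<in> K"
    then have "\<bar>of_int m :: real\<bar> \<le> (\<Sum>m\<in>K. \<bar>of_int m\<bar>)" by (intro member_le_sum) (auto simp: K)
    with x have "\<bar>x - of_int m\<bar> > S" by linarith
    then show "a m * g (x - of_int m) = 0" using S by simp
  qed
  then have "compactly_supported u" unfolding compactly_supported_def by blast
  ultimately show ?thesis by (simp add: bump_def)
qed

lemma bump_dilate: assumes "bump u" shows "bump (\<lambda>x. u (2 * x))"
proof -
  from assms have cu: "continuous_on UNIV u" by (simp add: bump_def)
  obtain S where S: "0 \<le> S" "\<And>x. \<bar>x\<bar> > S \<Longrightarrow> u x = 0" using bump_bounds[OF assms] by metis
  have "continuous_on UNIV (\<lambda>x. u (2 * x))"
    by (rule continuous_on_compose2[OF cu]) (auto intro: continuous_intros)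
  moreover have "\<forall>x. \<bar>x\<bar> > S \<longrightarrow> u (2 * x) = 0" using S by auto
  ultimately show ?thesis unfolding bump_def compactly_supported_def by blast
qed

lemma class_C_continuous: assumes "class_C r f" shows "continuous_on UNIV f"
proof (cases r)
  case 0 then show ?thesis using assms by (simp add: class_C_def)
next
  case (Suc r')
  then have "(deriv ^^ 0) f differentiable_on UNIV" using assms unfolding class_C_def by blast
  then show ?thesis by (simp add: differentiable_imp_continuous_on)
qed

text \<open>
  At most \<open>2 S + 1\<close> translates of a function supported in \<open>[-S, S]\<close> overlap at a given point.
\<close>
lemma card_nat_near:
  fixes y S :: real
  assumes "0 \<le> S"
  shows "finite {m::nat. \<bar>y - real m\<bar> \<le> S}" "real (card {m::nat. \<bar>y - real m\<bar> \<le> S}) \<le> 2 * S + 1"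
proof -
  let ?A = "{\<lceil>y - S\<rceil>..\<lfloor>y + S\<rfloor>}"
  have sub: "{m::nat. \<bar>y - real m\<bar> \<le> S} \<subseteq> nat ` ?A"
  proof
    fix m :: nat assume "m \<in> {m::nat. \<bar>y - real m\<bar> \<le> S}"
    then have "int m \<in> ?A" by (auto simp: ceiling_le_iff le_floor_iff)
    then show "m \<in> nat ` ?A" by (metis imageI nat_int)
  qed
  show "finite {m::nat. \<bar>y - real m\<bar> \<le> S}" by (rule finite_subset[OF sub]) auto
  have "card {m::nat. \<bar>y - real m\<bar> \<le> S} \<le> card (nat ` ?A)" by (rule card_mono[OF _ sub]) auto
  also have "\<dots> \<le> card ?A" by (rule card_image_le) auto
  finally have "real (card {m::nat. \<bar>y - real m\<bar> \<le> S}) \<le> real (card ?A)" by simp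
  also have "\<dots> \<le> 2 * S + 1"
    using assms by (simp add: of_nat_nat) linarith
  finally show "real (card {m::nat. \<bar>y - real m\<bar> \<le> S}) \<le> 2 * S + 1" .
qed

text \<open>
  One resolution level together with a common bound \<open>B\<close> and a common radius \<open>S\<close> of the supports
  of all its generators.
\<close>
locale bump_level =
  fixes g :: "real \<Rightarrow> real" and E :: edges and B S :: real
  assumes B0: "0 \<le> B" and S0: "0 \<le> S"
    and g_bump: "bump g" and E_bump: "\<And>uw. uw \<in> set E \<Longrightarrow> bump (fst uw) \<and> bump (snd uw)"
    and g_bd: "\<And>x. \<bar>g x\<bar> \<le> B" and g_supp: "\<And>x. \<bar>x\<bar> > S \<Longrightarrow> g x = 0"
    and E_bd: "\<And>uw x. uw \<in> set E \<Longrightarrow> \<bar>fst uw x\<bar> \<le> B \<and> \<bar>snd uw x\<bar> \<le> B"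
    and E_supp: "\<And>uw x. uw \<in> set E \<Longrightarrow> \<bar>x\<bar> > S \<Longrightarrow> fst uw x = 0 \<and> snd uw x = 0"
begin

lemma level_fun_measurable: "level_fun g E p i k \<in> borel_measurable borel"
proof -
  note [measurable] = bump_measurable[OF g_bump]
  show ?thesis
  proof (cases "k < length E")
    case True
    then have [measurable]: "fst (E ! k) \<in> borel_measurable borel" "snd (E ! k) \<in> borel_measurable borel"
      using E_bump[OF nth_mem[OF True]] by (auto intro: bump_measurable)
    show ?thesis using True unfolding level_fun_def[abs_def] edge_fun_def[abs_def] by simp
  next
    case False
    then show ?thesis unfolding level_fun_def[abs_def] by simp
  qed
qed

lemma edge_bound: "k < length E \<Longrightarrow> \<bar>level_fun g E p i k x\<bar> \<le> 2 * B * 2 powr (real i / 2)"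
  using E_bd[OF nth_mem, of k "2 ^ i * x"] E_bd[OF nth_mem, of k "2 ^ i * (x - 1)"]
  by (auto simp: level_fun_def edge_fun_def abs_mult intro: order_trans[OF abs_triangle_ineq])

lemma edge_zero:
  assumes "k < length E" "2 ^ i * x > S" "2 ^ i * (1 - x) > S"
  shows "level_fun g E p i k x = 0"
proof -
  have "\<bar>2 ^ i * x\<bar> > S" "\<bar>2 ^ i * (x - 1)\<bar> > S"
    using assms(2,3) by (auto simp: algebra_simps)
  then show ?thesis using E_supp[OF nth_mem[OF assms(1)]] assms(1)
    by (simp add: level_fun_def edge_fun_def)
qed

lemma interior_bound: "\<not> k < length E \<Longrightarrow> \<bar>level_fun g E p i k x\<bar> \<le> B * 2 powr (real i / 2)"
  using g_bd by (auto simp: level_fun_def abs_mult)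

lemma interior_zero:
  assumes "\<not> k < length E" "\<bar>2 ^ i * x - real (p + (k - length E))\<bar> > S"
  shows "level_fun g E p i k x = 0"
  using assms g_supp by (simp add: level_fun_def)

lemma level_fun_bound: "\<bar>level_fun g E p i k x\<bar> \<le> 2 * B * 2 powr (real i / 2)"
proof (cases "k < length E")
  case True then show ?thesis by (rule edge_bound)
next
  case False
  from interior_bound[OF this, of p i x] B0 show ?thesis
    by (simp add: mult_right_mono order_trans)
qed

lemma level_fun_sum_bound:
  "(\<Sum>k<m. \<bar>level_fun g E p i k x\<bar>) \<le> 2 * B * (real (length E) + 2 * S + 1) * 2 powr (real i / 2)"
proof -
  let ?A = "{m::nat. \<bar>(2 ^ i * x) - real m\<bar> \<le> S}"
  let ?K = "{..<length E} \<union> {k. length E \<le> k \<and> p + (k - length E) \<in> ?A}"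
  have fA: "finite ?A" by (rule card_nat_near[OF S0])
  have inj: "inj_on (\<lambda>k. p + (k - length E)) {k. length E \<le> k \<and> p + (k - length E) \<in> ?A}"
    by (auto simp: inj_on_def)
  have img: "(\<lambda>k. p + (k - length E)) ` {k. length E \<le> k \<and> p + (k - length E) \<in> ?A} \<subseteq> ?A" by blast
  have fK: "finite {k. length E \<le> k \<and> p + (k - length E) \<in> ?A}"
    using inj_on_finite[OF inj img fA] .
  have "card {k. length E \<le> k \<and> p + (k - length E) \<in> ?A} \<le> card ?A"
    by (rule card_inj_on_le[OF inj img fA])
  moreover have "card ?K \<le> card {..<length E} + card {k. length E \<le> k \<and> p + (k - length E) \<in> ?A}"
    by (rule card_Un_le)
  ultimately have cK: "real (card ?K) \<le> real (length E) + 2 * S + 1"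
    using card_nat_near(2)[OF S0, of "2 ^ i * x"] by simp
  have "(\<Sum>k<m. \<bar>level_fun g E p i k x\<bar>) = (\<Sum>k\<in>{..<m} \<inter> ?K. \<bar>level_fun g E p i k x\<bar>)"
    by (rule sum.mono_neutral_right) (auto simp: not_le intro!: interior_zero)
  also have "\<dots> \<le> (\<Sum>k\<in>?K. \<bar>level_fun g E p i k x\<bar>)"
    by (rule sum_mono2) (use fK in auto)
  also have "\<dots> \<le> (\<Sum>k\<in>?K. 2 * B * 2 powr (real i / 2))"
    by (rule sum_mono) (rule level_fun_bound)
  also have "\<dots> = real (card ?K) * (2 * B * 2 powr (real i / 2))" by simp
  also have "\<dots> \<le> (real (length E) + 2 * S + 1) * (2 * B * 2 powr (real i / 2))"
    by (rule mult_right_mono[OF cK]) (use B0 in auto)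
  finally show ?thesis by (simp only: mult_ac)
qed

lemma level_fun_L1_bound:
  "(\<integral>x. \<bar>level_fun g E p i k x\<bar> \<partial>unit_measure) \<le> 4 * B * S * 2 powr (- real i / 2)"
proof -
  define K where "K = 2 * B * 2 powr (real i / 2)"
  have K0: "0 \<le> K" using B0 by (simp add: K_def)
  obtain a1 b1 a2 b2 :: real where ab: "a1 \<le> b1" "a2 \<le> b2" "(b1 - a1) + (b2 - a2) = 2 * S / 2 ^ i"
    and supp: "\<And>x. x \<in> {0..1} \<Longrightarrow> x \<notin> {a1..b1} \<Longrightarrow> x \<notin> {a2..b2} \<Longrightarrow> level_fun g E p i k x = 0"
  proof (cases "k < length E")
    case True
    have "level_fun g E p i k x = 0" if "x \<in> {0..1}" "x \<notin> {0..S / 2 ^ i}" "x \<notin> {1 - S / 2 ^ i..1}" for x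
      by (rule edge_zero[OF True]) (use that in \<open>auto simp: field_simps\<close>)
    with S0 show ?thesis by (intro that[of 0 "S / 2 ^ i" "1 - S / 2 ^ i" 1]) auto
  next
    case False
    let ?m = "real (p + (k - length E))"
    have "level_fun g E p i k x = 0" if "x \<notin> {(?m - S) / 2 ^ i..(?m + S) / 2 ^ i}" for x
      by (rule interior_zero[OF False]) (use that in \<open>auto simp: field_simps\<close>)
    with S0 show ?thesis
      by (intro that[of "(?m - S) / 2 ^ i" "(?m + S) / 2 ^ i" 0 0])
        (auto simp: field_simps)
  qed
  have "(\<integral>x. \<bar>level_fun g E p i k x\<bar> \<partial>unit_measure)
      \<le> (\<integral>x. K * (indicator {a1..b1} x + indicator {a2..b2} x) \<partial>unit_measure)"
  proof (rule integral_unit_mono)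
    show "integrable unit_measure (\<lambda>x. \<bar>level_fun g E p i k x\<bar>)"
      by (rule integrable_unit_bounded[where B=K])
        (use level_fun_measurable level_fun_bound in \<open>auto simp: K_def\<close>)
    show "integrable unit_measure (\<lambda>x. K * (indicator {a1..b1} x + indicator {a2..b2} x))"
      by (rule integrable_unit_bounded[where B="K * 2"])
        (use K0 in \<open>auto simp: abs_mult indicator_def intro!: mult_left_mono\<close>)
    fix x :: real assume x: "x \<in> {0..1}"
    show "\<bar>level_fun g E p i k x\<bar> \<le> K * (indicator {a1..b1} x + indicator {a2..b2} x)"
    proof (cases "x \<in> {a1..b1} \<or> x \<in> {a2..b2}")
      case True
      then have "1 \<le> indicator {a1..b1} x + (indicator {a2..b2} x :: real)" by (auto simp: indicator_def)
      then have "K * 1 \<le> K * (indicator {a1..b1} x + indicator {a2..b2} x)" by (rule mult_left_mono[OF _ K0])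
      with level_fun_bound[of p i k x] show ?thesis by (simp add: K_def)
    next
      case False with supp[OF x] show ?thesis by auto
    qed
  qed
  also have "\<dots> \<le> (\<integral>x. K * (indicator {a1..b1} x + indicator {a2..b2} x) \<partial>lborel)"
  proof -
    let ?f = "\<lambda>x. K * (indicator {a1..b1} x + indicator {a2..b2} x) :: real"
    have i: "integrable lborel ?f"
      by (intro integrable_mult_right Bochner_Integration.integrable_add) (auto simp: integrable_indicator_iff emeasure_lborel_Icc_eq)
    have "(\<integral>x. ?f x \<partial>unit_measure) = (\<integral>x. indicator {0..1} x *\<^sub>R ?f x \<partial>lborel)"
      by (subst integral_restrict_space) auto
    also have "\<dots> \<le> (\<integral>x. ?f x \<partial>lborel)"
    proof (rule integral_mono[OF integrable_mult_indicator[OF _ i] i])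
      show "indicator {0..1} x *\<^sub>R ?f x \<le> ?f x" for x :: real
        using K0 by (auto simp: indicator_def)
    qed simp
    finally show ?thesis .
  qed
  also have "\<dots> = K * ((b1 - a1) + (b2 - a2))" using ab by simp
  also have "\<dots> = 4 * B * S * (2 powr (real i / 2) / 2 ^ i)" by (simp add: ab(3) K_def)
  also have "2 powr (real i / 2) / 2 ^ i = 2 powr (real i / 2) / 2 powr (real i)"
    by (simp add: powr_realpow)
  also have "\<dots> = 2 powr (- real i / 2)" by (simp flip: powr_diff)
  finally show ?thesis .
qed

end

lemma bump_level_exists:
  assumes "bump g" "\<And>uw. uw \<in> set E \<Longrightarrow> bump (fst uw) \<and> bump (snd uw)"
  obtains B S where "bump_level g E B S"
proof -
  have "\<exists>B S. 0 \<le> B \<and> 0 \<le> S \<and> (\<forall>h\<in>insert g (fst ` set E \<union> snd ` set E).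
      (\<forall>x. \<bar>h x\<bar> \<le> B) \<and> (\<forall>x. \<bar>x\<bar> > S \<longrightarrow> h x = 0))"
    by (rule bump_family_bounds) (use assms in auto)
  then obtain B S where "0 \<le> B" "0 \<le> S"
    "\<forall>h\<in>insert g (fst ` set E \<union> snd ` set E). (\<forall>x. \<bar>h x\<bar> \<le> B) \<and> (\<forall>x. \<bar>x\<bar> > S \<longrightarrow> h x = 0)"
    by blast
  then have "bump_level g E B S" using assms by unfold_locales auto
  then show thesis by (rule that)
qed

lemma interval_wavelet_basisE:
  assumes "interval_wavelet_basis r I \<Psi>"
  obtains \<phi> \<psi> E F p q J a b B S B' S' where
    "bump_level \<phi> E B S" "bump_level \<psi> F B' S'" "p + q \<le> 2 ^ J"
    "\<And>x. x < - real p \<or> x > real q + 1 \<Longrightarrow> \<psi> x = 0"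
    "I = wavelet_index E F p q J" "\<Psi> = wavelet_fun \<phi> \<psi> E F p q J"
    "orthonormal_basis {0..1} (Lam I) (\<lambda>(j, k). \<Psi> j k) (L2 {0..1})"
    "a > 0" "\<And>j. a * 2 ^ j \<le> real (card (I j))" "\<And>j. real (card (I j)) \<le> b * 2 ^ j"
proof -
  from assms obtain \<phi> \<psi> V E F p q J a b where
    mra: "regular_mra r \<phi> \<psi> V" and pq: "p + q \<le> 2 ^ J"
    and supp: "\<forall>x. x < - real p \<or> x > real q + 1 \<longrightarrow> \<phi> x = 0 \<and> \<psi> x = 0"
    and E: "\<forall>(u, w) \<in> set E. u \<in> translate_span \<phi> \<and> w \<in> translate_span \<phi>"
    and F: "\<forall>(u, w) \<in> set F. \<exists>u' \<in> translate_span \<phi>. \<exists>w' \<in> translate_span \<phi>.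
            u = (\<lambda>x. u' (2 * x)) \<and> w = (\<lambda>x. w' (2 * x))"
    and I: "I = wavelet_index E F p q J" and \<Psi>: "\<Psi> = wavelet_fun \<phi> \<psi> E F p q J"
    and onb: "orthonormal_basis {0..1} (Lam I) (\<lambda>(j, k). \<Psi> j k) (L2 {0..1})"
    and card: "a > 0" "\<forall>j. a * 2 ^ j \<le> real (card (I j)) \<and> real (card (I j)) \<le> b * 2 ^ j"
    unfolding interval_wavelet_basis_def Let_def by - (elim exE conjE, rule that, assumption+)
  from mra have \<phi>: "bump \<phi>" and \<psi>: "bump \<psi>"
    unfolding regular_mra_def bump_def by (auto intro: class_C_continuous)
  obtain B S where 1: "bump_level \<phi> E B S"
    by (rule bump_level_exists[OF \<phi>, of E]) (use E bump_translate_span[OF \<phi>] in fastforce)+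
  have "bump (fst uw) \<and> bump (snd uw)" if uw: "uw \<in> set F" for uw
  proof -
    obtain u w where uw': "uw = (u, w)" by (cases uw)
    with F uw obtain u' w' where "u' \<in> translate_span \<phi>" "w' \<in> translate_span \<phi>"
      "u = (\<lambda>x. u' (2 * x))" "w = (\<lambda>x. w' (2 * x))" by fast
    with uw' show ?thesis using bump_dilate bump_translate_span[OF \<phi>] by simp
  qed
  then obtain B' S' where 2: "bump_level \<psi> F B' S'" by (rule bump_level_exists[OF \<psi>, of F]) auto
  show thesis
    by (rule that[OF 1 2 pq _ I \<Psi> onb card(1)]) (use supp card(2) in auto)
qed

lemma sum_lessThan_add:
  fixes f :: "nat \<Rightarrow> real"
  shows "(\<Sum>k<a + b. f k) = (\<Sum>k<a. f k) + (\<Sum>k<b. f (a + k))"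
  by (induction b) (auto simp: algebra_simps)

lemma wavelet_system_of_interval_basis:
  assumes "interval_wavelet_basis r I \<Psi>"
  obtains C where "wavelet_system I \<Psi> C"
proof -
  from assms obtain \<phi> \<psi> E F p q J a b B S B' S' where
    lev: "bump_level \<phi> E B S" "bump_level \<psi> F B' S'" and
    "p + q \<le> 2 ^ J" "\<And>x. x < - real p \<or> x > real q + 1 \<Longrightarrow> \<psi> x = 0" and
    I: "I = wavelet_index E F p q J" and \<Psi>: "\<Psi> = wavelet_fun \<phi> \<psi> E F p q J" and
    onb: "orthonormal_basis {0..1} (Lam I) (\<lambda>(j, k). \<Psi> j k) (L2 {0..1})" and
    card: "a > 0" "\<And>j. a * 2 ^ j \<le> real (card (I j))" "\<And>j. real (card (I j)) \<le> b * 2 ^ j"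
    by (rule interval_wavelet_basisE) (rule that, assumption+)
  interpret \<phi>: bump_level \<phi> E B S by (rule lev)
  interpret \<psi>: bump_level \<psi> F B' S' by (rule lev)
  define D where "D = 2 * B * (real (length E) + 2 * S + 1)"
  define D' where "D' = 2 * B' * (real (length F) + 2 * S' + 1)"
  define P where "P = 2 powr (real J / 2)"
  have pos: "0 \<le> D" "0 \<le> D'" "0 \<le> 4 * B * S" "0 \<le> 4 * B' * S'" "1 \<le> P"
    using \<phi>.B0 \<phi>.S0 \<psi>.B0 \<psi>.S0 by (auto simp: D_def D'_def P_def intro!: mult_nonneg_nonneg ge_one_powr_ge_zero)
  have b: "0 \<le> b" using card(1) card(2)[of 0] card(3)[of 0] by simp
  define C where "C = 1 + b + (D + D') * P + 4 * B * S + 4 * B' * S'"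
  have DP: "0 \<le> (D + D') * P" using pos by simp
  have powJ: "2 powr (real (J + j) / 2) = P * 2 powr (real j / 2)" for j
    by (simp add: P_def add_divide_distrib flip: powr_add)
  have powJ': "2 powr (- real (J + j) / 2) \<le> 2 powr (- real j / 2)" for j by simp
  have sum_bd: "(\<Sum>k\<in>I j. \<bar>\<Psi> j k x\<bar>) \<le> (D + D') * P * 2 powr (real j / 2)" for j x
  proof (cases "j = 0")
    case True
    have "(\<Sum>k\<in>I j. \<bar>\<Psi> j k x\<bar>) = (\<Sum>k<level_size E p q J. \<bar>level_fun \<phi> E p J k x\<bar>)
        + (\<Sum>k<level_size F p q J. \<bar>level_fun \<psi> F p J k x\<bar>)"
      using True by (simp add: I \<Psi> wavelet_index_def wavelet_fun_def sum_lessThan_add)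
    also have "\<dots> \<le> D * P + D' * P"
      using \<phi>.level_fun_sum_bound \<psi>.level_fun_sum_bound unfolding D_def D'_def P_def
      by (intro add_mono) auto
    finally show ?thesis using True by (simp add: algebra_simps)
  next
    case False
    then have "(\<Sum>k\<in>I j. \<bar>\<Psi> j k x\<bar>) = (\<Sum>k<level_size F p q (J + j). \<bar>level_fun \<psi> F p (J + j) k x\<bar>)"
      by (simp add: I \<Psi> wavelet_index_def wavelet_fun_def)
    also have "\<dots> \<le> D' * 2 powr (real (J + j) / 2)" unfolding D'_def by (rule \<psi>.level_fun_sum_bound)
    also have "\<dots> = D' * P * 2 powr (real j / 2)" by (simp only: powJ mult.assoc)
    also have "\<dots> \<le> (D + D') * P * 2 powr (real j / 2)"
      using pos by (intro mult_right_mono) auto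
    finally show ?thesis .
  qed
  have L1: "(\<integral>x. \<bar>\<Psi> j k x\<bar> \<partial>unit_measure) \<le> (4 * B * S + 4 * B' * S') * 2 powr (- real j / 2)" for j k
  proof -
    consider (a) "j = 0" "k < level_size E p q J" | (b) k' where "\<Psi> j k = level_fun \<psi> F p (J + j) k'"
      unfolding \<Psi> wavelet_fun_def by (metis Nat.add_0_right)
    then show ?thesis
    proof cases
      case a
      then have "\<Psi> j k = level_fun \<phi> E p J k" by (simp add: \<Psi> wavelet_fun_def[abs_def])
      then have "(\<integral>x. \<bar>\<Psi> j k x\<bar> \<partial>unit_measure) \<le> 4 * B * S * 2 powr (- real J / 2)"
        using \<phi>.level_fun_L1_bound by simp
      also have "\<dots> \<le> 4 * B * S * 1" using pos powr_mono[of "- real J / 2" 0 "2::real"] by (intro mult_left_mono) auto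
      finally show ?thesis using a pos by simp
    next
      case b
      then have "(\<integral>x. \<bar>\<Psi> j k x\<bar> \<partial>unit_measure) \<le> 4 * B' * S' * 2 powr (- real (J + j) / 2)"
        by (simp only: \<psi>.level_fun_L1_bound)
      also have "\<dots> \<le> 4 * B' * S' * 2 powr (- real j / 2)"
        by (rule mult_left_mono[OF powJ']) (use pos in simp)
      also have "\<dots> \<le> (4 * B * S + 4 * B' * S') * 2 powr (- real j / 2)"
        by (rule mult_right_mono) (use pos in auto)
      finally show ?thesis .
    qed
  qed
  have "wavelet_system I \<Psi> C"
  proof
    show "finite (I j)" for j by (simp add: I wavelet_index_def)
    show "I j \<noteq> {}" for j
    proof
      assume "I j = {}"
      then have "a * 2 ^ j \<le> 0" using card(2)[of j] by simp
      moreover have "0 < a * 2 ^ j" using card(1) by simp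
      ultimately show False by linarith
    qed
    show "real (card (I j)) \<le> C * 2 ^ j" for j
      by (rule order_trans[OF card(3)], rule mult_right_mono) (use pos DP in \<open>auto simp: C_def\<close>)
    show "\<Psi> j k \<in> borel_measurable borel" for j k
      using \<phi>.level_fun_measurable \<psi>.level_fun_measurable
      by (simp add: \<Psi> wavelet_fun_def[abs_def])
    show "(\<Sum>k\<in>I j. \<bar>\<Psi> j k x\<bar>) \<le> C * 2 powr (real j / 2)" for j x
      by (rule order_trans[OF sum_bd], rule mult_right_mono) (use pos b in \<open>auto simp: C_def\<close>)
    show "(\<integral>x. \<bar>\<Psi> j k x\<bar> \<partial>unit_measure) \<le> C * 2 powr (- real j / 2)" for j k
      by (rule order_trans[OF L1], rule mult_right_mono) (use DP b in \<open>auto simp: C_def\<close>)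
    show "(\<integral>x. \<Psi> j k x * \<Psi> j' k' x \<partial>unit_measure) = (if j = j' \<and> k = k' then 1 else 0)"
      if "k \<in> I j" "k' \<in> I j'" for j k j' k'
    proof -
      have "(j, k) \<in> Lam I" "(j', k') \<in> Lam I" using that by (auto simp: Lam_def)
      with onb have "L2_inner {0..1} (\<Psi> j k) (\<Psi> j' k') = (if (j, k) = (j', k') then 1 else 0)"
        unfolding orthonormal_basis_def orthonormal_family_def by fast
      then show ?thesis by (simp add: L2_inner_unit)
    qed
    show "1 \<le> C" using pos b DP by (simp add: C_def)
  qed
  then show thesis by (rule that)
qed

section \<open>The uniform density\<close>

lemma powr_half_sq: "(2 powr (real m / 2))\<^sup>2 = 2 ^ m"
  unfolding power2_eq_square powr_add[symmetric] by (simp add: powr_realpow[symmetric])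

context wavelet_system
begin

text \<open>
  The coefficients of the constant function \<open>1\<close>.
\<close>
definition const_coeff :: "nat \<times> nat \<Rightarrow> real" where
  "const_coeff p = (\<integral>x. \<Psi> (fst p) (snd p) x \<partial>unit_measure)"

lemma wavelet_integrable: "k \<in> I j \<Longrightarrow> integrable unit_measure (\<Psi> j k)"
  by (rule integrable_unit_bounded[OF wavelet_measurable wavelet_bound])

lemma wavelet_prod_integrable:
  assumes "k \<in> I j" "k' \<in> I j'"
  shows "integrable unit_measure (\<lambda>x. \<Psi> j k x * \<Psi> j' k' x)"
proof (rule integrable_unit_bounded[where B="(C * 2 powr (real j / 2)) * (C * 2 powr (real j' / 2))"])
  fix x :: real assume "x \<in> {0..1}"
  then show "\<bar>\<Psi> j k x * \<Psi> j' k' x\<bar> \<le> (C * 2 powr (real j / 2)) * (C * 2 powr (real j' / 2))"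
    unfolding abs_mult using assms by (intro mult_mono wavelet_bound) auto
qed simp

lemma const_approx_sq:
  assumes K: "finite K" "K \<subseteq> Lam I"
  shows "(\<integral>x. (1 - (\<Sum>p\<in>K. a p * \<Psi> (fst p) (snd p) x))\<^sup>2 \<partial>unit_measure)
    = 1 - 2 * (\<Sum>p\<in>K. a p * const_coeff p) + (\<Sum>p\<in>K. (a p)\<^sup>2)"
proof -
  let ?e = "\<lambda>p x. \<Psi> (fst p) (snd p) x"
  have KI: "snd p \<in> I (fst p)" if "p \<in> K" for p using K that by (auto simp: Lam_def)
  have i1: "integrable unit_measure (\<lambda>x. a p * ?e p x)" if "p \<in> K" for p
    by (intro integrable_mult_right wavelet_integrable KI that)
  have i2: "integrable unit_measure (\<lambda>x. a p * a p' * (?e p x * ?e p' x))" if "p \<in> K" "p' \<in> K" for p p'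
    by (intro integrable_mult_right wavelet_prod_integrable KI that)
  have eq: "(1 - (\<Sum>p\<in>K. a p * ?e p x))\<^sup>2
      = 1 - 2 * (\<Sum>p\<in>K. a p * ?e p x) + (\<Sum>p\<in>K. \<Sum>p'\<in>K. a p * a p' * (?e p x * ?e p' x))" for x
  proof -
    have "(\<Sum>p\<in>K. a p * ?e p x)\<^sup>2 = (\<Sum>p\<in>K. \<Sum>p'\<in>K. a p * a p' * (?e p x * ?e p' x))"
      unfolding power2_eq_square sum_product by (simp add: mult_ac)
    then show ?thesis by (simp add: power2_diff)
  qed
  have orth: "(\<integral>x. ?e p x * ?e p' x \<partial>unit_measure) = (if p' = p then 1 else 0)" if "p \<in> K" "p' \<in> K" for p p'
    using wavelet_orthonormal[OF KI[OF that(1)] KI[OF that(2)]] by (auto simp: prod_eq_iff)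
  have "(\<integral>x. (1 - (\<Sum>p\<in>K. a p * ?e p x))\<^sup>2 \<partial>unit_measure)
      = 1 - 2 * (\<Sum>p\<in>K. a p * const_coeff p) + (\<Sum>p\<in>K. \<Sum>p'\<in>K. a p * a p' * (\<integral>x. ?e p x * ?e p' x \<partial>unit_measure))"
    unfolding eq using i1 i2
    by (simp add: const_coeff_def unit_measure.prob_space[simplified])
  also have "(\<Sum>p\<in>K. \<Sum>p'\<in>K. a p * a p' * (\<integral>x. ?e p x * ?e p' x \<partial>unit_measure))
      = (\<Sum>p\<in>K. \<Sum>p'\<in>K. if p' = p then a p * a p' else 0)"
    by (intro sum.cong refl) (simp add: orth)
  also have "\<dots> = (\<Sum>p\<in>K. (a p)\<^sup>2)"
    using K(1) by (simp add: sum.delta power2_eq_square)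
  finally show ?thesis .
qed

lemma const_coeff_residual:
  assumes "finite K" "K \<subseteq> Lam I"
  shows "(\<integral>x. (1 - (\<Sum>p\<in>K. const_coeff p * \<Psi> (fst p) (snd p) x))\<^sup>2 \<partial>unit_measure)
    = 1 - (\<Sum>p\<in>K. (const_coeff p)\<^sup>2)"
  using const_approx_sq[OF assms, of const_coeff] by (simp add: power2_eq_square)

lemma const_coeff_bessel:
  assumes "finite K" "K \<subseteq> Lam I"
  shows "(\<Sum>p\<in>K. (const_coeff p)\<^sup>2) \<le> 1"
proof -
  have "0 \<le> (\<integral>x. (1 - (\<Sum>p\<in>K. const_coeff p * \<Psi> (fst p) (snd p) x))\<^sup>2 \<partial>unit_measure)"
    by (rule Bochner_Integration.integral_nonneg) simp
  then show ?thesis using const_coeff_residual[OF assms] by simp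
qed

text \<open>
  The projection onto finitely many basis functions is the best approximation by their combinations, so that
  completeness forces the residual of the projections to vanish.
\<close>
lemma const_coeff_parseval:
  assumes "closed_span {0..1} (Lam I) (\<lambda>(j, k). \<Psi> j k) = L2 {0..1}"
  shows "((\<lambda>p. (const_coeff p)\<^sup>2) has_sum 1) (Lam I)"
proof -
  let ?S = "SUP F\<in>{F. finite F \<and> F \<subseteq> Lam I}. \<Sum>p\<in>F. (const_coeff p)\<^sup>2"
  have bdd: "bdd_above (sum (\<lambda>p. (const_coeff p)\<^sup>2) ` {F. F \<subseteq> Lam I \<and> finite F})"
    by (rule bdd_aboveI[where M=1]) (auto intro: const_coeff_bessel)
  have hs: "((\<lambda>p. (const_coeff p)\<^sup>2) has_sum ?S) (Lam I)"
    using nonneg_bdd_above_has_sum[OF _ bdd] by (simp add: conj_commute)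
  have ex: "\<exists>K. finite K \<and> K \<subseteq> Lam I \<and> 1 - (\<Sum>p\<in>K. (const_coeff p)\<^sup>2) < \<epsilon>" if e: "\<epsilon> > 0" for \<epsilon> :: real
  proof -
    have "set_integrable lborel {0..1::real} (\<lambda>x. 1\<^sup>2 :: real)"
      by (simp add: set_integrable_def)
    then have "(\<lambda>x. 1) \<in> L2 {0..1}" by (simp add: L2_def)
    then have "(\<lambda>x. 1) \<in> closed_span {0..1} (Lam I) (\<lambda>(j, k). \<Psi> j k)" using assms by simp
    then obtain K a where K: "finite K" "K \<subseteq> Lam I"
      and d: "L2_dist {0..1} (\<lambda>x. 1) (\<lambda>x. \<Sum>p\<in>K. a p * (case p of (j, k) \<Rightarrow> \<Psi> j k) x) < sqrt \<epsilon>"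
      unfolding closed_span_def using real_sqrt_gt_zero[OF e] by blast
    have "(\<integral>x. (1 - (\<Sum>p\<in>K. a p * \<Psi> (fst p) (snd p) x))\<^sup>2 \<partial>unit_measure) < \<epsilon>"
      using d unfolding L2_dist_def L2_inner_unit by (simp add: power2_eq_square case_prod_beta)
    moreover have "0 \<le> (\<Sum>p\<in>K. (a p - const_coeff p)\<^sup>2)" by (intro sum_nonneg) auto
    then have "1 - (\<Sum>p\<in>K. (const_coeff p)\<^sup>2)
        \<le> 1 - 2 * (\<Sum>p\<in>K. a p * const_coeff p) + (\<Sum>p\<in>K. (a p)\<^sup>2)"
      by (simp add: power2_diff sum.distrib sum_subtractf sum_distrib_left mult.assoc)
    ultimately show ?thesis using K const_approx_sq[OF K, of a] by (intro exI[of _ K]) auto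
  qed
  have "?S \<le> 1" by (rule cSUP_least) (auto intro: const_coeff_bessel)
  moreover have "1 \<le> ?S"
  proof (rule field_le_epsilon)
    fix \<epsilon> :: real assume "\<epsilon> > 0"
    then obtain K where K: "finite K" "K \<subseteq> Lam I" "1 - (\<Sum>p\<in>K. (const_coeff p)\<^sup>2) < \<epsilon>" using ex by blast
    have "(\<Sum>p\<in>K. (const_coeff p)\<^sup>2) \<le> ?S"
      by (rule cSUP_upper) (use K bdd in \<open>auto simp: conj_commute\<close>)
    with K show "1 \<le> ?S + \<epsilon>" by linarith
  qed
  ultimately have "?S = 1" by (rule antisym)
  then show ?thesis using hs by (simp only:)
qed

text \<open>
  Where the terms of the series eventually vanish it converges trivially; by Fatou's lemma its
  sum agrees almost everywhere with the limit in \<open>L\<^sup>2\<close> of the partial sums, which is \<open>1\<close>.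
\<close>
lemma const_coeff_density_params:
  assumes complete: "closed_span {0..1} (Lam I) (\<lambda>(j, k). \<Psi> j k) = L2 {0..1}"
    and vanish: "\<And>x. x \<in> {0<..<1} \<Longrightarrow> \<exists>j0. \<forall>j\<ge>j0. \<forall>k\<in>I j. const_coeff (j, k) * \<Psi> j k x = 0"
  shows "const_coeff \<in> density_params I \<Psi>"
proof -
  define S where "S m x = (\<Sum>j<m. \<Sum>k\<in>I j. const_coeff (j, k) * \<Psi> j k x)" for m x
  have Sm [measurable]: "S m \<in> borel_measurable borel" for m unfolding S_def by measurable
  have parseval: "((\<lambda>p. (const_coeff p)\<^sup>2) has_sum 1) (Lam I)" by (rule const_coeff_parseval[OF complete])
  have S_bound: "\<bar>S m x\<bar> \<le> (\<Sum>j<m. C * level_norm const_coeff j)" if "x \<in> {0..1}" for m x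
    unfolding S_def by (rule order_trans[OF sum_abs], rule sum_mono, rule level_abs_bound[OF that])
  have S_res: "(\<integral>x. (1 - S m x)\<^sup>2 \<partial>unit_measure) = 1 - (\<Sum>j<m. \<Sum>k\<in>I j. (const_coeff (j, k))\<^sup>2)" for m
  proof -
    let ?K = "SIGMA j:{..<m}. I j"
    have K: "finite ?K" "?K \<subseteq> Lam I" by (auto simp: Lam_def)
    have "S m x = (\<Sum>p\<in>?K. const_coeff p * \<Psi> (fst p) (snd p) x)" for x
      unfolding S_def by (subst sum.Sigma) (auto simp: case_prod_beta)
    moreover have "(\<Sum>j<m. \<Sum>k\<in>I j. (const_coeff (j, k))\<^sup>2) = (\<Sum>p\<in>?K. (const_coeff p)\<^sup>2)"
      by (subst sum.Sigma) (auto simp: case_prod_beta)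
    ultimately show ?thesis using const_coeff_residual[OF K] by simp
  qed
  have "((\<lambda>j. \<Sum>k\<in>I j. (const_coeff (j, k))\<^sup>2) has_sum 1) UNIV"
    by (rule has_sum_SigmaD[OF parseval[unfolded Lam_def]]) (auto intro!: has_sum_finite)
  then have "(\<lambda>m. \<Sum>j<m. \<Sum>k\<in>I j. (const_coeff (j, k))\<^sup>2) \<longlonglongrightarrow> 1"
    using has_sum_imp_sums sums_def by blast
  then have "(\<lambda>m. 1 - (\<Sum>j<m. \<Sum>k\<in>I j. (const_coeff (j, k))\<^sup>2)) \<longlonglongrightarrow> 1 - 1"
    by (intro tendsto_diff tendsto_const)
  then have res0: "(\<lambda>m. \<integral>x. (1 - S m x)\<^sup>2 \<partial>unit_measure) \<longlonglongrightarrow> 0" by (simp add: S_res)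
  have S_lim: "(\<lambda>m. S m x) \<longlonglongrightarrow> synth I \<Psi> const_coeff x" if x: "x \<in> {0<..<1}" for x
  proof -
    obtain j0 where j0: "\<And>j k. j \<ge> j0 \<Longrightarrow> k \<in> I j \<Longrightarrow> const_coeff (j, k) * \<Psi> j k x = 0" using vanish[OF x] by blast
    have "summable (\<lambda>j. \<Sum>k\<in>I j. const_coeff (j, k) * \<Psi> j k x)"
      by (rule summable_finite[of "{..<j0}"]) (auto simp: not_less j0)
    then show ?thesis unfolding S_def synth_def by (rule summable_LIMSEQ)
  qed
  have "(\<integral>\<^sup>+x. ennreal ((1 - synth I \<Psi> const_coeff x)\<^sup>2) \<partial>unit_measure)
      = (\<integral>\<^sup>+x. liminf (\<lambda>m. ennreal ((1 - S m x)\<^sup>2)) \<partial>unit_measure)"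
  proof (rule nn_integral_cong_AE)
    have "AE x in lborel. x \<noteq> (0::real) \<and> x \<noteq> 1"
      using AE_lborel_singleton[of 0] AE_lborel_singleton[of 1] by eventually_elim auto
    then have "AE x in unit_measure. x \<in> {0<..<1::real}"
      by (subst AE_restrict_space_iff) auto
    then show "AE x in unit_measure. ennreal ((1 - synth I \<Psi> const_coeff x)\<^sup>2)
        = liminf (\<lambda>m. ennreal ((1 - S m x)\<^sup>2))"
    proof eventually_elim
      case (elim x)
      have "(\<lambda>m. ennreal ((1 - S m x)\<^sup>2)) \<longlonglongrightarrow> ennreal ((1 - synth I \<Psi> const_coeff x)\<^sup>2)"
        by (intro tendsto_ennrealI tendsto_power tendsto_diff tendsto_const S_lim[OF elim])
      then show ?case using lim_imp_Liminf[OF sequentially_bot] by metis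
    qed
  qed
  also have "\<dots> \<le> liminf (\<lambda>m. \<integral>\<^sup>+x. ennreal ((1 - S m x)\<^sup>2) \<partial>unit_measure)"
    by (rule nn_integral_liminf) measurable
  also have "(\<lambda>m. \<integral>\<^sup>+x. ennreal ((1 - S m x)\<^sup>2) \<partial>unit_measure) = (\<lambda>m. ennreal (\<integral>x. (1 - S m x)\<^sup>2 \<partial>unit_measure))"
  proof
    fix m
    have "integrable unit_measure (\<lambda>x. (1 - S m x)\<^sup>2)"
    proof (rule integrable_unit_bounded[where B="(1 + (\<Sum>j<m. C * level_norm const_coeff j))\<^sup>2"])
      fix x :: real assume "x \<in> {0..1}"
      from S_bound[OF this, of m] show "\<bar>(1 - S m x)\<^sup>2\<bar> \<le> (1 + (\<Sum>j<m. C * level_norm const_coeff j))\<^sup>2"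
        unfolding power_abs power2_abs by (intro abs_le_square_iff[THEN iffD1]) auto
    qed measurable
    then show "(\<integral>\<^sup>+x. ennreal ((1 - S m x)\<^sup>2) \<partial>unit_measure) = ennreal (\<integral>x. (1 - S m x)\<^sup>2 \<partial>unit_measure)"
      by (intro nn_integral_eq_integral) auto
  qed
  also have "liminf \<dots> = 0"
    using lim_imp_Liminf[OF sequentially_bot tendsto_ennrealI[OF res0]] by simp
  finally have "(\<integral>\<^sup>+x. ennreal ((1 - synth I \<Psi> const_coeff x)\<^sup>2) \<partial>unit_measure) = 0" by simp
  then have "AE x in unit_measure. ennreal ((1 - synth I \<Psi> const_coeff x)\<^sup>2) = 0"
    by (subst (asm) nn_integral_0_iff_AE) measurable
  then have "AE x in unit_measure. synth I \<Psi> const_coeff x \<ge> 0" by eventually_elim auto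
  then have "AE x in lborel. x \<in> {0..1} \<longrightarrow> synth I \<Psi> const_coeff x \<ge> 0"
    by (subst (asm) AE_restrict_space_iff) auto
  with parseval show ?thesis by (simp add: density_params_def unit_l2_def)
qed

end

text \<open>
  All interior wavelets of a level have the same coefficient \<open>2\<^bsup>-i/2\<^esup> \<integral>\<psi>\<close>, and there are about \<open>2\<^bsup>i\<^esup>\<close>
  of them. If \<open>\<integral>\<psi>\<close> were not zero, the sum of the squares would be bounded below on every level, against
  Bessel's inequality. Hence only boundary functions contribute, and they vanish at any
  fixed inner point for large levels.
\<close>
lemma density_params_nonempty:
  assumes "interval_wavelet_basis r I \<Psi>"
  shows "density_params I \<Psi> \<noteq> {}"
proof -
  from assms obtain \<phi> \<psi> E F p q J a b B S B' S' where
    lev: "bump_level \<phi> E B S" "bump_level \<psi> F B' S'" and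
    pq: "p + q \<le> 2 ^ J" and supp: "\<And>x. x < - real p \<or> x > real q + 1 \<Longrightarrow> \<psi> x = 0" and
    I: "I = wavelet_index E F p q J" and \<Psi>: "\<Psi> = wavelet_fun \<phi> \<psi> E F p q J" and
    onb: "orthonormal_basis {0..1} (Lam I) (\<lambda>(j, k). \<Psi> j k) (L2 {0..1})" and
    card: "a > 0" "\<And>j. a * 2 ^ j \<le> real (card (I j))" "\<And>j. real (card (I j)) \<le> b * 2 ^ j"
    by (rule interval_wavelet_basisE) (rule that, assumption+)
  obtain C where "wavelet_system I \<Psi> C" using wavelet_system_of_interval_basis[OF assms] .
  then interpret wavelet_system I \<Psi> C .
  interpret \<psi>: bump_level \<psi> F B' S' by (rule lev)
  define c0 where "c0 = (\<integral>x. \<psi> x \<partial>lborel)"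
  have \<Psi>_level: "\<Psi> j k = level_fun \<psi> F p (J + j) k" if "1 \<le> j" for j k
    using that by (simp add: \<Psi> wavelet_fun_def[abs_def])
  have I_level: "I j = {..<length F + (2 ^ (J + j) - p - q)}" if "1 \<le> j" for j
    using that by (simp add: I wavelet_index_def level_size_def)
  have interior: "const_coeff (j, length F + l) = 2 powr (real (J + j) / 2) * c0 / 2 ^ (J + j)"
    if j: "1 \<le> j" and l: "l < 2 ^ (J + j) - p - q" for j l
  proof -
    let ?i = "J + j" and ?m = "real (p + l)"
    let ?f = "\<lambda>x. 2 powr (real ?i / 2) * \<psi> (2 ^ ?i * x - ?m)"
    have lr: "?m + real q + 1 \<le> 2 ^ ?i"
    proof -
      have "p + l + q + 1 \<le> 2 ^ ?i" using l by linarith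
      then have "real (p + l + q + 1) \<le> real (2 ^ ?i)" by (rule of_nat_mono)
      then show ?thesis by simp
    qed
    have out: "?f x = 0" if "x \<notin> {0..1}" for x
    proof (cases "x < 0")
      case True
      then have "2 ^ ?i * x < 0" by (simp add: mult_less_0_iff)
      then have "2 ^ ?i * x - ?m < - real p" by simp
      then show ?thesis using supp by simp
    next
      case False
      with that have "2 ^ ?i * 1 < 2 ^ ?i * x" by simp
      with lr have "2 ^ ?i * x - ?m > real q + 1" by linarith
      then show ?thesis using supp by simp
    qed
    have "const_coeff (j, length F + l) = (\<integral>x. ?f x \<partial>unit_measure)"
      by (simp add: const_coeff_def \<Psi>_level[OF j] level_fun_def)
    also have "\<dots> = (\<integral>x. indicator {0..1} x *\<^sub>R ?f x \<partial>lborel)"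
      by (subst integral_restrict_space) auto
    also have "\<dots> = (\<integral>x. ?f x \<partial>lborel)"
      by (rule Bochner_Integration.integral_cong) (use out in \<open>auto simp: indicator_def\<close>)
    also have "\<dots> = 2 powr (real ?i / 2) * (\<integral>x. \<psi> (2 ^ ?i * x - ?m) \<partial>lborel)" by simp
    also have "c0 = 2 ^ ?i * (\<integral>x. \<psi> (2 ^ ?i * x - ?m) \<partial>lborel)"
      using lborel_integral_real_affine[of "2 ^ ?i" \<psi> "- ?m"]
      unfolding c0_def uminus_add_conv_diff by simp
    then have "(\<integral>x. \<psi> (2 ^ ?i * x - ?m) \<partial>lborel) = c0 / 2 ^ ?i" by simp
    finally show ?thesis by simp
  qed
  have c0: "c0 = 0"
  proof (rule ccontr)
    assume "c0 \<noteq> 0"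
    then have pos: "c0\<^sup>2 / 2 > 0" by simp
    obtain M :: nat where M: "1 < real M * (c0\<^sup>2 / 2)" using reals_Archimedean3[OF pos] by blast
    let ?K = "SIGMA j:{1..M}. (\<lambda>l. length F + l) ` {..<2 ^ (J + j) - p - q}"
    have "?K \<subseteq> Lam I" by (auto simp: Lam_def I_level)
    moreover have "finite ?K" by auto
    ultimately have "(\<Sum>p\<in>?K. (const_coeff p)\<^sup>2) \<le> 1" by (intro const_coeff_bessel)
    moreover have "(\<Sum>p\<in>?K. (const_coeff p)\<^sup>2)
        = (\<Sum>j\<in>{1..M}. \<Sum>k\<in>(\<lambda>l. length F + l) ` {..<2 ^ (J + j) - p - q}. (const_coeff (j, k))\<^sup>2)"
      by (subst sum.Sigma) (auto simp: case_prod_beta)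
    moreover have "c0\<^sup>2 / 2 \<le> (\<Sum>k\<in>(\<lambda>l. length F + l) ` {..<2 ^ (J + j) - p - q}. (const_coeff (j, k))\<^sup>2)"
      if "j \<in> {1..M}" for j
    proof -
      let ?i = "J + j"
      have j: "1 \<le> j" using that by simp
      have "(2::nat) ^ Suc J \<le> 2 ^ ?i" using j by (intro power_increasing) auto
      then have "2 * (p + q) \<le> 2 ^ ?i" using pq by simp
      then have cnt: "2 ^ ?i \<le> 2 * (2 ^ ?i - p - q)"
        by (simp only: diff_diff_left) arith
      have "real (2 ^ ?i) \<le> real (2 * (2 ^ ?i - p - q))" by (rule of_nat_mono[OF cnt])
      then have half: "2 ^ ?i / 2 \<le> real (2 ^ ?i - p - q)" by simp
      have sq: "(2 powr (real ?i / 2) * c0 / 2 ^ ?i)\<^sup>2 = c0\<^sup>2 / 2 ^ ?i"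
      proof -
        have "(2 powr (real ?i / 2))\<^sup>2 = 2 ^ ?i"
          by (rule powr_half_sq)
        then show ?thesis by (simp add: power_divide power_mult_distrib power2_eq_square[of "2 ^ ?i"])
      qed
      have "(\<Sum>k\<in>(\<lambda>l. length F + l) ` {..<2 ^ ?i - p - q}. (const_coeff (j, k))\<^sup>2)
          = (\<Sum>l<2 ^ ?i - p - q. (const_coeff (j, length F + l))\<^sup>2)"
        by (subst sum.reindex) (auto simp: inj_on_def)
      also have "\<dots> = (\<Sum>l<2 ^ ?i - p - q. c0\<^sup>2 / 2 ^ ?i)"
        by (rule sum.cong[OF refl]) (simp only: interior[OF j] lessThan_iff sq)
      also have "\<dots> = real (2 ^ ?i - p - q) * (c0\<^sup>2 / 2 ^ ?i)" by simp
      also have "\<dots> \<ge> (2 ^ ?i / 2) * (c0\<^sup>2 / 2 ^ ?i)" by (rule mult_right_mono[OF half]) simp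
      finally show ?thesis by simp
    qed
    then have "(\<Sum>j\<in>{1..M}. c0\<^sup>2 / 2)
        \<le> (\<Sum>j\<in>{1..M}. \<Sum>k\<in>(\<lambda>l. length F + l) ` {..<2 ^ (J + j) - p - q}. (const_coeff (j, k))\<^sup>2)"
      by (rule sum_mono)
    ultimately show False using M by simp
  qed
  have "const_coeff \<in> density_params I \<Psi>"
  proof (rule const_coeff_density_params)
    show "closed_span {0..1} (Lam I) (\<lambda>(j, k). \<Psi> j k) = L2 {0..1}"
      using onb by (simp add: orthonormal_basis_def)
    fix x :: real assume x: "x \<in> {0<..<1}"
    define y where "y = min x (1 - x)"
    have y: "0 < y" "y \<le> x" "y \<le> 1 - x" using x by (auto simp: y_def)
    obtain j0 where j0: "S' / y < 2 ^ j0" using real_arch_pow[of 2 "S' / y"] by auto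
    have "const_coeff (j, k) * \<Psi> j k x = 0" if j: "j \<ge> Suc j0" and k: "k \<in> I j" for j k
    proof (cases "k < length F")
      case True
      have "(2::real) ^ j0 \<le> 2 ^ (J + j)" using j by (intro power_increasing) auto
      then have "S' / y < 2 ^ (J + j)" using j0 by linarith
      then have S': "S' < 2 ^ (J + j) * y" using y(1) by (simp add: divide_less_eq)
      have "S' < 2 ^ (J + j) * x" "S' < 2 ^ (J + j) * (1 - x)"
        using less_le_trans[OF S' mult_left_mono[OF y(2)]] less_le_trans[OF S' mult_left_mono[OF y(3)]] by auto
      then show ?thesis using \<psi>.edge_zero[OF True] j by (simp add: \<Psi>_level)
    next
      case False
      define l where "l = k - length F"
      have "k = length F + l" "l < 2 ^ (J + j) - p - q" using False k j by (auto simp: l_def I_level)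
      then have "const_coeff (j, k) = 0" using interior[of j l] j c0 by simp
      then show ?thesis by simp
    qed
    then show "\<exists>j0. \<forall>j\<ge>j0. \<forall>k\<in>I j. const_coeff (j, k) * \<Psi> j k x = 0" by blast
  qed
  then show ?thesis by blast
qed

section \<open>Finitely supported coefficient vectors\<close>

lemma exp_le_quadratic:
  fixes x :: real
  assumes "x \<le> 1"
  shows "exp x \<le> 1 + x + x\<^sup>2"
proof (cases "0 \<le> x")
  case True with assms show ?thesis by (intro exp_bound) auto
next
  case False
  define z where "z = - x"
  have z: "z > 0" using False by (simp add: z_def)
  have "exp z \<ge> 1 + z + z\<^sup>2 / 2" using z by (intro exp_lower_Taylor_quadratic) simp
  then have "exp (- z) \<le> 1 / (1 + z + z\<^sup>2 / 2)"
    using z by (simp add: exp_minus inverse_eq_divide frac_le add_pos_nonneg)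
  also have "\<dots> \<le> 1 - z + z\<^sup>2"
  proof -
    have "1 \<le> (1 - z + z\<^sup>2) * (1 + z + z\<^sup>2 / 2)"
    proof -
      have "(1 - z + z\<^sup>2) * (1 + z + z\<^sup>2 / 2) = 1 + z\<^sup>2 / 2 + z ^ 3 / 2 + z ^ 4 / 2"
        by (simp add: field_simps power2_eq_square power3_eq_cube power4_eq_xxxx)
      then show ?thesis using z by simp
    qed
    moreover have "0 < 1 + z + z\<^sup>2 / 2" using z by (simp add: add_pos_nonneg)
    ultimately show ?thesis by (simp add: divide_le_eq)
  qed
  finally show ?thesis by (simp add: z_def)
qed

lemma sum_sqrt2_powers:
  "(\<Sum>j\<le>J. 2 powr (real j / 2)) \<le> 4 * 2 powr (real J / 2)"
proof (induction J)
  case 0 show ?case by simp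
next
  case (Suc J)
  have e: "2 powr (real (Suc J) / 2) = sqrt 2 * 2 powr (real J / 2)"
    by (simp add: add_divide_distrib powr_add powr_half_sqrt)
  have "4 \<le> 3 * sqrt 2"
    using real_le_rsqrt[of "4/3" 2] by (simp add: power2_eq_square)
  then have "4 * 2 powr (real J / 2) \<le> (3 * sqrt 2) * 2 powr (real J / 2)"
    by (rule mult_right_mono) simp
  moreover have "(\<Sum>j\<le>Suc J. 2 powr (real j / 2)) = (\<Sum>j\<le>J. 2 powr (real j / 2)) + 2 powr (real (Suc J) / 2)"
    by simp
  ultimately show ?case using Suc e by linarith
qed

lemma sq_le_sq: "\<bar>x\<bar> \<le> B \<Longrightarrow> x\<^sup>2 \<le> B\<^sup>2" for x B :: real
  by (rule abs_le_square_iff[THEN iffD1]) auto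

context wavelet_system
begin

definition indices :: "nat \<Rightarrow> (nat \<times> nat) set" where
  "indices J = (SIGMA j:{..J}. I j)"

lemma finite_indices [simp, intro]: "finite (indices J)"
  by (simp add: indices_def)

lemma indices_iff: "(j, k) \<in> indices J \<longleftrightarrow> j \<le> J \<and> k \<in> I j"
  by (simp add: indices_def)

lemma indices_subset: "indices J \<subseteq> Lam I"
  by (auto simp: indices_def Lam_def)

lemma card_indices: "real (card (indices J)) \<le> 2 * C * 2 ^ J"
proof -
  have "real (card (indices J)) = (\<Sum>j\<le>J. real (card (I j)))"
    by (simp add: indices_def card_SigmaI)
  also have "\<dots> \<le> (\<Sum>j\<le>J. C * 2 ^ j)" by (rule sum_mono) (rule card_level)
  also have "\<dots> = C * (\<Sum>j\<le>J. 2 ^ j)" by (simp add: sum_distrib_left)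
  also have "\<dots> \<le> C * (2 * 2 ^ J)"
  proof (rule mult_left_mono)
    show "(\<Sum>j\<le>J. (2::real) ^ j) \<le> 2 * 2 ^ J" by (induction J) auto
  qed simp
  finally show ?thesis by (simp add: mult_ac)
qed

definition supported :: "nat \<Rightarrow> (nat \<times> nat \<Rightarrow> real) \<Rightarrow> bool" where
  "supported J u \<longleftrightarrow> (\<forall>p. p \<notin> indices J \<longrightarrow> u p = 0)"

lemma level_norm_supported:
  assumes "supported J u" "J < j"
  shows "level_norm u j = 0"
proof (rule antisym[OF level_norm_le level_norm_nonneg])
  fix k show "2 powr (real j / 2) * \<bar>u (j, k)\<bar> \<le> 0"
    using assms by (simp add: supported_def indices_iff)
qed

lemma summable_supported:
  assumes "supported J u" shows "summable (level_norm u)"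
  by (rule summable_finite[of "{..J}"]) (use level_norm_supported[OF assms] in auto)

lemma has_sum_supported:
  assumes "supported J u"
  shows "((\<lambda>p. (u p)\<^sup>2) has_sum (\<Sum>p\<in>indices J. (u p)\<^sup>2)) (Lam I)"
proof -
  have "((\<lambda>p. (u p)\<^sup>2) has_sum (\<Sum>p\<in>indices J. (u p)\<^sup>2)) (indices J)" by (rule has_sum_finite) simp
  then show ?thesis
    by (subst has_sum_cong_neutral[where T="indices J"])
      (use assms indices_subset in \<open>auto simp: supported_def\<close>)
qed

definition sq_norm :: "(nat \<times> nat \<Rightarrow> real) \<Rightarrow> real" where
  "sq_norm u = (\<integral>x. (synth I \<Psi> u x)\<^sup>2 \<partial>unit_measure)"

lemma sq_norm_supported:
  assumes "supported J u"
  shows "sq_norm u = (\<Sum>p\<in>indices J. (u p)\<^sup>2)"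
  unfolding sq_norm_def by (rule parseval_synth[OF summable_supported[OF assms] has_sum_supported[OF assms]])

lemma synth_sq_integrable:
  assumes "summable (level_norm v)" shows "integrable unit_measure (\<lambda>x. (synth I \<Psi> v x)\<^sup>2)"
proof (rule integrable_unit_bounded[where B="(C * (\<Sum>j. level_norm v j))\<^sup>2"])
  fix x :: real assume "x \<in> {0..1}"
  from synth_bound[OF assms this]
  show "\<bar>(synth I \<Psi> v x)\<^sup>2\<bar> \<le> (C * (\<Sum>j. level_norm v j))\<^sup>2"
    by (simp add: sq_le_sq)
qed measurable
text \<open>
  Bessel's inequality for a single coefficient: expand the square of the distance of \<open>h\<close> to its projection.
\<close>

lemma coeff_sq_le:
  assumes h: "h \<in> borel_measurable borel" "\<And>x. x \<in> {0..1} \<Longrightarrow> \<bar>h x\<bar> \<le> B" and k: "k \<in> I j"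
  shows "(\<integral>x. h x * \<Psi> j k x \<partial>unit_measure)\<^sup>2 \<le> (\<integral>x. (h x)\<^sup>2 \<partial>unit_measure)"
proof -
  define \<alpha> where "\<alpha> = (\<integral>x. h x * \<Psi> j k x \<partial>unit_measure)"
  note [measurable] = h(1)
  have i1: "integrable unit_measure (\<lambda>x. (h x)\<^sup>2)"
  proof (rule integrable_unit_bounded[where B="B\<^sup>2"])
    fix x :: real assume "x \<in> {0..1}"
    from h(2)[OF this] show "\<bar>(h x)\<^sup>2\<bar> \<le> B\<^sup>2"
      by (simp add: sq_le_sq)
  qed measurable
  have i2: "integrable unit_measure (\<lambda>x. h x * \<Psi> j k x)"
  proof (rule integrable_unit_bounded[where B="B * (C * 2 powr (real j / 2))"])
    fix x :: real assume x: "x \<in> {0..1}"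
    show "\<bar>h x * \<Psi> j k x\<bar> \<le> B * (C * 2 powr (real j / 2))"
      unfolding abs_mult using h(2)[OF x] wavelet_bound[OF x k]
      by (intro mult_mono) (auto intro: order_trans[OF abs_ge_zero])
  qed measurable
  have "0 \<le> (\<integral>x. (h x - \<alpha> * \<Psi> j k x)\<^sup>2 \<partial>unit_measure)" by (rule Bochner_Integration.integral_nonneg) simp
  also have "(\<lambda>x. (h x - \<alpha> * \<Psi> j k x)\<^sup>2)
      = (\<lambda>x. (h x)\<^sup>2 - 2 * \<alpha> * (h x * \<Psi> j k x) + \<alpha>\<^sup>2 * (\<Psi> j k x * \<Psi> j k x))"
    by (auto simp: power2_eq_square algebra_simps)
  also have "(\<integral>x. \<dots> x \<partial>unit_measure) = (\<integral>x. (h x)\<^sup>2 \<partial>unit_measure) - 2 * \<alpha> * \<alpha> + \<alpha>\<^sup>2 * 1"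
    using i1 i2 wavelet_prod_integrable[OF k k] wavelet_orthonormal[OF k k] by (simp add: \<alpha>_def)
  finally show ?thesis unfolding \<alpha>_def[symmetric] by (simp add: power2_eq_square)
qed

section \<open>Product moments under the sampling law\<close>

text \<open>
  Independence: every exponential moment below is an integral of a product with equal factors.
\<close>
lemma nn_integral_sample_prod:
  assumes a: "summable (level_norm \<theta>)" "(\<integral>x. (synth I \<Psi> \<theta> x)\<^sup>2 \<partial>unit_measure) = 1"
    and F [measurable]: "F \<in> borel_measurable borel"
    and F_bd: "\<And>x. x \<in> {0..1} \<Longrightarrow> 0 \<le> F x \<and> F x \<le> B"
  shows "(\<integral>\<^sup>+y. ennreal (\<Prod>i<n. F (y i)) \<partial>sample_law I \<Psi> n \<theta>)
    = ennreal ((\<integral>x. F x * (synth I \<Psi> \<theta> x)\<^sup>2 \<partial>unit_measure) ^ n)"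
proof -
  define D where "D = density unit_measure (\<lambda>x. ennreal (dens I \<Psi> \<theta> x))"
  have dens_meas [measurable]: "dens I \<Psi> \<theta> \<in> borel_measurable borel"
    unfolding dens_def by measurable
  have "emeasure D (space D) = (\<integral>\<^sup>+x. ennreal ((synth I \<Psi> \<theta> x)\<^sup>2) \<partial>unit_measure)"
    unfolding D_def space_density
    by (subst emeasure_density) (auto simp: dens_def sets_restrict_space_iff intro!: nn_integral_cong)
  also have "\<dots> = ennreal 1"
    using synth_sq_integrable[OF a(1)] a(2) by (subst nn_integral_eq_integral) auto
  finally have "prob_space D" by (intro prob_spaceI) simp
  then interpret D: prob_space D .
  interpret P: product_sigma_finite "\<lambda>_::nat. D" by unfold_locales
  have "(\<integral>\<^sup>+x. ennreal (F x) \<partial>D) = (\<integral>\<^sup>+x. ennreal (F x * (synth I \<Psi> \<theta> x)\<^sup>2) \<partial>unit_measure)"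
    unfolding D_def
    by (subst nn_integral_density) (auto simp: dens_def F_bd ennreal_mult' mult.commute intro!: nn_integral_cong)
  also have "\<dots> = ennreal (\<integral>x. F x * (synth I \<Psi> \<theta> x)\<^sup>2 \<partial>unit_measure)"
  proof (rule nn_integral_eq_integral)
    show "AE x in unit_measure. 0 \<le> F x * (synth I \<Psi> \<theta> x)\<^sup>2" using F_bd by (intro AE_I2) auto
    show "integrable unit_measure (\<lambda>x. F x * (synth I \<Psi> \<theta> x)\<^sup>2)"
    proof (rule integrable_unit_bounded[where B="B * (C * (\<Sum>j. level_norm \<theta> j))\<^sup>2"])
      fix x :: real assume x: "x \<in> {0..1}"
      have "(synth I \<Psi> \<theta> x)\<^sup>2 \<le> (C * (\<Sum>j. level_norm \<theta> j))\<^sup>2"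
        using synth_bound[OF a(1) x] by (rule sq_le_sq)
      then show "\<bar>F x * (synth I \<Psi> \<theta> x)\<^sup>2\<bar> \<le> B * (C * (\<Sum>j. level_norm \<theta> j))\<^sup>2"
        unfolding abs_mult using F_bd[OF x] by (intro mult_mono) auto
    qed measurable
  qed
  finally have one: "(\<integral>\<^sup>+x. ennreal (F x) \<partial>D) = ennreal (\<integral>x. F x * (synth I \<Psi> \<theta> x)\<^sup>2 \<partial>unit_measure)" .
  have nonneg: "0 \<le> (\<integral>x. F x * (synth I \<Psi> \<theta> x)\<^sup>2 \<partial>unit_measure)"
    using F_bd by (intro Bochner_Integration.integral_nonneg_AE AE_I2) auto
  have "(\<integral>\<^sup>+y. ennreal (\<Prod>i<n. F (y i)) \<partial>sample_law I \<Psi> n \<theta>)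
      = (\<integral>\<^sup>+y. (\<Prod>i<n. ennreal (F (y i))) \<partial>PiM {..<n} (\<lambda>_. D))"
    unfolding sample_law_def D_def[symmetric]
  proof (rule nn_integral_cong)
    fix y assume "y \<in> space (PiM {..<n} (\<lambda>_. D))"
    then have "y i \<in> {0..1}" if "i < n" for i using that by (auto simp: space_PiM D_def PiE_iff)
    then show "ennreal (\<Prod>i<n. F (y i)) = (\<Prod>i<n. ennreal (F (y i)))"
      using F_bd by (intro prod_ennreal[symmetric]) auto
  qed
  also have "\<dots> = (\<Prod>i<n. (\<integral>\<^sup>+x. ennreal (F x) \<partial>D))"
    by (rule P.product_nn_integral_prod) (auto simp: D_def)
  also have "\<dots> = ennreal ((\<integral>x. F x * (synth I \<Psi> \<theta> x)\<^sup>2 \<partial>unit_measure) ^ n)"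
    unfolding one using nonneg by (simp add: ennreal_power)
  finally show ?thesis .
qed

lemma sample_space: "y \<in> space (sample_law I \<Psi> n \<theta>) \<Longrightarrow> i < n \<Longrightarrow> y i \<in> {0..1}"
  by (auto simp: sample_law_def space_PiM PiE_iff)

text \<open>
  Bernstein's method without centring: \<open>exp Y \<le> 1 + Y + Y\<^sup>2\<close> for \<open>\<bar>Y\<bar> \<le> 1\<close>, followed by
  \<open>1 + z \<le> exp z\<close>.
\<close>
lemma exp_moment_bound:
  assumes a: "summable (level_norm \<theta>)" "(\<integral>x. (synth I \<Psi> \<theta> x)\<^sup>2 \<partial>unit_measure) = 1"
    and Y [measurable]: "Y \<in> borel_measurable borel"
    and Y_bd: "\<And>x. x \<in> {0..1} \<Longrightarrow> \<bar>Y x\<bar> \<le> 1"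
    and V: "(\<integral>x. (Y x)\<^sup>2 * (synth I \<Psi> \<theta> x)\<^sup>2 \<partial>unit_measure) \<le> V"
    and b: "V + (\<integral>x. Y x * (synth I \<Psi> \<theta> x)\<^sup>2 \<partial>unit_measure) - m \<le> b"
  shows "(\<integral>\<^sup>+y. ennreal (\<Prod>i<n. exp (Y (y i) - m)) \<partial>sample_law I \<Psi> n \<theta>) \<le> ennreal (exp (real n * b))"
proof -
  let ?a2 = "\<lambda>x. (synth I \<Psi> \<theta> x)\<^sup>2"
  let ?K = "(C * (\<Sum>j. level_norm \<theta> j))\<^sup>2"
  have a_bd: "?a2 x \<le> ?K" if "x \<in> {0..1}" for x
    using synth_bound[OF a(1) that] by (rule sq_le_sq)
  have i: "integrable unit_measure (\<lambda>x. f x * ?a2 x)"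
    if [measurable]: "f \<in> borel_measurable borel" and f: "\<And>x. x \<in> {0..1} \<Longrightarrow> \<bar>f x\<bar> \<le> 3" for f
  proof (rule integrable_unit_bounded[where B="3 * ?K"])
    fix x :: real assume x: "x \<in> {0..1}"
    show "\<bar>f x * ?a2 x\<bar> \<le> 3 * ?K" unfolding abs_mult using f[OF x] a_bd[OF x] by (intro mult_mono) auto
  qed measurable
  have Y2: "(Y x)\<^sup>2 \<le> 1" if "x \<in> {0..1}" for x using Y_bd[OF that] by (simp add: abs_square_le_1)
  have e3: "exp (Y x) \<le> 3" if "x \<in> {0..1}" for x
    using exp_le_quadratic[of "Y x"] Y_bd[OF that] Y2[OF that] unfolding abs_le_iff by linarith
  have "(\<integral>x. exp (Y x) * ?a2 x \<partial>unit_measure) \<le> (\<integral>x. ?a2 x + Y x * ?a2 x + (Y x)\<^sup>2 * ?a2 x \<partial>unit_measure)"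
  proof (rule integral_unit_mono)
    show "integrable unit_measure (\<lambda>x. exp (Y x) * ?a2 x)" using e3 by (intro i) auto
    have "\<bar>Y x\<bar> \<le> 3" "\<bar>(Y x)\<^sup>2\<bar> \<le> 3" if "x \<in> {0..1}" for x using Y_bd[OF that] Y2[OF that] by auto
    then show "integrable unit_measure (\<lambda>x. ?a2 x + Y x * ?a2 x + (Y x)\<^sup>2 * ?a2 x)"
      by (intro Bochner_Integration.integrable_add synth_sq_integrable a i) auto
    fix x :: real assume "x \<in> {0..1}"
    then have "exp (Y x) * ?a2 x \<le> (1 + Y x + (Y x)\<^sup>2) * ?a2 x"
      using Y_bd by (intro mult_right_mono exp_le_quadratic) (auto simp: abs_le_iff)
    then show "exp (Y x) * ?a2 x \<le> ?a2 x + Y x * ?a2 x + (Y x)\<^sup>2 * ?a2 x" by (simp add: algebra_simps)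
  qed
  also have "\<dots> = 1 + (\<integral>x. Y x * ?a2 x \<partial>unit_measure) + (\<integral>x. (Y x)\<^sup>2 * ?a2 x \<partial>unit_measure)"
  proof -
    have "\<bar>Y x\<bar> \<le> 3" "\<bar>(Y x)\<^sup>2\<bar> \<le> 3" if "x \<in> {0..1}" for x using Y_bd[OF that] Y2[OF that] by auto
    then have "integrable unit_measure (\<lambda>x. Y x * ?a2 x)" "integrable unit_measure (\<lambda>x. (Y x)\<^sup>2 * ?a2 x)"
      by (auto intro!: i)
    then show ?thesis using a(2) synth_sq_integrable[OF a(1)] by simp
  qed
  also have "\<dots> \<le> 1 + (b + m)" using V b by linarith
  also have "\<dots> \<le> exp (b + m)" by (rule exp_ge_add_one_self)
  finally have le: "(\<integral>x. exp (Y x) * ?a2 x \<partial>unit_measure) \<le> exp (b + m)" .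
  have "(\<integral>\<^sup>+y. ennreal (\<Prod>i<n. exp (Y (y i) - m)) \<partial>sample_law I \<Psi> n \<theta>)
      = ennreal ((\<integral>x. exp (Y x - m) * ?a2 x \<partial>unit_measure) ^ n)"
    by (rule nn_integral_sample_prod[where B="3 * exp (- m)", OF a])
      (use e3 in \<open>auto simp: exp_diff exp_minus divide_inverse\<close>)
  also have "(\<integral>x. exp (Y x - m) * ?a2 x \<partial>unit_measure) = (\<integral>x. exp (Y x) * ?a2 x \<partial>unit_measure) * exp (- m)"
    by (simp add: exp_diff exp_minus divide_inverse mult_ac
        flip: integral_mult_left_zero integral_mult_right_zero)
  also have "ennreal (\<dots> ^ n) \<le> ennreal (exp b ^ n)"
  proof (rule ennreal_leI, rule power_mono)
    have "(\<integral>x. exp (Y x) * ?a2 x \<partial>unit_measure) * exp (- m) \<le> exp (b + m) * exp (- m)"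
      by (rule mult_right_mono[OF le]) simp
    then show "(\<integral>x. exp (Y x) * ?a2 x \<partial>unit_measure) * exp (- m) \<le> exp b" by (simp flip: exp_add)
    show "0 \<le> (\<integral>x. exp (Y x) * ?a2 x \<partial>unit_measure) * exp (- m)"
      by (intro mult_nonneg_nonneg Bochner_Integration.integral_nonneg) auto
  qed
  also have "exp b ^ n = exp (real n * b)" by (simp add: exp_of_nat_mult)
  finally show ?thesis .
qed

end

section \<open>The sieve\<close>

text \<open>
  The radius of the \<open>L\<^sup>2\<close>-neighbourhood in the first step, in units of \<open>N\<^bsup>1/2\<^esup> \<delta>\<close>. Its square
  over four exceeds \<open>63 C\<^sup>2 = 7 * 9 C\<^sup>2\<close>, which is the price of the distance between truth and nearest grid
  point, by enough to pay also for the entropy \<open>4 C N log n\<close> of the sieve.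
\<close>
definition near_const :: "real \<Rightarrow> real" where
  "near_const C = 2 * sqrt (63 * C\<^sup>2 + 4 * C + 1)"

context wavelet_system
begin

definition grid :: "nat \<Rightarrow> real \<Rightarrow> real set" where
  "grid n \<delta> = (\<lambda>m. \<delta> * of_int m) ` {- int n..int n}"

text \<open>
  The lower bound makes synthesised functions admissible square roots of densities, and lets them
  be used as denominators.
\<close>
definition sieve :: "real \<Rightarrow> nat \<Rightarrow> real \<Rightarrow> nat \<Rightarrow> (nat \<times> nat \<Rightarrow> real) set" where
  "sieve c n \<delta> J = {u \<in> PiE_dflt (indices J) 0 (\<lambda>_. grid n \<delta>). \<forall>x\<in>{0..1}. c / 2 \<le> synth I \<Psi> u x}"

text \<open>
  The likelihood of \<open>u / \<parallel>u\<parallel>\<close> times \<open>\<parallel>u\<parallel>\<^bsup>2n\<^esup> exp (- n \<parallel>u\<parallel>\<^sup>2)\<close>. The latter factor is largest for \<open>\<parallel>u\<parallel> = 1\<close>, so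
  that normalised vectors are not disfavoured.
\<close>
definition score :: "nat \<Rightarrow> (nat \<times> nat \<Rightarrow> real) \<Rightarrow> (nat \<Rightarrow> real) \<Rightarrow> real" where
  "score n u y = exp (- (real n * sq_norm u)) * (\<Prod>i<n. (synth I \<Psi> u (y i))\<^sup>2)"

lemma finite_grid [simp]: "finite (grid n \<delta>)" by (simp add: grid_def)

lemma card_grid: "card (grid n \<delta>) \<le> 2 * n + 1"
proof -
  have "card (grid n \<delta>) \<le> card {- int n..int n}" unfolding grid_def by (rule card_image_le) simp
  then show ?thesis by simp
qed

lemma finite_sieve [simp]: "finite (sieve c n \<delta> J)"
  unfolding sieve_def by (rule finite_subset[OF _ finite_PiE_dflt]) auto

lemma card_sieve: "card (sieve c n \<delta> J) \<le> (2 * n + 1) ^ card (indices J)"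
proof -
  have "card (sieve c n \<delta> J) \<le> card (PiE_dflt (indices J) 0 (\<lambda>_. grid n \<delta>))"
    unfolding sieve_def by (rule card_mono) auto
  also have "\<dots> = (\<Prod>p\<in>indices J. card (grid n \<delta>))" by (rule card_PiE_dflt) auto
  also have "\<dots> \<le> (2 * n + 1) ^ card (indices J)" using card_grid[of n \<delta>] by (simp add: power_mono)
  finally show ?thesis .
qed

lemma sieve_supported: "u \<in> sieve c n \<delta> J \<Longrightarrow> supported J u"
  by (auto simp: sieve_def PiE_dflt_def supported_def)

lemma sieve_grid: "u \<in> sieve c n \<delta> J \<Longrightarrow> p \<in> indices J \<Longrightarrow> u p \<in> grid n \<delta>"
  unfolding sieve_def PiE_dflt_def by blast

lemma sieve_lower: "u \<in> sieve c n \<delta> J \<Longrightarrow> x \<in> {0..1} \<Longrightarrow> c / 2 \<le> synth I \<Psi> u x"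
  by (auto simp: sieve_def)

lemma score_nonneg: "0 \<le> score n u y"
  unfolding score_def by (intro mult_nonneg_nonneg prod_nonneg) auto

end

text \<open>
  One true parameter \<open>\<theta>0\<close> and one sample size. The last assumption is uniform consistency: the points left after the
  first step are within \<open>O (2\<^bsup>J\<^esup> \<delta>)\<close> of the truth. The factors \<open>J + 2\<close> come from adding up the levels.
\<close>
locale sieve_core = wavelet_system +
  fixes J n :: nat and \<delta> c :: real and \<theta>0 :: "nat \<times> nat \<Rightarrow> real"
  assumes c_pos: "0 < c" and \<delta>_pos: "0 < \<delta>" and grid_covers: "2 \<le> real n * \<delta>"
    and truth_summable: "summable (level_norm \<theta>0)"
    and truth_norm: "(\<integral>x. (synth I \<Psi> \<theta>0 x)\<^sup>2 \<partial>unit_measure) = 1"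
    and truth_gt: "\<And>x. x \<in> {0..1} \<Longrightarrow> c < synth I \<Psi> \<theta>0 x"
    and truth_le_one: "\<And>p. p \<in> Lam I \<Longrightarrow> \<bar>\<theta>0 p\<bar> \<le> 1"
    and truth_tail: "(\<Sum>j. level_norm \<theta>0 (j + Suc J)) \<le> 2 powr (real J / 2) * \<delta>"
    and resolution_small:
      "(real J + 2)\<^sup>2 * 2 ^ J * \<delta> \<le> c / (64 * C ^ 3 * (near_const C + 1226))"
begin

abbreviation "a \<equiv> synth I \<Psi> \<theta>0"
abbreviation "s \<equiv> 2 powr (real J / 2)"

text \<open>
  The grid point nearest to the truth, coordinate by coordinate.
\<close>
definition center :: "nat \<times> nat \<Rightarrow> real" where
  "center p = (if p \<in> indices J then \<delta> * of_int (round (\<theta>0 p / \<delta>)) else 0)"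

definition dist_sq :: "(nat \<times> nat \<Rightarrow> real) \<Rightarrow> real" where
  "dist_sq u = (\<integral>x. (synth I \<Psi> u x - a x)\<^sup>2 \<partial>unit_measure)"

definition near :: "(nat \<times> nat \<Rightarrow> real) \<Rightarrow> bool" where
  "near u \<longleftrightarrow> dist_sq u \<le> (near_const C)\<^sup>2 * 2 ^ J * \<delta>\<^sup>2"

lemma s_ge_1: "1 \<le> s" by (rule ge_one_powr_ge_zero) auto
lemma s_sq: "s * s = 2 ^ J" using powr_half_sq[of J] by (simp add: power2_eq_square)
lemma s_le: "s \<le> 2 ^ J" using mult_left_mono[OF s_ge_1, of s] s_sq by simp
lemma wt_le_s: "j \<le> J \<Longrightarrow> 2 powr (real j / 2) \<le> s" by simp

lemma near_const_nonneg: "0 \<le> near_const C"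
  unfolding near_const_def using one_le_C by simp

lemma near_const_sq: "(near_const C)\<^sup>2 = 4 * (63 * C\<^sup>2 + 4 * C + 1)"
  unfolding near_const_def power_mult_distrib using one_le_C by (simp add: add_nonneg_nonneg)

lemma small_consequence:
  assumes "z \<le> K * (2 ^ J * \<delta>)" "0 \<le> K" "K \<le> near_const C + 1226"
  shows "64 * C ^ 3 * ((real J + 2)\<^sup>2 * z) \<le> c"
proof -
  let ?D = "64 * C ^ 3 * (near_const C + 1226)"
  have D: "0 < ?D" using one_le_C near_const_nonneg by simp
  have "z \<le> (near_const C + 1226) * (2 ^ J * \<delta>)"
    by (rule order_trans[OF assms(1) mult_right_mono[OF assms(3)]]) (use \<delta>_pos in simp)
  then have "(real J + 2)\<^sup>2 * z \<le> (real J + 2)\<^sup>2 * ((near_const C + 1226) * (2 ^ J * \<delta>))"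
    by (rule mult_left_mono) simp
  then have "64 * C ^ 3 * ((real J + 2)\<^sup>2 * z) \<le> 64 * C ^ 3 * ((real J + 2)\<^sup>2 * ((near_const C + 1226) * (2 ^ J * \<delta>)))"
    by (rule mult_left_mono) simp
  also have "\<dots> = ?D * ((real J + 2)\<^sup>2 * 2 ^ J * \<delta>)" by (simp only: mult_ac)
  also have "\<dots> \<le> c" using resolution_small D by (simp only: pos_le_divide_eq mult.commute)
  finally show ?thesis .
qed

lemma C_le_cube: "C \<le> C ^ 3"
  using power_increasing[of 1 3 C] one_le_C by simp

lemma small_consequence_linear:
  assumes "0 \<le> z" "z \<le> K * (2 ^ J * \<delta>)" "0 \<le> K" "K \<le> near_const C + 1226"
  shows "64 * (C * ((real J + 2) * z)) \<le> c"
proof -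
  have "(real J + 2) * z \<le> (real J + 2)\<^sup>2 * z"
    using assms(1) self_le_power[of "real J + 2" 2] by (intro mult_right_mono) auto
  then have "C * ((real J + 2) * z) \<le> C ^ 3 * ((real J + 2)\<^sup>2 * z)"
    by (rule mult_mono[OF C_le_cube]) (use assms(1) in auto)
  with small_consequence[OF assms(2,3,4)] show ?thesis by linarith
qed

lemma s\<delta>_le: "s * \<delta> \<le> 1 * (2 ^ J * \<delta>)" using s_le \<delta>_pos by simp

text \<open>
  Deviations are allowed to consist of a part \<open>A\<close> that is already weighted by \<open>2\<^bsup>j/2\<^esup>\<close>, and so counts once
  per level, and of a constant part \<open>t\<close>, for which the levels add up geometrically.
\<close>
lemma synth_dist_bound:
  assumes w: "supported J w" and A: "0 \<le> A" and t: "0 \<le> t" and x: "x \<in> {0..1}"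
    and d: "\<And>j k. (j, k) \<in> indices J \<Longrightarrow>
      2 powr (real j / 2) * \<bar>w (j, k) - \<theta>0 (j, k)\<bar> \<le> A + 2 powr (real j / 2) * t"
  shows "\<bar>synth I \<Psi> w x - a x\<bar> \<le> C * ((real J + 1) * A + (4 * t + \<delta>) * s)"
proof -
  let ?v = "\<lambda>p. w p - \<theta>0 p"
  have sv: "summable (level_norm ?v)"
    by (rule summable_level_norm_diff[OF summable_supported[OF w] truth_summable])
  have "\<bar>synth I \<Psi> w x - a x\<bar> = \<bar>synth I \<Psi> ?v x\<bar>"
    using synth_diff[OF summable_supported[OF w] truth_summable x] by simp
  also have "\<dots> \<le> C * (\<Sum>j. level_norm ?v j)" by (rule synth_bound[OF sv x])
  also have "\<dots> \<le> C * ((real J + 1) * A + (4 * t + \<delta>) * s)"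
  proof (rule mult_left_mono)
    have "(\<Sum>j. level_norm ?v j) = (\<Sum>j. level_norm ?v (j + Suc J)) + (\<Sum>j<Suc J. level_norm ?v j)"
      by (rule suminf_split_initial_segment[OF sv])
    moreover have "(\<lambda>j. level_norm ?v (j + Suc J)) = (\<lambda>j. level_norm \<theta>0 (j + Suc J))"
    proof
      fix j
      have "w (j + Suc J, k) = 0" for k using w by (simp add: supported_def indices_iff)
      then show "level_norm ?v (j + Suc J) = level_norm \<theta>0 (j + Suc J)"
        by (simp add: level_norm_def)
    qed
    moreover have "(\<Sum>j<Suc J. level_norm ?v j) \<le> (\<Sum>j<Suc J. A + 2 powr (real j / 2) * t)"
      by (rule sum_mono, rule level_norm_le) (auto simp: indices_iff intro!: d)
    moreover have "(\<Sum>j<Suc J. A + 2 powr (real j / 2) * t) = (real J + 1) * A + (\<Sum>j\<le>J. 2 powr (real j / 2)) * t"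
      by (simp add: sum.distrib lessThan_Suc_atMost flip: sum_distrib_right)
    moreover have "(\<Sum>j\<le>J. 2 powr (real j / 2)) * t \<le> 4 * s * t"
      by (rule mult_right_mono[OF sum_sqrt2_powers t])
    ultimately show "(\<Sum>j. level_norm ?v j) \<le> (real J + 1) * A + (4 * t + \<delta>) * s"
      using truth_tail by (simp add: algebra_simps)
  qed simp
  finally show ?thesis .
qed

lemma center_supported: "supported J center" by (simp add: center_def supported_def)

lemma center_close:
  assumes "p \<in> indices J" shows "\<bar>center p - \<theta>0 p\<bar> \<le> \<delta> / 2"
proof -
  have "\<bar>of_int (round (\<theta>0 p / \<delta>)) - \<theta>0 p / \<delta>\<bar> \<le> 1 / 2" by (rule of_int_round_abs_le)
  then have "\<delta> * \<bar>of_int (round (\<theta>0 p / \<delta>)) - \<theta>0 p / \<delta>\<bar> \<le> \<delta> * (1 / 2)"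
    by (rule mult_left_mono) (use \<delta>_pos in simp)
  moreover have "\<delta> * \<bar>of_int (round (\<theta>0 p / \<delta>)) - \<theta>0 p / \<delta>\<bar>
      = \<bar>\<delta> * (of_int (round (\<theta>0 p / \<delta>)) - \<theta>0 p / \<delta>)\<bar>"
    using \<delta>_pos by (simp add: abs_mult)
  ultimately show ?thesis using assms \<delta>_pos by (simp add: center_def right_diff_distrib)
qed

lemma center_grid:
  assumes "p \<in> indices J" shows "center p \<in> grid n \<delta>"
proof -
  have "\<bar>\<theta>0 p\<bar> \<le> 1" by (rule truth_le_one[OF subsetD[OF indices_subset assms]])
  then have "\<bar>\<theta>0 p / \<delta>\<bar> \<le> 1 / \<delta>" using \<delta>_pos by (simp add: divide_right_mono)
  also have "1 / \<delta> \<le> real n / 2" using grid_covers \<delta>_pos by (simp add: field_simps)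
  finally have "\<bar>\<theta>0 p / \<delta>\<bar> \<le> real n / 2" .
  moreover have "\<bar>of_int (round (\<theta>0 p / \<delta>)) - \<theta>0 p / \<delta>\<bar> \<le> 1 / 2" by (rule of_int_round_abs_le)
  moreover have "1 \<le> n" using grid_covers by (cases n) auto
  ultimately have "\<bar>real_of_int (round (\<theta>0 p / \<delta>))\<bar> \<le> real n" by linarith
  then have "\<bar>round (\<theta>0 p / \<delta>)\<bar> \<le> int n" by linarith
  then have "round (\<theta>0 p / \<delta>) \<in> {- int n..int n}" by auto
  then have "\<delta> * of_int (round (\<theta>0 p / \<delta>)) \<in> grid n \<delta>" unfolding grid_def by (rule imageI)
  then show ?thesis using assms unfolding center_def by simp
qed

lemma center_dist:
  assumes "x \<in> {0..1}" shows "\<bar>synth I \<Psi> center x - a x\<bar> \<le> 3 * C * s * \<delta>"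
proof -
  have "\<bar>synth I \<Psi> center x - a x\<bar> \<le> C * ((real J + 1) * 0 + (4 * (\<delta> / 2) + \<delta>) * s)"
  proof (rule synth_dist_bound[OF center_supported _ _ assms])
    fix j k assume p: "(j, k) \<in> indices J"
    from mult_left_mono[OF center_close[OF p], of "2 powr (real j / 2)"]
    show "2 powr (real j / 2) * \<bar>center (j, k) - \<theta>0 (j, k)\<bar> \<le> 0 + 2 powr (real j / 2) * (\<delta> / 2)"
      by simp
  qed (use \<delta>_pos in auto)
  then show ?thesis by (simp add: algebra_simps)
qed

lemma center_dist_half:
  assumes "x \<in> {0..1}" shows "\<bar>synth I \<Psi> center x - a x\<bar> \<le> c / 2"
proof -
  have z: "0 \<le> s * \<delta>" using \<delta>_pos by simp
  have "64 * (C * ((real J + 2) * (s * \<delta>))) \<le> c"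
    by (rule small_consequence_linear[OF z s\<delta>_le]) (use near_const_nonneg in auto)
  moreover have "C * (1 * (s * \<delta>)) \<le> C * ((real J + 2) * (s * \<delta>))"
    using z by (intro mult_left_mono mult_right_mono) auto
  ultimately have "3 * (C * (s * \<delta>)) \<le> c / 2" using c_pos by simp
  with center_dist[OF assms] show ?thesis by (simp add: mult.assoc)
qed

lemma center_in_sieve: "center \<in> sieve c n \<delta> J"
proof -
  have "c / 2 \<le> synth I \<Psi> center x" if "x \<in> {0..1}" for x
    using center_dist_half[OF that] truth_gt[OF that] unfolding abs_le_iff by linarith
  moreover have "center \<in> PiE_dflt (indices J) 0 (\<lambda>_. grid n \<delta>)"
    using center_grid by (auto simp: PiE_dflt_def center_def)
  ultimately show ?thesis by (simp add: sieve_def)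
qed

lemma diff_sq_integrable:
  assumes "supported J u" shows "integrable unit_measure (\<lambda>x. (synth I \<Psi> u x - a x)\<^sup>2)"
proof -
  have "integrable unit_measure (\<lambda>x. (synth I \<Psi> (\<lambda>p. u p - \<theta>0 p) x)\<^sup>2)"
    by (rule synth_sq_integrable[OF summable_level_norm_diff[OF summable_supported[OF assms] truth_summable]])
  then show ?thesis
    by (subst Bochner_Integration.integrable_cong[OF refl, where g="\<lambda>x. (synth I \<Psi> (\<lambda>p. u p - \<theta>0 p) x)\<^sup>2"])
      (use synth_diff[OF summable_supported[OF assms] truth_summable] in auto)
qed

lemma center_dist_sq: "dist_sq center \<le> 9 * C\<^sup>2 * (2 ^ J * \<delta>\<^sup>2)"
proof -
  have "dist_sq center \<le> (\<integral>x. (3 * C * s * \<delta>)\<^sup>2 \<partial>unit_measure)"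
    unfolding dist_sq_def
  proof (rule integral_unit_mono)
    show "integrable unit_measure (\<lambda>x. (synth I \<Psi> center x - a x)\<^sup>2)"
      by (rule diff_sq_integrable[OF center_supported])
    fix x :: real assume "x \<in> {0..1}"
    then show "(synth I \<Psi> center x - a x)\<^sup>2 \<le> (3 * C * s * \<delta>)\<^sup>2" by (intro sq_le_sq center_dist)
  qed simp
  also have "\<dots> = (3 * C * s * \<delta>)\<^sup>2" by (simp add: unit_measure.prob_space[simplified])
  also have "\<dots> = 9 * C\<^sup>2 * (2 ^ J * \<delta>\<^sup>2)" by (simp add: power_mult_distrib powr_half_sq)
  finally show ?thesis .
qed

section \<open>Localisation in \<open>L\<^sup>2\<close>\<close>

text \<open>
  One factor of the square root of the ratio of the scores of \<open>u\<close> and \<open>center\<close>.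
\<close>
definition root_ratio :: "(nat \<times> nat \<Rightarrow> real) \<Rightarrow> real \<Rightarrow> real" where
  "root_ratio u x = exp (- (sq_norm u - sq_norm center) / 2) * (synth I \<Psi> u x / synth I \<Psi> center x)"

lemma center_pos: "x \<in> {0..1} \<Longrightarrow> 0 < synth I \<Psi> center x"
  using sieve_lower[OF center_in_sieve, of x] c_pos by simp

lemma score_root_ratio:
  assumes "\<And>i. i < n \<Longrightarrow> y i \<in> {0..1}"
  shows "score n u y = (\<Prod>i<n. root_ratio u (y i))\<^sup>2 * score n center y"
proof -
  have "(\<Prod>i<n. root_ratio u (y i))\<^sup>2 * score n center y
      = (\<Prod>i<n. (root_ratio u (y i))\<^sup>2 * (exp (- sq_norm center) * (synth I \<Psi> center (y i))\<^sup>2))"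
    unfolding score_def prod.distrib prod_power_distrib[symmetric]
    by (simp add: exp_of_nat_mult[symmetric] mult.commute)
  also have "\<dots> = (\<Prod>i<n. exp (- sq_norm u) * (synth I \<Psi> u (y i))\<^sup>2)"
  proof (rule prod.cong[OF refl])
    fix i assume "i \<in> {..<n}"
    then have p: "synth I \<Psi> center (y i) \<noteq> 0" using center_pos[OF assms] by force
    have "(exp (- (sq_norm u - sq_norm center) / 2))\<^sup>2 * exp (- sq_norm center) = exp (- sq_norm u)"
      by (simp add: power2_eq_square flip: exp_add)
    then show "(root_ratio u (y i))\<^sup>2 * (exp (- sq_norm center) * (synth I \<Psi> center (y i))\<^sup>2)
        = exp (- sq_norm u) * (synth I \<Psi> u (y i))\<^sup>2"
      using p by (simp add: root_ratio_def power_mult_distrib power_divide field_simps)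
  qed
  also have "\<dots> = score n u y"
    unfolding score_def prod.distrib by (simp add: exp_of_nat_mult[symmetric] mult.commute)
  finally show ?thesis ..
qed

text \<open>
  For normalised \<open>g\<close>, \<open>b\<close> and \<open>a = b\<close> the left side integrates to the affinity of \<open>g\<close> and \<open>b\<close> minus one, that is to
  \<open>- \<parallel>g - b\<parallel>\<^sup>2 / 2\<close>. The square root of the score has been arranged so that the estimate survives pointwise
  when \<open>a\<close> differs from \<open>b\<close>: with \<open>e = b - a\<close> and \<open>h = g - a\<close> the left side is
  \<open>- h\<^sup>2 / 2 + e\<^sup>2 / 2 - e h + e\<^sup>2 g / b\<close>.
\<close>
lemma root_ratio_pointwise:
  fixes g b a :: real
  assumes b: "0 < b" "\<bar>b - a\<bar> \<le> b"
  shows "g * a\<^sup>2 / b - (g\<^sup>2 - b\<^sup>2) / 2 - a\<^sup>2 \<le> 7 * (b - a)\<^sup>2 - (g - a)\<^sup>2 / 4"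
proof -
  define e where "e = b - a"
  define h where "h = g - a"
  have "g * a\<^sup>2 / b = g * b - 2 * e * g + e\<^sup>2 * (g / b)"
    using b(1) by (simp add: e_def power2_eq_square field_simps)
  moreover have "e\<^sup>2 * (g / b) = e\<^sup>2 + e * (h - e) * (e / b)"
    using b(1) by (simp add: e_def h_def power2_eq_square field_simps)
  moreover have "e * (h - e) * (e / b) \<le> \<bar>e\<bar> * \<bar>h\<bar> + e\<^sup>2"
  proof -
    have "\<bar>e / b\<bar> \<le> 1" using b by (simp add: e_def)
    then have "\<bar>e * (h - e)\<bar> * \<bar>e / b\<bar> \<le> \<bar>e * (h - e)\<bar> * 1" by (intro mult_left_mono) auto
    then have "e * (h - e) * (e / b) \<le> \<bar>e * (h - e)\<bar>" unfolding abs_mult[symmetric] by linarith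
    also have "\<dots> \<le> \<bar>e * h\<bar> + \<bar>e * e\<bar>" unfolding right_diff_distrib by (rule abs_triangle_ineq4)
    finally show ?thesis by (simp add: abs_mult power2_eq_square)
  qed
  ultimately have "g * a\<^sup>2 / b - (g\<^sup>2 - b\<^sup>2) / 2 - a\<^sup>2
      \<le> g * b - 2 * e * g + e\<^sup>2 + \<bar>e\<bar> * \<bar>h\<bar> + e\<^sup>2 - (g\<^sup>2 - b\<^sup>2) / 2 - a\<^sup>2" by linarith
  also have "\<dots> = - h\<^sup>2 / 2 + 5 * e\<^sup>2 / 2 - e * h + \<bar>e\<bar> * \<bar>h\<bar>"
    by (simp add: e_def h_def power2_eq_square field_simps)
  also have "\<dots> \<le> - h\<^sup>2 / 2 + 5 * e\<^sup>2 / 2 + 2 * (\<bar>e\<bar> * \<bar>h\<bar>)"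
    using abs_ge_minus_self[of "e * h"] by (simp add: abs_mult)
  also have "2 * (\<bar>e\<bar> * \<bar>h\<bar>) \<le> h\<^sup>2 / 4 + 4 * e\<^sup>2"
    using zero_le_power2[of "\<bar>h\<bar> / 2 - 2 * \<bar>e\<bar>"] by (simp add: power2_diff power_divide power_mult_distrib algebra_simps)
  finally show ?thesis unfolding e_def[symmetric] h_def[symmetric] using zero_le_power2[of e] by linarith
qed

lemma root_ratio_moment:
  assumes u: "u \<in> sieve c n \<delta> J"
  shows "(\<integral>\<^sup>+y. ennreal (\<Prod>i<n. root_ratio u (y i)) \<partial>sample_law I \<Psi> n \<theta>0)
    \<le> ennreal (exp (real n * (7 * dist_sq center - dist_sq u / 4)))"
proof -
  let ?g = "synth I \<Psi> u" and ?b = "synth I \<Psi> center"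
  let ?E = "exp (- (sq_norm u - sq_norm center) / 2)"
  note su = summable_supported[OF sieve_supported[OF u]]
  note sc = summable_supported[OF center_supported]
  let ?G = "C * (\<Sum>j. level_norm u j)"
  have low: "c / 2 \<le> ?b x" "c / 2 \<le> ?g x" if "x \<in> {0..1}" for x
    using sieve_lower[OF center_in_sieve that] sieve_lower[OF u that] by auto
  have gb: "0 \<le> ?g x / ?b x \<and> ?g x / ?b x \<le> ?G / (c / 2)" if x: "x \<in> {0..1}" for x
  proof -
    have "?g x \<le> ?G" using synth_bound[OF su x] by (simp add: abs_le_iff)
    then have "?g x / ?b x \<le> ?G / (c / 2)"
      by (intro frac_le) (use low[OF x] c_pos in auto)
    moreover have "0 \<le> ?g x / ?b x" using low[OF x] c_pos by (intro divide_nonneg_nonneg) auto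
    ultimately show ?thesis by simp
  qed
  have int_gab: "integrable unit_measure (\<lambda>x. ?g x * (a x)\<^sup>2 / ?b x)"
  proof (rule integrable_unit_bounded[where B="?G / (c / 2) * (C * (\<Sum>j. level_norm \<theta>0 j))\<^sup>2"])
    fix x :: real assume x: "x \<in> {0..1}"
    have "\<bar>?g x / ?b x * (a x)\<^sup>2\<bar> \<le> ?G / (c / 2) * (C * (\<Sum>j. level_norm \<theta>0 j))\<^sup>2"
      unfolding abs_mult using gb[OF x] sq_le_sq[OF synth_bound[OF truth_summable x]]
      by (intro mult_mono) auto
    then show "\<bar>?g x * (a x)\<^sup>2 / ?b x\<bar> \<le> ?G / (c / 2) * (C * (\<Sum>j. level_norm \<theta>0 j))\<^sup>2" by simp
  qed measurable
  note ints = int_gab synth_sq_integrable[OF su] synth_sq_integrable[OF sc]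
    synth_sq_integrable[OF truth_summable] diff_sq_integrable[OF sieve_supported[OF u]]
    diff_sq_integrable[OF center_supported]
  define A where "A = (\<integral>x. ?g x * (a x)\<^sup>2 / ?b x \<partial>unit_measure)"
  have "(\<integral>x. ?g x * (a x)\<^sup>2 / ?b x - ((?g x)\<^sup>2 - (?b x)\<^sup>2) / 2 - (a x)\<^sup>2 \<partial>unit_measure)
      \<le> (\<integral>x. 7 * (?b x - a x)\<^sup>2 - (?g x - a x)\<^sup>2 / 4 \<partial>unit_measure)"
  proof (rule integral_unit_mono)
    fix x :: real assume x: "x \<in> {0..1}"
    show "?g x * (a x)\<^sup>2 / ?b x - ((?g x)\<^sup>2 - (?b x)\<^sup>2) / 2 - (a x)\<^sup>2
        \<le> 7 * (?b x - a x)\<^sup>2 - (?g x - a x)\<^sup>2 / 4"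
      using low(1)[OF x] center_dist_half[OF x] c_pos by (intro root_ratio_pointwise) auto
  qed (use ints in auto)
  then have main: "A - (sq_norm u - sq_norm center) / 2 - 1 \<le> 7 * dist_sq center - dist_sq u / 4"
    using ints truth_norm by (simp add: A_def sq_norm_def dist_sq_def)
  have "(\<integral>\<^sup>+y. ennreal (\<Prod>i<n. root_ratio u (y i)) \<partial>sample_law I \<Psi> n \<theta>0)
      = ennreal ((\<integral>x. root_ratio u x * (a x)\<^sup>2 \<partial>unit_measure) ^ n)"
  proof (rule nn_integral_sample_prod[OF truth_summable truth_norm, where B="?E * (?G / (c / 2))"])
    show "root_ratio u \<in> borel_measurable borel" unfolding root_ratio_def[abs_def] by measurable
    fix x :: real assume "x \<in> {0..1}"
    from gb[OF this] show "0 \<le> root_ratio u x \<and> root_ratio u x \<le> ?E * (?G / (c / 2))"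
      unfolding root_ratio_def by (intro conjI mult_left_mono mult_nonneg_nonneg) auto
  qed
  also have "(\<integral>x. root_ratio u x * (a x)\<^sup>2 \<partial>unit_measure) = ?E * A"
    unfolding A_def root_ratio_def by (simp add: mult.assoc flip: integral_mult_right_zero)
  also have "(?E * A) ^ n \<le> exp (7 * dist_sq center - dist_sq u / 4) ^ n"
  proof (rule power_mono)
    have "0 \<le> ?g x * (a x)\<^sup>2 / ?b x" if "x \<in> {0..1}" for x
      using mult_nonneg_nonneg[OF conjunct1[OF gb[OF that]] zero_le_power2[of "a x"]] by simp
    then have "0 \<le> A" unfolding A_def
      by (intro Bochner_Integration.integral_nonneg_AE AE_I2) simp
    then show "0 \<le> ?E * A" by simp
    have "A \<le> exp (A - 1)" using exp_ge_add_one_self[of "A - 1"] by simp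
    then have "?E * A \<le> ?E * exp (A - 1)" by simp
    also have "\<dots> = exp (A - (sq_norm u - sq_norm center) / 2 - 1)"
      unfolding exp_add[symmetric] by (rule arg_cong[where f=exp]) (simp add: field_simps)
    also have "\<dots> \<le> exp (7 * dist_sq center - dist_sq u / 4)" using main by simp
    finally show "?E * A \<le> exp (7 * dist_sq center - dist_sq u / 4)" .
  qed
  also have "exp (7 * dist_sq center - dist_sq u / 4) ^ n = exp (real n * (7 * dist_sq center - dist_sq u / 4))"
    by (simp only: exp_of_nat_mult)
  finally show ?thesis by (simp add: ennreal_leI)
qed

section \<open>Resetting the worst coordinate\<close>

abbreviation wt :: "nat \<times> nat \<Rightarrow> real" where "wt p \<equiv> 2 powr (real (fst p) / 2)"

text \<open>
  A coordinate is bad if its displacement \<open>u p - center p\<close> dominates the rounding error of the truth.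
  With this proviso, moving it back is a clear gain: the cross term between displacement and rounding
  error cannot compensate the square of the displacement. Grid values that are about equally good
  for a truth half-way between them do not count as bad.
\<close>
definition bad :: "(nat \<times> nat \<Rightarrow> real) \<Rightarrow> nat \<times> nat \<Rightarrow> bool" where
  "bad u p \<longleftrightarrow> p \<in> indices J \<and> u p \<noteq> center p \<and> 16 * \<bar>center p - \<theta>0 p\<bar> \<le> \<bar>u p - center p\<bar>"

definition near_bad :: "(nat \<times> nat \<Rightarrow> real) set" where
  "near_bad = {u \<in> sieve c n \<delta> J. near u \<and> (\<exists>p. bad u p)}"

text \<open>
  The displacement is weighted by \<open>2\<^bsup>j/2\<^esup>\<close>, so that the worst bad coordinate bounds the uniform
  distance between \<open>u\<close> and the truth, up to the number of levels. All errors in the comparison below can therefore be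
  measured against the displacement that is undone.
\<close>
definition worst :: "(nat \<times> nat \<Rightarrow> real) \<Rightarrow> nat \<times> nat" where
  "worst u = (SOME p. bad u p \<and> (\<forall>p'. bad u p' \<longrightarrow>
     wt p' * \<bar>u p' - center p'\<bar> \<le> wt p * \<bar>u p - center p\<bar>))"

definition reset :: "(nat \<times> nat \<Rightarrow> real) \<Rightarrow> nat \<times> nat \<Rightarrow> real" where
  "reset u = u(worst u := center (worst u))"

definition shift :: "(nat \<times> nat \<Rightarrow> real) \<Rightarrow> real" where
  "shift u = u (worst u) - center (worst u)"

text \<open>
  A bound for the uniform distance between \<open>reset u\<close> and the truth.
\<close>
definition reset_radius :: "(nat \<times> nat \<Rightarrow> real) \<Rightarrow> real" where
  "reset_radius u = C * ((real J + 1) * (wt (worst u) * \<bar>shift u\<bar>) + 37 * (s * \<delta>))"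

lemma worst_props:
  assumes "u \<in> near_bad"
  shows "bad u (worst u)"
    and "bad u p' \<Longrightarrow> wt p' * \<bar>u p' - center p'\<bar> \<le> wt (worst u) * \<bar>shift u\<bar>"
proof -
  let ?S = "{p. bad u p}"
  let ?f = "\<lambda>p. wt p * \<bar>u p - center p\<bar>"
  have fin: "finite ?S" by (rule finite_subset[of _ "indices J"]) (auto simp: bad_def)
  have ne: "?S \<noteq> {}" using assms by (auto simp: near_bad_def)
  have "Max (?f ` ?S) \<in> ?f ` ?S" using fin ne by (intro Max_in) auto
  then obtain p where p: "p \<in> ?S" "?f p = Max (?f ` ?S)" by force
  have "?f p' \<le> ?f p" if "bad u p'" for p'
    unfolding p(2) using fin that by (intro Max_ge) auto
  then have "bad u p \<and> (\<forall>p'. bad u p' \<longrightarrow> ?f p' \<le> ?f p)" using p(1) by blast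
  then have *: "bad u (worst u) \<and> (\<forall>p'. bad u p' \<longrightarrow> ?f p' \<le> ?f (worst u))"
    unfolding worst_def by (rule someI)
  show "bad u (worst u)" using * by blast
  show "bad u p' \<Longrightarrow> wt p' * \<bar>u p' - center p'\<bar> \<le> wt (worst u) * \<bar>shift u\<bar>"
    using * unfolding shift_def by blast
qed

lemma worst_index:
  assumes "u \<in> near_bad"
  shows "worst u \<in> indices J" "fst (worst u) \<le> J" "snd (worst u) \<in> I (fst (worst u))"
  using worst_props(1)[OF assms] by (auto simp: bad_def indices_def)

lemma shift_ge:
  assumes "u \<in> near_bad" shows "\<delta> \<le> \<bar>shift u\<bar>"
proof -
  let ?p = "worst u"
  have p: "?p \<in> indices J" by (rule worst_index(1)[OF assms])
  have "u ?p \<in> grid n \<delta>" using assms p by (auto simp: near_bad_def intro: sieve_grid)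
  then obtain m m' :: int where m: "u ?p = \<delta> * of_int m" "center ?p = \<delta> * of_int m'"
    using center_grid[OF p] unfolding grid_def by blast
  have "u ?p \<noteq> center ?p" using worst_props(1)[OF assms] by (simp add: bad_def)
  then have "1 \<le> \<bar>m - m'\<bar>" using m by auto
  then have "1 \<le> \<bar>real_of_int (m - m')\<bar>" by linarith
  then have "\<delta> * 1 \<le> \<delta> * \<bar>real_of_int (m - m')\<bar>" by (rule mult_left_mono) (use \<delta>_pos in simp)
  also have "\<dots> = \<bar>shift u\<bar>" unfolding shift_def m using \<delta>_pos by (simp add: abs_mult flip: right_diff_distrib)
  finally show ?thesis by simp
qed

lemma near_coeff:
  assumes u: "supported J u" "near u" and p: "p \<in> indices J"
  shows "\<bar>u p - \<theta>0 p\<bar> \<le> near_const C * s * \<delta>"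
proof -
  obtain j k where jk: "p = (j, k)" "k \<in> I j" using p by (auto simp: indices_def)
  let ?v = "\<lambda>p. u p - \<theta>0 p"
  have sv: "summable (level_norm ?v)"
    by (rule summable_level_norm_diff[OF summable_supported[OF u(1)] truth_summable])
  have "(\<integral>x. synth I \<Psi> ?v x * \<Psi> j k x \<partial>unit_measure)\<^sup>2 \<le> (\<integral>x. (synth I \<Psi> ?v x)\<^sup>2 \<partial>unit_measure)"
    by (rule coeff_sq_le[OF synth_measurable synth_bound[OF sv] jk(2)])
  also have "(\<integral>x. (synth I \<Psi> ?v x)\<^sup>2 \<partial>unit_measure) = dist_sq u"
    unfolding dist_sq_def
    by (rule integral_unit_cong) (simp add: synth_diff[OF summable_supported[OF u(1)] truth_summable])
  also have "\<dots> \<le> (near_const C * s * \<delta>)\<^sup>2"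
    using u(2) by (simp add: near_def power_mult_distrib powr_half_sq)
  finally have "(u p - \<theta>0 p)\<^sup>2 \<le> (near_const C * s * \<delta>)\<^sup>2" using synth_coeff[OF sv jk(2)] jk(1) by simp
  then have "\<bar>u p - \<theta>0 p\<bar> \<le> \<bar>near_const C * s * \<delta>\<bar>" by (rule abs_le_square_iff[THEN iffD2])
  then show ?thesis using near_const_nonneg \<delta>_pos by simp
qed

lemma near_bad_supported: "u \<in> near_bad \<Longrightarrow> supported J u"
  by (auto simp: near_bad_def intro: sieve_supported)

lemma shift_le:
  assumes "u \<in> near_bad"
  shows "wt (worst u) * \<bar>shift u\<bar> \<le> (near_const C + 1) * (2 ^ J * \<delta>)"
proof -
  let ?p = "worst u"
  note p = worst_index[OF assms]
  have "\<bar>u ?p - \<theta>0 ?p\<bar> \<le> near_const C * s * \<delta>"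
    using assms p by (intro near_coeff near_bad_supported) (auto simp: near_bad_def)
  moreover have "\<bar>center ?p - \<theta>0 ?p\<bar> \<le> \<delta> / 2" by (rule center_close[OF p(1)])
  ultimately have "\<bar>shift u\<bar> \<le> near_const C * s * \<delta> + \<delta>" unfolding shift_def using \<delta>_pos by linarith
  also have "\<dots> \<le> near_const C * s * \<delta> + s * \<delta>" using s_ge_1 \<delta>_pos by simp
  finally have "\<bar>shift u\<bar> \<le> (near_const C + 1) * (s * \<delta>)" by (simp add: algebra_simps)
  then have "wt ?p * \<bar>shift u\<bar> \<le> s * ((near_const C + 1) * (s * \<delta>))"
    using wt_le_s[OF p(2)] by (intro mult_mono) auto
  also have "\<dots> = (near_const C + 1) * ((s * s) * \<delta>)" by (simp only: mult_ac)
  finally show ?thesis unfolding s_sq .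
qed

lemma reset_supported: "u \<in> near_bad \<Longrightarrow> supported J (reset u)"
  using near_bad_supported worst_index(1) unfolding supported_def reset_def by auto

lemma reset_dist:
  assumes u: "u \<in> near_bad" and x: "x \<in> {0..1}"
  shows "\<bar>synth I \<Psi> (reset u) x - a x\<bar> \<le> reset_radius u"
proof -
  let ?A = "wt (worst u) * \<bar>shift u\<bar>"
  have "\<bar>synth I \<Psi> (reset u) x - a x\<bar> \<le> C * ((real J + 1) * ?A + (4 * (9 * \<delta>) + \<delta>) * s)"
  proof (rule synth_dist_bound[OF reset_supported[OF u] _ _ x])
    fix j k assume p: "(j, k) \<in> indices J"
    let ?p = "(j, k)"
    have A: "0 \<le> ?A" by simp
    have w: "0 \<le> 2 powr (real j / 2)" by simp
    have cl: "\<bar>center ?p - \<theta>0 ?p\<bar> \<le> \<delta> / 2" by (rule center_close[OF p])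
    show "2 powr (real j / 2) * \<bar>reset u ?p - \<theta>0 ?p\<bar> \<le> ?A + 2 powr (real j / 2) * (9 * \<delta>)"
    proof (cases "bad u ?p \<and> ?p \<noteq> worst u")
      case True
      then have "2 powr (real j / 2) * \<bar>u ?p - center ?p\<bar> \<le> ?A"
        using worst_props(2)[OF u, of ?p] by simp
      moreover have "2 powr (real j / 2) * \<bar>u ?p - \<theta>0 ?p\<bar>
          \<le> 2 powr (real j / 2) * (\<bar>u ?p - center ?p\<bar> + 9 * \<delta>)"
        using cl \<delta>_pos by (intro mult_left_mono[OF _ w]) linarith
      ultimately show ?thesis using True by (simp add: reset_def distrib_left)
    next
      case False
      have "\<bar>reset u ?p - \<theta>0 ?p\<bar> \<le> 9 * \<delta>"
      proof (cases "?p = worst u")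
        case True
        then have "reset u ?p = center ?p" by (simp add: reset_def)
        then show ?thesis using cl \<delta>_pos by simp
      next
        case neq: False
        with False p have "u ?p = center ?p \<or> \<bar>u ?p - center ?p\<bar> < 16 * \<bar>center ?p - \<theta>0 ?p\<bar>"
          by (auto simp: bad_def)
        then have "\<bar>u ?p - center ?p\<bar> \<le> 8 * \<delta>"
        proof
          assume "\<bar>u ?p - center ?p\<bar> < 16 * \<bar>center ?p - \<theta>0 ?p\<bar>"
          then show ?thesis by (rule order_less_imp_le[OF order_less_le_trans]) (use cl in simp)
        qed (use \<delta>_pos in simp)
        with cl have "\<bar>u ?p - \<theta>0 ?p\<bar> \<le> 9 * \<delta>" using \<delta>_pos by linarith
        then show ?thesis using neq by (simp add: reset_def)
      qed
      from mult_left_mono[OF this w] A show ?thesis by linarith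
    qed
  qed (use \<delta>_pos in auto)
  also have "\<dots> = reset_radius u" by (simp add: reset_radius_def algebra_simps)
  finally show ?thesis .
qed

lemma reset_radius_half:
  assumes "u \<in> near_bad" shows "reset_radius u \<le> c / 2"
proof -
  let ?S = "wt (worst u) * \<bar>shift u\<bar>"
  have S: "0 \<le> ?S" "0 \<le> s * \<delta>" using \<delta>_pos by auto
  have "64 * (C * ((real J + 2) * (?S + 37 * (s * \<delta>)))) \<le> c"
  proof (rule small_consequence_linear)
    show "?S + 37 * (s * \<delta>) \<le> (near_const C + 38) * (2 ^ J * \<delta>)"
      using shift_le[OF assms] s\<delta>_le by (simp add: algebra_simps)
  qed (use S near_const_nonneg in auto)
  moreover have "reset_radius u \<le> C * ((real J + 2) * (?S + 37 * (s * \<delta>)))"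
  proof -
    have "(real J + 1) * ?S \<le> (real J + 2) * ?S" by (rule mult_right_mono) (use S in auto)
    moreover have "1 * (37 * (s * \<delta>)) \<le> (real J + 2) * (37 * (s * \<delta>))"
      by (rule mult_right_mono) (use S in auto)
    ultimately have "(real J + 1) * ?S + 37 * (s * \<delta>) \<le> (real J + 2) * (?S + 37 * (s * \<delta>))"
      unfolding distrib_left by linarith
    then show ?thesis unfolding reset_radius_def by (intro mult_left_mono) auto
  qed
  ultimately show ?thesis using c_pos by linarith
qed

text \<open>
  The second-order error of a reset is of the order of the square of this radius. The square is small relative to the weighted
  displacement: the part of the radius proportional to the displacement is small in itself, and the rest squares to
  \<open>N \<delta>\<^sup>2\<close> up to a constant, while the displacement is at least \<open>\<delta>\<close>.
\<close>
lemma reset_radius_sq: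
  assumes "u \<in> near_bad"
  shows "32 * C * (reset_radius u)\<^sup>2 \<le> c * (wt (worst u) * \<bar>shift u\<bar>)"
proof -
  let ?S = "wt (worst u) * \<bar>shift u\<bar>"
  let ?T = "s * \<delta>"
  have wt1: "1 \<le> wt (worst u)" by (rule ge_one_powr_ge_zero) auto
  have S\<delta>: "\<delta> \<le> ?S"
    using mult_mono[OF wt1 shift_ge[OF assms]] \<delta>_pos by simp
  then have S: "0 < ?S" using \<delta>_pos by linarith
  have "((real J + 1) * ?S + 37 * ?T)\<^sup>2 \<le> 2 * ((real J + 1) * ?S)\<^sup>2 + 2 * (37 * ?T)\<^sup>2"
    using zero_le_power2[of "(real J + 1) * ?S - 37 * ?T"] by (simp add: power2_eq_square algebra_simps)
  also have "(37 * ?T)\<^sup>2 = 1369 * (2 ^ J * \<delta>) * \<delta>"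
    by (simp only: power_mult_distrib powr_half_sq) (simp add: power2_eq_square)
  also have "\<dots> \<le> 1369 * (2 ^ J * \<delta>) * ?S"
    using S\<delta> \<delta>_pos by (intro mult_left_mono) auto
  also have "((real J + 1) * ?S)\<^sup>2 \<le> ((real J + 2)\<^sup>2 * ?S) * ?S"
  proof -
    have "((real J + 1) * ?S)\<^sup>2 \<le> ((real J + 2) * ?S)\<^sup>2" by (rule power_mono, rule mult_right_mono) auto
    then show ?thesis by (simp only: power2_eq_square mult_ac)
  qed
  finally have "((real J + 1) * ?S + 37 * ?T)\<^sup>2
      \<le> 2 * (((real J + 2)\<^sup>2 * ?S) + 1369 * (2 ^ J * \<delta>)) * ?S" by (simp add: algebra_simps)
  then have "32 * C * (reset_radius u)\<^sup>2
      \<le> 32 * C * (C\<^sup>2 * (2 * (((real J + 2)\<^sup>2 * ?S) + 1369 * (2 ^ J * \<delta>)) * ?S))"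
    unfolding reset_radius_def power_mult_distrib[of C] by (intro mult_left_mono) auto
  also have "\<dots> = 64 * C ^ 3 * (((real J + 2)\<^sup>2 * ?S) + 1369 * (2 ^ J * \<delta>)) * ?S"
    by (simp add: power2_eq_square power3_eq_cube)
  also have "\<dots> \<le> 64 * C ^ 3 * ((real J + 2)\<^sup>2 * (?S + 343 * (2 ^ J * \<delta>))) * ?S"
  proof -
    have "4 \<le> (real J + 2)\<^sup>2" by (simp add: power2_eq_square algebra_simps)
    then have "4 * (343 * (2 ^ J * \<delta>)) \<le> (real J + 2)\<^sup>2 * (343 * (2 ^ J * \<delta>))"
      using \<delta>_pos by (intro mult_right_mono) auto
    moreover have "0 \<le> 2 ^ J * \<delta>" using \<delta>_pos by simp
    ultimately have "((real J + 2)\<^sup>2 * ?S) + 1369 * (2 ^ J * \<delta>) \<le> (real J + 2)\<^sup>2 * (?S + 343 * (2 ^ J * \<delta>))"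
      unfolding distrib_left by linarith
    then show ?thesis using S by (intro mult_right_mono mult_left_mono) auto
  qed
  also have "\<dots> \<le> c * ?S"
  proof (rule mult_right_mono)
    show "64 * C ^ 3 * ((real J + 2)\<^sup>2 * (?S + 343 * (2 ^ J * \<delta>))) \<le> c"
      by (rule small_consequence[where K="near_const C + 344"])
        (use shift_le[OF assms] near_const_nonneg in \<open>auto simp: algebra_simps\<close>)
  qed (use S in simp)
  finally show ?thesis .
qed

text \<open>
  The fluctuations that depend on the other coordinates of \<open>u\<close> are proportional to the radius; the bound is
  in units of the displacement, because deviations are tolerated up to a fraction of it.
\<close>
lemma reset_radius_shift:
  assumes "u \<in> near_bad"
  shows "reset_radius u \<le> 38 * C * (real J + 2) * s * \<bar>shift u\<bar>"
proof -
  let ?t = "\<bar>shift u\<bar>"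
  have t: "\<delta> \<le> ?t" by (rule shift_ge[OF assms])
  have "(real J + 1) * (wt (worst u) * ?t) \<le> (real J + 2) * (s * ?t)"
    using wt_le_s[OF worst_index(2)[OF assms]] by (intro mult_mono mult_right_mono) auto
  moreover have "37 * (s * \<delta>) \<le> (37 * (real J + 2)) * (s * ?t)"
    using t \<delta>_pos by (intro mult_mono) auto
  ultimately have "(real J + 1) * (wt (worst u) * ?t) + 37 * (s * \<delta>) \<le> 38 * (real J + 2) * (s * ?t)"
    by (simp add: algebra_simps)
  then have "reset_radius u \<le> C * (38 * (real J + 2) * (s * ?t))"
    unfolding reset_radius_def by (rule mult_left_mono) simp
  then show ?thesis by (simp only: mult_ac)
qed

lemma reset_lower:
  assumes "u \<in> near_bad" "x \<in> {0..1}" shows "c / 2 \<le> synth I \<Psi> (reset u) x"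
  using reset_dist[OF assms] reset_radius_half[OF assms(1)] truth_gt[OF assms(2)]
  unfolding abs_le_iff by linarith

lemma reset_in_sieve:
  assumes "u \<in> near_bad" shows "reset u \<in> sieve c n \<delta> J"
proof -
  have "u \<in> PiE_dflt (indices J) 0 (\<lambda>_. grid n \<delta>)" using assms by (simp add: near_bad_def sieve_def)
  then have "reset u \<in> PiE_dflt (indices J) 0 (\<lambda>_. grid n \<delta>)"
    using center_grid[OF worst_index(1)[OF assms]] worst_index(1)[OF assms]
    unfolding reset_def PiE_dflt_def by (auto simp del: split_paired_All)
  then show ?thesis using reset_lower[OF assms] by (simp add: sieve_def)
qed

section \<open>Exponential moments\<close>

abbreviation wv :: "nat \<times> nat \<Rightarrow> real \<Rightarrow> real" where "wv p \<equiv> \<Psi> (fst p) (snd p)"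

text \<open>
  A Chernoff bound for \<open>\<Sum>\<^sub>i \<sigma> \<Psi> (y\<^sub>i) / a (y\<^sub>i)\<close> exceeding its mean by \<open>n \<delta> / 32\<close>: the value is at most \<open>1\<close>
  unless it does so. The exponent \<open>\<delta> / 64\<close> is optimal for second moment one.
\<close>
definition coarse_test :: "nat \<times> nat \<Rightarrow> real \<Rightarrow> (nat \<Rightarrow> real) \<Rightarrow> real" where
  "coarse_test p \<sigma> y = (\<Prod>i<n. exp (\<delta> / 64 * \<sigma> * (wv p (y i) / a (y i)) - (\<delta> / 64 * \<sigma> * \<theta>0 p + \<delta>\<^sup>2 / 2048)))"

lemma truth_pos: "x \<in> {0..1} \<Longrightarrow> 0 < a x" using truth_gt[of x] c_pos by linarith

lemma coarse_test_moment:
  assumes p: "p \<in> indices J" and \<sigma>: "\<bar>\<sigma>\<bar> = 1"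
  shows "(\<integral>\<^sup>+y. ennreal (coarse_test p \<sigma> y) \<partial>sample_law I \<Psi> n \<theta>0) \<le> ennreal (exp (real n * (- (\<delta>\<^sup>2 / 4096))))"
  unfolding coarse_test_def
proof (rule exp_moment_bound[OF truth_summable truth_norm, where V="(\<delta> / 64)\<^sup>2"])
  let ?Y = "\<lambda>x. \<delta> / 64 * \<sigma> * (wv p x / a x)"
  have k: "snd p \<in> I (fst p)" "fst p \<le> J" using p by (auto simp: indices_def)
  show "?Y \<in> borel_measurable borel" by measurable
  fix x :: real assume x: "x \<in> {0..1}"
  have "\<bar>wv p x\<bar> \<le> C * 2 powr (real (fst p) / 2)" by (rule wavelet_bound[OF x k(1)])
  also have "\<dots> \<le> C * s" by (rule mult_left_mono[OF wt_le_s[OF k(2)]]) simp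
  finally have "\<bar>wv p x\<bar> / a x \<le> C * s / c"
    using truth_gt[OF x] c_pos by (intro frac_le) auto
  then have "\<delta> / 64 * (\<bar>wv p x\<bar> / a x) \<le> \<delta> / 64 * (C * s / c)" using \<delta>_pos by (intro mult_left_mono) auto
  also have "\<dots> \<le> 1"
  proof -
    have z: "0 \<le> s * \<delta>" using \<delta>_pos by simp
    have "64 * (C * ((real J + 2) * (s * \<delta>))) \<le> c"
      by (rule small_consequence_linear[OF z s\<delta>_le]) (use near_const_nonneg in auto)
    moreover have "C * (1 * (s * \<delta>)) \<le> C * ((real J + 2) * (s * \<delta>))"
      using z by (intro mult_left_mono mult_right_mono) auto
    moreover have "0 \<le> C * (s * \<delta>)" using z by simp
    ultimately have "C * (s * \<delta>) \<le> 64 * c" using c_pos by simp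
    then show ?thesis using c_pos by (simp add: field_simps)
  qed
  finally show "\<bar>?Y x\<bar> \<le> 1" using \<sigma> truth_pos[OF x] \<delta>_pos by (simp add: abs_mult abs_divide)
next
  have k: "snd p \<in> I (fst p)" using p by (auto simp: indices_def)
  have "(\<integral>x. (\<delta> / 64 * \<sigma> * (wv p x / a x))\<^sup>2 * (a x)\<^sup>2 \<partial>unit_measure)
      = (\<integral>x. (\<delta> / 64)\<^sup>2 * (wv p x * wv p x) \<partial>unit_measure)"
  proof (rule integral_unit_cong)
    fix x :: real assume "x \<in> {0..1}"
    from truth_pos[OF this] have "a x \<noteq> 0" by simp
    moreover have "\<sigma>\<^sup>2 = 1" using \<sigma> by (metis power2_abs one_power2)
    ultimately show "(\<delta> / 64 * \<sigma> * (wv p x / a x))\<^sup>2 * (a x)\<^sup>2 = (\<delta> / 64)\<^sup>2 * (wv p x * wv p x)"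
      by (simp add: power_mult_distrib power_divide power2_eq_square[of "wv p x"])
  qed
  also have "\<dots> = (\<delta> / 64)\<^sup>2" using wavelet_orthonormal[OF k k] by simp
  finally show "(\<integral>x. (\<delta> / 64 * \<sigma> * (wv p x / a x))\<^sup>2 * (a x)\<^sup>2 \<partial>unit_measure) \<le> (\<delta> / 64)\<^sup>2" by simp
  have "(\<integral>x. \<delta> / 64 * \<sigma> * (wv p x / a x) * (a x)\<^sup>2 \<partial>unit_measure)
      = (\<integral>x. (\<delta> / 64 * \<sigma>) * (a x * wv p x) \<partial>unit_measure)"
  proof (rule integral_unit_cong)
    fix x :: real assume "x \<in> {0..1}"
    from truth_pos[OF this] have "a x \<noteq> 0" by simp
    then show "\<delta> / 64 * \<sigma> * (wv p x / a x) * (a x)\<^sup>2 = (\<delta> / 64 * \<sigma>) * (a x * wv p x)"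
      by (simp add: power2_eq_square)
  qed
  also have "\<dots> = \<delta> / 64 * \<sigma> * \<theta>0 p" using synth_coeff[OF truth_summable k] by simp
  finally show "(\<delta> / 64)\<^sup>2 + (\<integral>x. \<delta> / 64 * \<sigma> * (wv p x / a x) * (a x)\<^sup>2 \<partial>unit_measure)
      - (\<delta> / 64 * \<sigma> * \<theta>0 p + \<delta>\<^sup>2 / 2048) \<le> - (\<delta>\<^sup>2 / 4096)"
    by (simp add: power_divide)
qed

text \<open>
  What replacing \<open>a\<close> by \<open>reset u\<close> in the denominator changes.
\<close>
definition fine_diff :: "(nat \<times> nat \<Rightarrow> real) \<Rightarrow> real \<Rightarrow> real" where
  "fine_diff u x = wv (worst u) x * (1 / synth I \<Psi> (reset u) x - 1 / a x)"

definition fine_mean :: "(nat \<times> nat \<Rightarrow> real) \<Rightarrow> real" where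
  "fine_mean u = (\<integral>x. fine_diff u x * (a x)\<^sup>2 \<partial>unit_measure)"

definition fine_scale :: "(nat \<times> nat \<Rightarrow> real) \<Rightarrow> real" where
  "fine_scale u = c\<^sup>2 / (256 * (38 * C)\<^sup>2) / ((real J + 2)\<^sup>2 * 2 ^ J * \<bar>shift u\<bar>)"

text \<open>
  The Chernoff bound for a deviation by \<open>n / 32\<close> times the displacement, in the direction of the
  displacement.
\<close>
definition fine_test :: "(nat \<times> nat \<Rightarrow> real) \<Rightarrow> (nat \<Rightarrow> real) \<Rightarrow> real" where
  "fine_test u y = (\<Prod>i<n. exp (fine_scale u * sgn (shift u) * fine_diff u (y i)
     - (fine_scale u * sgn (shift u) * fine_mean u + fine_scale u * \<bar>shift u\<bar> / 32)))"

definition fine_rate :: real where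
  "fine_rate = c\<^sup>2 / (256 * (38 * C)\<^sup>2) / (64 * (real J + 2)\<^sup>2 * 2 ^ J)"

lemma fine_diff_measurable [measurable]: "fine_diff u \<in> borel_measurable borel"
  unfolding fine_diff_def[abs_def] by measurable

lemma fine_diff_eq:
  assumes "u \<in> near_bad" "x \<in> {0..1}"
  shows "fine_diff u x = wv (worst u) x * (a x - synth I \<Psi> (reset u) x) / (a x * synth I \<Psi> (reset u) x)"
proof -
  have "a x \<noteq> 0" "synth I \<Psi> (reset u) x \<noteq> 0"
    using truth_pos[OF assms(2)] reset_lower[OF assms] c_pos by auto
  then show ?thesis unfolding fine_diff_def by (simp add: field_simps)
qed

lemma fine_diff_times_a:
  assumes u: "u \<in> near_bad" and x: "x \<in> {0..1}"
  shows "\<bar>fine_diff u x * a x\<bar> \<le> \<bar>wv (worst u) x\<bar> * (2 * reset_radius u / c)"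
proof -
  let ?b = "synth I \<Psi> (reset u) x"
  have b: "c / 2 \<le> ?b" by (rule reset_lower[OF u x])
  have "fine_diff u x * a x = wv (worst u) x * ((a x - ?b) / ?b)"
    unfolding fine_diff_eq[OF u x] using truth_pos[OF x] by simp
  moreover have "\<bar>(a x - ?b) / ?b\<bar> \<le> reset_radius u / (c / 2)"
  proof -
    have "\<bar>a x - ?b\<bar> / ?b \<le> reset_radius u / (c / 2)"
      using reset_dist[OF u x] b c_pos by (intro frac_le) auto
    then show ?thesis using b c_pos by (simp add: abs_divide)
  qed
  then have "\<bar>wv (worst u) x\<bar> * \<bar>(a x - ?b) / ?b\<bar> \<le> \<bar>wv (worst u) x\<bar> * (reset_radius u / (c / 2))"
    by (rule mult_left_mono) simp
  ultimately show ?thesis by (simp add: abs_mult mult.commute)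
qed

lemma fine_test_moment:
  assumes u: "u \<in> near_bad"
  shows "(\<integral>\<^sup>+y. ennreal (fine_test u y) \<partial>sample_law I \<Psi> n \<theta>0) \<le> ennreal (exp (real n * (- fine_rate)))"
  unfolding fine_test_def
proof (rule exp_moment_bound[OF truth_summable truth_norm, where V="fine_rate"])
  let ?t = "\<bar>shift u\<bar>"
  let ?lam = "fine_scale u"
  let ?kap = "c\<^sup>2 / (256 * (38 * C)\<^sup>2)"
  let ?Q = "(real J + 2)\<^sup>2 * 2 ^ J"
  let ?Y = "\<lambda>x. ?lam * sgn (shift u) * fine_diff u x"
  have t: "0 < ?t" using shift_ge[OF u] \<delta>_pos by linarith
  have C: "0 < C" using one_le_C by linarith
  have \<kappa>: "0 < ?kap" using c_pos C by simp
  have Q: "0 < ?Q" by simp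
  have lam: "0 < ?lam" unfolding fine_scale_def using \<kappa> Q t by (intro divide_pos_pos mult_pos_pos) auto
  have sg: "\<bar>sgn (shift u)\<bar> = 1" using t by (auto simp: sgn_if)
  note k = worst_index[OF u]
  have \<rho>: "reset_radius u \<le> 38 * C * (real J + 2) * s * ?t" by (rule reset_radius_shift[OF u])
  have bound: "\<bar>?Y x\<bar> * a x \<le> ?lam * (\<bar>wv (worst u) x\<bar> * (2 * (38 * C * (real J + 2) * s * ?t) / c))"
    if x: "x \<in> {0..1}" for x
  proof -
    have "\<bar>?Y x\<bar> * a x = ?lam * \<bar>fine_diff u x * a x\<bar>"
      using lam sg truth_pos[OF x] by (simp add: abs_mult)
    also have "\<dots> \<le> ?lam * (\<bar>wv (worst u) x\<bar> * (2 * reset_radius u / c))"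
      using lam by (intro mult_left_mono fine_diff_times_a[OF u x]) auto
    also have "\<dots> \<le> ?lam * (\<bar>wv (worst u) x\<bar> * (2 * (38 * C * (real J + 2) * s * ?t) / c))"
      using lam \<rho> c_pos by (intro mult_left_mono divide_right_mono) auto
    finally show ?thesis .
  qed
  have lamt: "?lam * ?t = ?kap / ?Q" unfolding fine_scale_def using t by simp
  have lin: "?lam * (2 * (38 * C * (real J + 2) * s * ?t) / c) = c / (128 * (38 * C)) / ((real J + 2) * s)"
  proof -
    have "?lam * (2 * (38 * C * (real J + 2) * s * ?t) / c) = (?lam * ?t) * (2 * (38 * C * (real J + 2) * s) / c)"
      by simp
    also have "\<dots> = ?kap / ((real J + 2)\<^sup>2 * (s * s)) * (2 * (38 * C * (real J + 2) * s) / c)"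
      unfolding lamt s_sq ..
    also have "\<dots> = c / (128 * (38 * C)) / ((real J + 2) * s)"
      using c_pos C s_ge_1 by (simp add: power2_eq_square divide_simps)
    finally show ?thesis .
  qed
  show "?Y \<in> borel_measurable borel" by measurable
  show "\<bar>?Y x\<bar> \<le> 1" if x: "x \<in> {0..1}" for x
  proof -
    have "\<bar>wv (worst u) x\<bar> \<le> C * 2 powr (real (fst (worst u)) / 2)" by (rule wavelet_bound[OF x k(3)])
    also have "\<dots> \<le> C * s" by (rule mult_left_mono[OF wt_le_s[OF k(2)]]) simp
    finally have wb: "\<bar>wv (worst u) x\<bar> \<le> C * s" .
    have "\<bar>?Y x\<bar> * a x \<le> \<bar>wv (worst u) x\<bar> * (c / (128 * (38 * C)) / ((real J + 2) * s))"
      using bound[OF x] unfolding lin[symmetric] by (simp only: mult_ac)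
    also have "\<dots> \<le> C * s * (c / (128 * (38 * C)) / ((real J + 2) * s))"
      using c_pos s_ge_1 by (intro mult_right_mono[OF wb]) auto
    also have "\<dots> = c * (1 / (128 * 38) / (real J + 2))"
      using C s_ge_1 by (simp add: divide_simps)
    also have "\<dots> \<le> c * 1" using c_pos by (intro mult_left_mono) (auto simp: divide_simps)
    also have "\<dots> \<le> 1 * a x" using truth_gt[OF x] by simp
    finally show ?thesis using truth_pos[OF x] by (rule mult_right_le_imp_le)
  qed
  let ?c1 = "c / (128 * (38 * C)) / ((real J + 2) * s)"
  have rate: "?c1\<^sup>2 = fine_rate"
  proof -
    have "?c1\<^sup>2 = c\<^sup>2 / (128 * (38 * C))\<^sup>2 / ((real J + 2)\<^sup>2 * (s * s))"
      by (simp add: power_divide power_mult_distrib power2_eq_square[of s])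
    also have "\<dots> = fine_rate" unfolding s_sq fine_rate_def by (simp add: power2_eq_square)
    finally show ?thesis .
  qed
  have "(\<integral>x. (?Y x)\<^sup>2 * (a x)\<^sup>2 \<partial>unit_measure)
      \<le> (\<integral>x. ?c1\<^sup>2 * (wv (worst u) x * wv (worst u) x) \<partial>unit_measure)"
  proof (rule integral_unit_mono)
    have pw: "(?Y x)\<^sup>2 * (a x)\<^sup>2 \<le> ?c1\<^sup>2 * (wv (worst u) x * wv (worst u) x)" if x: "x \<in> {0..1}" for x
    proof -
      have "\<bar>?Y x * a x\<bar> \<le> \<bar>wv (worst u) x\<bar> * ?c1"
        using bound[OF x] truth_pos[OF x] unfolding lin[symmetric] abs_mult[of _ "a x"] by (simp add: mult_ac)
      then have "(?Y x * a x)\<^sup>2 \<le> (\<bar>wv (worst u) x\<bar> * ?c1)\<^sup>2" by (rule sq_le_sq)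
      then show ?thesis unfolding power_mult_distrib by (simp add: power2_eq_square mult_ac)
    qed
    show i2: "integrable unit_measure (\<lambda>x. ?c1\<^sup>2 * (wv (worst u) x * wv (worst u) x))"
      by (intro integrable_mult_right wavelet_prod_integrable k)
    show "integrable unit_measure (\<lambda>x. (?Y x)\<^sup>2 * (a x)\<^sup>2)"
      by (rule Bochner_Integration.integrable_bound[OF i2]) (measurable, intro AE_I2, simp only: real_norm_def space_unit_measure abs_of_nonneg[OF mult_nonneg_nonneg[OF zero_le_power2 zero_le_power2]],
          rule order_trans[OF pw abs_ge_self])
    fix x :: real assume "x \<in> {0..1}"
    then show "(?Y x)\<^sup>2 * (a x)\<^sup>2 \<le> ?c1\<^sup>2 * (wv (worst u) x * wv (worst u) x)" by (rule pw)
  qed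
  also have "\<dots> = fine_rate" unfolding rate using wavelet_orthonormal[OF k(3) k(3)] by simp
  finally show "(\<integral>x. (?Y x)\<^sup>2 * (a x)\<^sup>2 \<partial>unit_measure) \<le> fine_rate" .
  have "(\<integral>x. ?Y x * (a x)\<^sup>2 \<partial>unit_measure) = ?lam * sgn (shift u) * fine_mean u"
    unfolding fine_mean_def by (simp add: mult.assoc)
  moreover have "?lam * ?t / 32 = 2 * fine_rate"
    unfolding lamt fine_rate_def by simp
  ultimately show "fine_rate + (\<integral>x. ?Y x * (a x)\<^sup>2 \<partial>unit_measure)
      - (?lam * sgn (shift u) * fine_mean u + ?lam * ?t / 32) \<le> - fine_rate"
    by simp
qed

text \<open>
  With \<open>b = reset u\<close>, the identity \<open>a\<^sup>2 / b = 2 a - b + (a - b)\<^sup>2 / b\<close> gives the mean up to a quadratic remainder. The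
  remainder is integrated against \<open>\<bar>\<Psi>\<bar>\<close>, whose integral \<open>O (2\<^bsup>-j/2\<^esup>)\<close> undoes the weight in the size of the displacement.
\<close>
lemma fine_mean_bound:
  assumes u: "u \<in> near_bad"
  shows "\<bar>fine_mean u - (\<theta>0 (worst u) - center (worst u))\<bar> \<le> \<bar>shift u\<bar> / 16"
proof -
  let ?b = "synth I \<Psi> (reset u)" and ?w = "wv (worst u)"
  note k = worst_index[OF u]
  note sr = summable_supported[OF reset_supported[OF u]]
  have sv: "summable (level_norm (\<lambda>p. \<theta>0 p - reset u p))"
    by (rule summable_level_norm_diff[OF truth_summable sr])
  let ?K = "C * 2 powr (real (fst (worst u)) / 2)"
  have w_bd: "\<bar>?w x\<bar> \<le> ?K" if "x \<in> {0..1}" for x by (rule wavelet_bound[OF that k(3)])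
  have q_bd: "(a x - ?b x)\<^sup>2 / ?b x \<le> (reset_radius u)\<^sup>2 * (2 / c)" "0 \<le> (a x - ?b x)\<^sup>2 / ?b x"
    if x: "x \<in> {0..1}" for x
  proof -
    have b: "c / 2 \<le> ?b x" by (rule reset_lower[OF u x])
    have "(a x - ?b x)\<^sup>2 / ?b x \<le> (reset_radius u)\<^sup>2 / (c / 2)"
      using b c_pos reset_dist[OF u x] by (intro frac_le sq_le_sq) (auto simp: abs_minus_commute)
    then show "(a x - ?b x)\<^sup>2 / ?b x \<le> (reset_radius u)\<^sup>2 * (2 / c)" by simp
    show "0 \<le> (a x - ?b x)\<^sup>2 / ?b x" using b c_pos by (intro divide_nonneg_nonneg) auto
  qed
  have i1: "integrable unit_measure (\<lambda>x. synth I \<Psi> (\<lambda>p. \<theta>0 p - reset u p) x * ?w x)"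
  proof (rule integrable_unit_bounded[where B="C * (\<Sum>j. level_norm (\<lambda>p. \<theta>0 p - reset u p) j) * ?K"])
    fix x :: real assume x: "x \<in> {0..1}"
    show "\<bar>synth I \<Psi> (\<lambda>p. \<theta>0 p - reset u p) x * ?w x\<bar>
        \<le> C * (\<Sum>j. level_norm (\<lambda>p. \<theta>0 p - reset u p) j) * ?K"
      unfolding abs_mult using synth_bound[OF sv x] w_bd[OF x]
      by (intro mult_mono) (auto intro: order_trans[OF abs_ge_zero])
  qed measurable
  have rem: "\<bar>?w x * ((a x - ?b x)\<^sup>2 / ?b x)\<bar> \<le> (reset_radius u)\<^sup>2 * (2 / c) * \<bar>?w x\<bar>" if x: "x \<in> {0..1}" for x
  proof -
    have "\<bar>?w x\<bar> * ((a x - ?b x)\<^sup>2 / ?b x) \<le> \<bar>?w x\<bar> * ((reset_radius u)\<^sup>2 * (2 / c))"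
      by (rule mult_left_mono[OF q_bd(1)[OF x]]) simp
    then show ?thesis unfolding abs_mult abs_of_nonneg[OF q_bd(2)[OF x]] by (simp only: mult.commute)
  qed
  have iw: "integrable unit_measure (\<lambda>x. (reset_radius u)\<^sup>2 * (2 / c) * \<bar>?w x\<bar>)"
    using wavelet_integrable[OF k(3)] by auto
  have w_meas: "(\<lambda>x. ?w x * ((a x - ?b x)\<^sup>2 / ?b x)) \<in> borel_measurable borel" by measurable
  have i2: "integrable unit_measure (\<lambda>x. ?w x * ((a x - ?b x)\<^sup>2 / ?b x))"
    by (rule Bochner_Integration.integrable_bound[OF iw])
      (auto simp only: real_norm_def space_unit_measure intro!: AE_I2 order_trans[OF rem abs_ge_self] measurable_unit_measure w_meas)
  have "fine_mean u = (\<integral>x. synth I \<Psi> (\<lambda>p. \<theta>0 p - reset u p) x * ?w x + ?w x * ((a x - ?b x)\<^sup>2 / ?b x) \<partial>unit_measure)"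
    unfolding fine_mean_def
  proof (rule integral_unit_cong)
    fix x :: real assume x: "x \<in> {0..1}"
    have nz: "a x \<noteq> 0" "?b x \<noteq> 0" using truth_pos[OF x] reset_lower[OF u x] c_pos by auto
    show "fine_diff u x * (a x)\<^sup>2 = synth I \<Psi> (\<lambda>p. \<theta>0 p - reset u p) x * ?w x + ?w x * ((a x - ?b x)\<^sup>2 / ?b x)"
      unfolding fine_diff_eq[OF u x] synth_diff[OF truth_summable sr x]
      using nz by (simp add: power2_eq_square field_simps)
  qed
  also have "\<dots> = (\<theta>0 (worst u) - reset u (worst u)) + (\<integral>x. ?w x * ((a x - ?b x)\<^sup>2 / ?b x) \<partial>unit_measure)"
    using i1 i2 synth_coeff[OF sv k(3)] by simp
  finally have eq: "fine_mean u - (\<theta>0 (worst u) - center (worst u)) = (\<integral>x. ?w x * ((a x - ?b x)\<^sup>2 / ?b x) \<partial>unit_measure)"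
    by (simp add: reset_def)
  have w1: "wt (worst u) * 2 powr (- real (fst (worst u)) / 2) = 1" by (simp flip: powr_add)
  have "\<bar>\<integral>x. ?w x * ((a x - ?b x)\<^sup>2 / ?b x) \<partial>unit_measure\<bar> \<le> (\<integral>x. \<bar>?w x * ((a x - ?b x)\<^sup>2 / ?b x)\<bar> \<partial>unit_measure)"
    by (rule integral_abs_bound)
  also have "\<dots> \<le> (\<integral>x. (reset_radius u)\<^sup>2 * (2 / c) * \<bar>?w x\<bar> \<partial>unit_measure)"
    by (rule integral_unit_mono[OF integrable_abs[OF i2] iw rem])
  also have "\<dots> = (reset_radius u)\<^sup>2 * (2 / c) * (\<integral>x. \<bar>?w x\<bar> \<partial>unit_measure)" by simp
  also have "\<dots> \<le> (reset_radius u)\<^sup>2 * (2 / c) * (C * 2 powr (- real (fst (worst u)) / 2))"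
    using c_pos by (intro mult_left_mono wavelet_L1_bound k) auto
  also have "\<dots> = (32 * C * (reset_radius u)\<^sup>2) * (2 powr (- real (fst (worst u)) / 2) / (16 * c))"
    by simp
  also have "\<dots> \<le> (c * (wt (worst u) * \<bar>shift u\<bar>)) * (2 powr (- real (fst (worst u)) / 2) / (16 * c))"
    by (rule mult_right_mono[OF reset_radius_sq[OF u]]) (use c_pos in simp)
  also have "\<dots> = (wt (worst u) * 2 powr (- real (fst (worst u)) / 2)) * \<bar>shift u\<bar> / 16"
    using c_pos by simp
  also have "\<dots> = \<bar>shift u\<bar> / 16" unfolding w1 by simp
  finally show ?thesis unfolding eq .
qed

section \<open>Mass of the badly placed points\<close>

lemma sq_norm_reset:
  assumes u: "u \<in> near_bad"
  shows "sq_norm u = sq_norm (reset u) + shift u * (2 * center (worst u) + shift u)"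
proof -
  let ?p = "worst u"
  have p: "?p \<in> indices J" by (rule worst_index(1)[OF u])
  have "sq_norm u = (u ?p)\<^sup>2 + (\<Sum>p\<in>indices J - {?p}. (u p)\<^sup>2)"
    unfolding sq_norm_supported[OF near_bad_supported[OF u]] by (rule sum.remove[OF finite_indices p])
  moreover have "sq_norm (reset u) = (center ?p)\<^sup>2 + (\<Sum>p\<in>indices J - {?p}. (u p)\<^sup>2)"
    unfolding sq_norm_supported[OF reset_supported[OF u]]
    by (subst sum.remove[OF finite_indices p]) (auto simp: reset_def intro!: sum.cong)
  ultimately show ?thesis by (simp add: shift_def power2_eq_square algebra_simps)
qed

lemma synth_reset:
  assumes u: "u \<in> near_bad" and x: "x \<in> {0..1}"
  shows "synth I \<Psi> u x = synth I \<Psi> (reset u) x + shift u * wv (worst u) x"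
proof -
  let ?v = "\<lambda>p. u p - reset u p"
  obtain j k where jk: "worst u = (j, k)" by (cases "worst u")
  have k: "k \<in> I j" using worst_index[OF u] jk by simp
  have v: "?v p = (if p = (j, k) then shift u else 0)" for p
    by (auto simp: reset_def shift_def jk)
  have level: "(\<Sum>k'\<in>I i. ?v (i, k') * \<Psi> i k' x) = (if i = j then shift u * \<Psi> j k x else 0)" for i
  proof -
    have "(\<Sum>k'\<in>I i. ?v (i, k') * \<Psi> i k' x)
        = (\<Sum>k'\<in>I i. if k' = k then (if i = j then shift u * \<Psi> j k x else 0) else 0)"
      by (intro sum.cong) (auto simp: v)
    then show ?thesis using k by (auto simp: sum.delta')
  qed
  have "(\<lambda>i. if i = j then shift u * \<Psi> j k x else 0) sums (shift u * \<Psi> j k x)"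
    using sums_single[of j "\<lambda>_. shift u * \<Psi> j k x"] by simp
  then have "synth I \<Psi> ?v x = shift u * \<Psi> j k x"
    unfolding synth_def level by (rule sums_unique[symmetric])
  then show ?thesis
    using synth_diff[OF summable_supported[OF near_bad_supported[OF u]] summable_supported[OF reset_supported[OF u]] x] jk
    by simp
qed

text \<open>
  Write \<open>t\<close> for the displacement. By \<open>1 + x \<le> exp x\<close>, the log-ratio is at most
  \<open>2 t \<Sum>\<^sub>i \<Psi> (y\<^sub>i) / synth (reset u) (y\<^sub>i) - n t (2 center + t)\<close>. The means contribute
  \<open>4 n t (\<theta>0 - center)\<close> and a remainder; since the coordinate is bad, these and the deviations
  permitted by the two tests take away at most half of \<open>n t\<^sup>2\<close>.
\<close>
lemma score_reset:
  assumes u: "u \<in> near_bad" and y: "\<And>i. i < n \<Longrightarrow> y i \<in> {0..1}"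
    and coarse: "coarse_test (worst u) (sgn (shift u)) y \<le> 1" and fine: "fine_test u y \<le> 1"
  shows "score n u y \<le> exp (- (real n * \<delta>\<^sup>2 / 2)) * score n (reset u) y"
proof -
  let ?p = "worst u" and ?b = "synth I \<Psi> (reset u)" and ?g = "synth I \<Psi> u"
  define t where "t = shift u"
  define T where "T = \<bar>t\<bar>"
  define \<sigma> where "\<sigma> = sgn t"
  define A where "A = (\<Sum>i<n. wv ?p (y i) / a (y i))"
  define F where "F = (\<Sum>i<n. fine_diff u (y i))"
  define \<mu> where "\<mu> = fine_mean u"
  define e where "e = \<theta>0 ?p - center ?p"
  define N where "N = real n"
  have T: "\<delta> \<le> T" "0 < T" using shift_ge[OF u] \<delta>_pos by (auto simp: T_def t_def)
  have t_eq: "t = \<sigma> * T" by (simp add: \<sigma>_def T_def sgn_mult_abs)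
  have N0: "0 \<le> N" by (simp add: N_def)
  have sum_le: "(\<Sum>i<n. h i) \<le> 0" if "(\<Prod>i<n. exp (h i)) \<le> 1" for h :: "nat \<Rightarrow> real"
    using that by (simp flip: exp_sum)
  have "(\<Sum>i<n. \<delta> / 64 * \<sigma> * (wv ?p (y i) / a (y i)) - (\<delta> / 64 * \<sigma> * \<theta>0 ?p + \<delta>\<^sup>2 / 2048)) \<le> 0"
    using sum_le[OF coarse[unfolded coarse_test_def]] by (simp add: \<sigma>_def t_def)
  then have "\<delta> / 64 * \<sigma> * A - N * (\<delta> / 64 * \<sigma> * \<theta>0 ?p + \<delta>\<^sup>2 / 2048) \<le> 0"
    unfolding A_def N_def by (simp only: sum_subtractf sum_distrib_left[symmetric] sum_constant card_lessThan)
  then have "\<delta> / 64 * (\<sigma> * A - N * (\<sigma> * \<theta>0 ?p + \<delta> / 32)) \<le> 0"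
    by (simp add: algebra_simps power2_eq_square)
  then have A1: "\<sigma> * A \<le> N * (\<sigma> * \<theta>0 ?p + \<delta> / 32)" using \<delta>_pos by (simp add: mult_le_0_iff)
  have lam: "0 < fine_scale u"
    unfolding fine_scale_def using c_pos one_le_C T by (auto simp: T_def t_def intro!: divide_pos_pos mult_pos_pos)
  have "(\<Sum>i<n. fine_scale u * \<sigma> * fine_diff u (y i) - (fine_scale u * \<sigma> * \<mu> + fine_scale u * T / 32)) \<le> 0"
    using sum_le[OF fine[unfolded fine_test_def]] by (simp add: \<sigma>_def t_def T_def \<mu>_def)
  then have "fine_scale u * \<sigma> * F - N * (fine_scale u * \<sigma> * \<mu> + fine_scale u * T / 32) \<le> 0"
    unfolding F_def N_def by (simp only: sum_subtractf sum_distrib_left[symmetric] sum_constant card_lessThan)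
  then have "fine_scale u * (\<sigma> * F - N * (\<sigma> * \<mu> + T / 32)) \<le> 0" by (simp add: algebra_simps)
  then have F1: "\<sigma> * F \<le> N * (\<sigma> * \<mu> + T / 32)" using lam by (simp add: mult_le_0_iff)
  have "T * (\<sigma> * A) \<le> T * (N * (\<sigma> * \<theta>0 ?p + \<delta> / 32))" by (rule mult_left_mono[OF A1]) (use T in simp)
  also have "\<dots> \<le> T * (N * (\<sigma> * \<theta>0 ?p + T / 32))"
    by (intro mult_left_mono) (use T N0 in auto)
  finally have A2: "t * A \<le> N * (t * \<theta>0 ?p) + N * T\<^sup>2 / 32"
    by (simp add: t_eq algebra_simps power2_eq_square)
  have "T * (\<sigma> * F) \<le> T * (N * (\<sigma> * \<mu> + T / 32))" by (rule mult_left_mono[OF F1]) (use T in simp)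
  then have F2: "t * F \<le> N * (t * \<mu>) + N * T\<^sup>2 / 32"
    by (simp add: t_eq algebra_simps power2_eq_square)
  have e: "\<bar>e\<bar> \<le> T / 16"
    using worst_props(1)[OF u] by (simp add: bad_def e_def T_def t_def shift_def abs_minus_commute)
  have te: "t * e \<le> T\<^sup>2 / 16"
  proof -
    have "t * e \<le> \<bar>t\<bar> * \<bar>e\<bar>" unfolding abs_mult[symmetric] by (rule abs_ge_self)
    also have "\<dots> \<le> T * (T / 16)" unfolding T_def[symmetric] by (rule mult_left_mono[OF e]) (use T in simp)
    finally show ?thesis by (simp add: power2_eq_square)
  qed
  have t\<mu>: "t * (\<mu> - e) \<le> T\<^sup>2 / 16"
  proof -
    have "t * (\<mu> - e) \<le> \<bar>t\<bar> * \<bar>\<mu> - e\<bar>" unfolding abs_mult[symmetric] by (rule abs_ge_self)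
    also have "\<dots> \<le> T * (T / 16)" unfolding T_def[symmetric]
      by (rule mult_left_mono) (use T fine_mean_bound[OF u] in \<open>auto simp: \<mu>_def e_def T_def t_def\<close>)
    finally show ?thesis by (simp add: power2_eq_square)
  qed
  have split: "t * (wv ?p x / ?b x) = t * (wv ?p x / a x) + t * fine_diff u x" for x
    unfolding fine_diff_def by (simp add: algebra_simps)
  have tsum: "(\<Sum>i<n. t * (wv ?p (y i) / ?b (y i))) = t * A + t * F"
    unfolding split sum.distrib A_def F_def by (simp add: sum_distrib_left)
  have expo: "2 * (t * A + t * F) - N * (t * (2 * center ?p + t)) \<le> - (N * \<delta>\<^sup>2 / 2)"
  proof -
    have "t * (2 * center ?p + t) = 2 * (t * \<theta>0 ?p) - 2 * (t * e) + T\<^sup>2"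
      by (simp add: e_def T_def algebra_simps power2_eq_square)
    then have "2 * (t * A + t * F) - N * (t * (2 * center ?p + t))
        \<le> 2 * (N * (t * \<theta>0 ?p) + N * T\<^sup>2 / 32) + 2 * (N * (t * \<mu>) + N * T\<^sup>2 / 32)
          - N * (2 * (t * \<theta>0 ?p) - 2 * (t * e) + T\<^sup>2)"
      using A2 F2 by simp
    also have "\<dots> = N * (2 * (t * (\<mu> - e)) + 4 * (t * e) + T\<^sup>2 / 8 - T\<^sup>2)"
      by (simp add: algebra_simps)
    also have "\<dots> \<le> N * (- (T\<^sup>2 / 2))"
      using te t\<mu> by (intro mult_left_mono N0) simp
    also have "\<dots> \<le> N * (- (\<delta>\<^sup>2 / 2))"
      using power_mono[OF T(1), of 2] \<delta>_pos N0 by (intro mult_left_mono) auto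
    finally show ?thesis by simp
  qed
  have factor: "(?g (y i))\<^sup>2 \<le> (?b (y i))\<^sup>2 * exp (2 * (t * (wv ?p (y i) / ?b (y i))))" if i: "i < n" for i
  proof -
    have b: "0 < ?b (y i)" using reset_lower[OF u y[OF i]] c_pos by linarith
    have g: "0 \<le> ?g (y i)"
      using u sieve_lower[OF _ y[OF i], of u c n \<delta> J] c_pos by (auto simp: near_bad_def)
    have "?g (y i) = ?b (y i) * (1 + t * (wv ?p (y i) / ?b (y i)))"
      unfolding synth_reset[OF u y[OF i]] t_def using b by (simp add: field_simps)
    also have "\<dots> \<le> ?b (y i) * exp (t * (wv ?p (y i) / ?b (y i)))"
      using b by (intro mult_left_mono exp_ge_add_one_self) auto
    finally have "(?g (y i))\<^sup>2 \<le> (?b (y i) * exp (t * (wv ?p (y i) / ?b (y i))))\<^sup>2"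
      using g by (rule power_mono)
    then show ?thesis by (simp only: power_mult_distrib exp_double)
  qed
  have "score n u y \<le> exp (- (N * sq_norm u)) * (\<Prod>i<n. (?b (y i))\<^sup>2 * exp (2 * (t * (wv ?p (y i) / ?b (y i)))))"
    unfolding score_def N_def by (intro mult_left_mono prod_mono) (use factor in auto)
  also have "(\<Prod>i<n. (?b (y i))\<^sup>2 * exp (2 * (t * (wv ?p (y i) / ?b (y i)))))
      = (\<Prod>i<n. (?b (y i))\<^sup>2) * exp (2 * (t * A + t * F))"
    unfolding prod.distrib tsum[symmetric] by (simp add: sum_distrib_left exp_sum)
  also have "exp (- (N * sq_norm u)) * ((\<Prod>i<n. (?b (y i))\<^sup>2) * exp (2 * (t * A + t * F)))
      = exp (2 * (t * A + t * F) - N * (t * (2 * center ?p + t))) * (exp (- (N * sq_norm (reset u))) * (\<Prod>i<n. (?b (y i))\<^sup>2))"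
  proof -
    have "exp (- (N * sq_norm u)) * exp (2 * (t * A + t * F))
        = exp (2 * (t * A + t * F) - N * (t * (2 * center ?p + t))) * exp (- (N * sq_norm (reset u)))"
      unfolding exp_add[symmetric] sq_norm_reset[OF u] t_def[symmetric]
      by (rule arg_cong[where f=exp]) (simp add: algebra_simps)
    from arg_cong[OF this, of "\<lambda>z. z * (\<Prod>i<n. (?b (y i))\<^sup>2)"] show ?thesis by (simp only: mult_ac)
  qed
  also have "\<dots> \<le> exp (- (N * \<delta>\<^sup>2 / 2)) * (exp (- (N * sq_norm (reset u))) * (\<Prod>i<n. (?b (y i))\<^sup>2))"
    by (intro mult_right_mono) (use expo in \<open>auto intro!: mult_nonneg_nonneg prod_nonneg\<close>)
  finally show ?thesis unfolding score_def N_def .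
qed

text \<open>
  Resetting is injective once the coordinate and its old value are recorded, and there are only
  polynomially many possibilities for these.
\<close>

lemma reset_sum_le:
  "(\<Sum>u\<in>near_bad. score n (reset u) y)
    \<le> real (card (indices J)) * real (2 * n + 1) * (\<Sum>u\<in>sieve c n \<delta> J. score n u y)"
proof -
  let ?f = "\<lambda>u. (worst u, u (worst u), reset u)"
  let ?T = "indices J \<times> grid n \<delta> \<times> sieve c n \<delta> J"
  have inj: "inj_on ?f near_bad"
  proof (rule inj_onI)
    fix u v assume "?f u = ?f v"
    then have *: "worst u = worst v" "u (worst u) = v (worst v)" "reset u = reset v" by auto
    show "u = v"
    proof
      fix p show "u p = v p"
      proof (cases "p = worst u")
        case True with * show ?thesis by simp
      next
        case False
        then have "u p = reset u p" by (simp add: reset_def)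
        also have "\<dots> = reset v p" by (simp only: *(3))
        also have "\<dots> = v p" using False *(1) by (simp add: reset_def)
        finally show ?thesis .
      qed
    qed
  qed
  have img: "?f ` near_bad \<subseteq> ?T"
  proof
    fix z assume "z \<in> ?f ` near_bad"
    then obtain u where u: "u \<in> near_bad" "z = ?f u" by blast
    have "u (worst u) \<in> grid n \<delta>"
      using u(1) worst_index(1)[OF u(1)] by (auto simp: near_bad_def intro: sieve_grid)
    then show "z \<in> ?T" using u worst_index(1) reset_in_sieve by auto
  qed
  have "(\<Sum>u\<in>near_bad. score n (reset u) y) = (\<Sum>z\<in>?f ` near_bad. score n (snd (snd z)) y)"
    by (subst sum.reindex[OF inj]) simp
  also have "\<dots> \<le> (\<Sum>z\<in>?T. score n (snd (snd z)) y)"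
    by (rule sum_mono2[OF _ img]) (auto simp: score_nonneg)
  also have "\<dots> = (\<Sum>p\<in>indices J. \<Sum>v\<in>grid n \<delta>. \<Sum>u\<in>sieve c n \<delta> J. score n u y)"
    by (simp add: sum.cartesian_product' case_prod_beta)
  also have "\<dots> = real (card (indices J)) * real (card (grid n \<delta>)) * (\<Sum>u\<in>sieve c n \<delta> J. score n u y)"
    by simp
  also have "\<dots> \<le> real (card (indices J)) * real (2 * n + 1) * (\<Sum>u\<in>sieve c n \<delta> J. score n u y)"
    using card_grid[of n \<delta>] by (intro mult_right_mono mult_left_mono sum_nonneg score_nonneg of_nat_mono) auto
  finally show ?thesis .
qed

definition far :: "(nat \<times> nat \<Rightarrow> real) set" where
  "far = {u \<in> sieve c n \<delta> J. \<not> near u}"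

definition bad_set :: "(nat \<times> nat \<Rightarrow> real) set" where
  "bad_set = {u \<in> sieve c n \<delta> J. \<exists>p. bad u p}"

text \<open>
  Either one of the first three sums is at least \<open>1\<close>, and then the bound is trivial, or all comparisons succeed.
  Replacing indicators of the exceptional events by the exponentials that bound them leaves only products
  over the sample to integrate.
\<close>
definition bad_mass_bound :: "(nat \<Rightarrow> real) \<Rightarrow> real" where
  "bad_mass_bound y = (\<Sum>u\<in>far. \<Prod>i<n. root_ratio u (y i))
    + (\<Sum>p\<in>indices J. coarse_test p 1 y + coarse_test p (- 1) y)
    + (\<Sum>u\<in>near_bad. fine_test u y)
    + real (card (indices J)) * real (2 * n + 1) * exp (- (real n * \<delta>\<^sup>2 / 2))"

lemma finite_far [simp]: "finite far" by (simp add: far_def)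
lemma finite_near_bad [simp]: "finite near_bad" by (simp add: near_bad_def)

lemma root_ratio_nonneg: "u \<in> sieve c n \<delta> J \<Longrightarrow> x \<in> {0..1} \<Longrightarrow> 0 \<le> root_ratio u x"
  using sieve_lower[of u c n \<delta> J x] center_pos[of x] c_pos unfolding root_ratio_def
  by (intro mult_nonneg_nonneg divide_nonneg_nonneg) auto

lemma coarse_test_nonneg: "0 \<le> coarse_test p \<sigma> y"
  unfolding coarse_test_def by (intro prod_nonneg) auto

lemma fine_test_nonneg: "0 \<le> fine_test u y"
  unfolding fine_test_def by (intro prod_nonneg) auto

lemma bad_mass_le:
  assumes y: "\<And>i. i < n \<Longrightarrow> y i \<in> {0..1}"
  shows "(\<Sum>u\<in>bad_set. score n u y) \<le> bad_mass_bound y * (\<Sum>u\<in>sieve c n \<delta> J. score n u y)"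
proof -
  let ?Z = "\<Sum>u\<in>sieve c n \<delta> J. score n u y"
  let ?R = "\<lambda>u. \<Prod>i<n. root_ratio u (y i)"
  let ?K = "real (card (indices J)) * real (2 * n + 1) * exp (- (real n * \<delta>\<^sup>2 / 2))"
  let ?FR = "\<Sum>u\<in>far. ?R u"
  let ?CT = "\<Sum>p\<in>indices J. coarse_test p 1 y + coarse_test p (- 1) y"
  let ?FT = "\<Sum>u\<in>near_bad. fine_test u y"
  have Z: "0 \<le> ?Z" by (intro sum_nonneg score_nonneg)
  have R0: "0 \<le> ?R u" if "u \<in> far" for u
    using that y by (intro prod_nonneg) (auto simp: far_def intro!: root_ratio_nonneg)
  have FR: "0 \<le> ?FR" by (intro sum_nonneg R0)
  have CT: "0 \<le> ?CT" by (intro sum_nonneg add_nonneg_nonneg coarse_test_nonneg)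
  have FT: "0 \<le> ?FT" by (intro sum_nonneg fine_test_nonneg)
  have K: "0 \<le> ?K" by simp
  have bound: "bad_mass_bound y = ?FR + ?CT + ?FT + ?K" by (simp add: bad_mass_bound_def)
  show ?thesis
  proof (cases "1 \<le> bad_mass_bound y")
    case True
    have "(\<Sum>u\<in>bad_set. score n u y) \<le> ?Z"
      by (rule sum_mono2) (auto simp: bad_set_def score_nonneg)
    also have "\<dots> = 1 * ?Z" by simp
    also have "\<dots> \<le> bad_mass_bound y * ?Z" by (rule mult_right_mono[OF True Z])
    finally show ?thesis .
  next
    case False
    then have small: "?FR < 1" "?CT < 1" "?FT < 1" using FR CT FT K unfolding bound by linarith+
    have far_le: "score n u y \<le> ?R u * ?Z" if u: "u \<in> far" for u
    proof -
      have "?R u \<le> ?FR" by (rule member_le_sum) (use u R0 in auto)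
      then have "?R u \<le> 1" using small by linarith
      then have "(?R u)\<^sup>2 \<le> ?R u" using R0[OF u] by (simp add: power2_eq_square mult_left_le)
      moreover have "score n center y \<le> ?Z"
        by (rule member_le_sum[OF center_in_sieve]) (auto simp: score_nonneg)
      moreover have "score n u y = (?R u)\<^sup>2 * score n center y" by (rule score_root_ratio[OF y])
      ultimately show ?thesis
        using R0[OF u] by (auto intro!: mult_mono score_nonneg)
    qed
    have near_le: "score n u y \<le> exp (- (real n * \<delta>\<^sup>2 / 2)) * score n (reset u) y" if u: "u \<in> near_bad" for u
    proof (rule score_reset[OF u y])
      let ?p = "worst u"
      have "coarse_test ?p 1 y + coarse_test ?p (- 1) y \<le> ?CT"
        by (rule member_le_sum[OF worst_index(1)[OF u]]) (auto intro!: add_nonneg_nonneg coarse_test_nonneg)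
      then have "coarse_test ?p 1 y \<le> 1" "coarse_test ?p (- 1) y \<le> 1"
        using small coarse_test_nonneg[of ?p 1 y] coarse_test_nonneg[of ?p "- 1" y] by linarith+
      moreover have "shift u \<noteq> 0" using shift_ge[OF u] \<delta>_pos by auto
      ultimately show "coarse_test ?p (sgn (shift u)) y \<le> 1" by (auto simp: sgn_if)
      have "fine_test u y \<le> ?FT" by (rule member_le_sum[OF u]) (auto intro!: fine_test_nonneg)
      then show "fine_test u y \<le> 1" using small by linarith
    qed
    have sub: "bad_set \<subseteq> far \<union> near_bad" by (auto simp: bad_set_def far_def near_bad_def)
    have "(\<Sum>u\<in>bad_set. score n u y) \<le> (\<Sum>u\<in>far \<union> near_bad. score n u y)"
      by (rule sum_mono2[OF _ sub]) (auto simp: score_nonneg)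
    also have "\<dots> = (\<Sum>u\<in>far. score n u y) + (\<Sum>u\<in>near_bad. score n u y)"
      by (rule sum.union_disjoint) (auto simp: far_def near_bad_def)
    also have "(\<Sum>u\<in>far. score n u y) \<le> ?FR * ?Z"
      unfolding sum_distrib_right by (rule sum_mono[OF far_le])
    also have "(\<Sum>u\<in>near_bad. score n u y) \<le> ?K * ?Z"
    proof -
      have "(\<Sum>u\<in>near_bad. score n u y) \<le> (\<Sum>u\<in>near_bad. exp (- (real n * \<delta>\<^sup>2 / 2)) * score n (reset u) y)"
        by (rule sum_mono[OF near_le])
      also have "\<dots> = exp (- (real n * \<delta>\<^sup>2 / 2)) * (\<Sum>u\<in>near_bad. score n (reset u) y)"
        by (simp add: sum_distrib_left)
      also have "\<dots> \<le> exp (- (real n * \<delta>\<^sup>2 / 2)) * (real (card (indices J)) * real (2 * n + 1) * ?Z)"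
        by (rule mult_left_mono[OF reset_sum_le]) simp
      finally show ?thesis by (simp only: mult_ac)
    qed
    also have "?FR * ?Z + ?K * ?Z \<le> bad_mass_bound y * ?Z"
      unfolding distrib_right[symmetric] by (rule mult_right_mono[OF _ Z]) (use CT FT in \<open>simp add: bound\<close>)
    finally show ?thesis by simp
  qed
qed

lemma sample_prod_measurable:
  fixes F :: "real \<Rightarrow> real"
  assumes [measurable]: "F \<in> borel_measurable borel"
  shows "(\<lambda>y. \<Prod>i<n. F (y i)) \<in> borel_measurable (sample_law I \<Psi> n \<theta>)"
proof -
  have "(\<lambda>y. F (y i)) \<in> borel_measurable (sample_law I \<Psi> n \<theta>)" if "i < n" for i
    unfolding sample_law_def
    by (rule measurable_compose[OF measurable_component_singleton]) (use that in auto)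
  then show ?thesis by (intro borel_measurable_prod) auto
qed

lemma bad_mass_parts_measurable:
  shows "(\<lambda>y. \<Prod>i<n. root_ratio u (y i)) \<in> borel_measurable (sample_law I \<Psi> n \<theta>)"
    and "coarse_test p \<sigma> \<in> borel_measurable (sample_law I \<Psi> n \<theta>)"
    and "fine_test u \<in> borel_measurable (sample_law I \<Psi> n \<theta>)"
proof -
  show "(\<lambda>y. \<Prod>i<n. root_ratio u (y i)) \<in> borel_measurable (sample_law I \<Psi> n \<theta>)"
    by (rule sample_prod_measurable) (unfold root_ratio_def[abs_def], measurable)
  show "coarse_test p \<sigma> \<in> borel_measurable (sample_law I \<Psi> n \<theta>)"
    unfolding coarse_test_def[abs_def] by (rule sample_prod_measurable) measurable
  show "fine_test u \<in> borel_measurable (sample_law I \<Psi> n \<theta>)"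
    unfolding fine_test_def[abs_def] by (rule sample_prod_measurable) measurable
qed

lemma bad_mass_measurable: "bad_mass_bound \<in> borel_measurable (sample_law I \<Psi> n \<theta>)"
  unfolding bad_mass_bound_def[abs_def]
  by (intro borel_measurable_add borel_measurable_sum bad_mass_parts_measurable borel_measurable_const)

lemma bad_mass_moment:
  "(\<integral>\<^sup>+y. ennreal (bad_mass_bound y) \<partial>sample_law I \<Psi> n \<theta>0)
    \<le> ennreal (real (card (sieve c n \<delta> J)) * exp (- (real n * (2 ^ J * \<delta>\<^sup>2) * (4 * C + 1)))
      + 2 * real (card (indices J)) * exp (- (real n * \<delta>\<^sup>2 / 4096))
      + real (card (sieve c n \<delta> J)) * exp (- (real n * fine_rate))
      + real (card (indices J)) * real (2 * n + 1) * exp (- (real n * \<delta>\<^sup>2 / 2)))"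
proof -
  let ?S = "sample_law I \<Psi> n \<theta>0"
  let ?R = "\<lambda>u y. \<Prod>i<n. root_ratio u (y i)"
  let ?K = "real (card (indices J)) * real (2 * n + 1) * exp (- (real n * \<delta>\<^sup>2 / 2))"
  let ?E1 = "exp (- (real n * (2 ^ J * \<delta>\<^sup>2) * (4 * C + 1)))"
  let ?E2 = "exp (- (real n * \<delta>\<^sup>2 / 4096))"
  let ?E3 = "exp (- (real n * fine_rate))"
  have plus4: "ennreal (x1 + x2 + x3 + x4) = ennreal x1 + ennreal x2 + ennreal x3 + ennreal x4"
    if "0 \<le> x1" "0 \<le> x2" "0 \<le> x3" "0 \<le> x4" for x1 x2 x3 x4 :: real
    using that by (simp add: ennreal_plus)
  have mR: "(\<lambda>y. ennreal (?R u y)) \<in> borel_measurable ?S" for u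
    by (rule measurable_compose[OF bad_mass_parts_measurable(1) measurable_ennreal])
  have mC: "(\<lambda>y. ennreal (coarse_test p \<sigma> y)) \<in> borel_measurable ?S" for p \<sigma>
    by (rule measurable_compose[OF bad_mass_parts_measurable(2) measurable_ennreal])
  have mF: "(\<lambda>y. ennreal (fine_test u y)) \<in> borel_measurable ?S" for u
    by (rule measurable_compose[OF bad_mass_parts_measurable(3) measurable_ennreal])
  have "(\<integral>\<^sup>+y. ennreal (bad_mass_bound y) \<partial>?S)
      = (\<integral>\<^sup>+y. (\<Sum>u\<in>far. ennreal (?R u y))
          + (\<Sum>p\<in>indices J. ennreal (coarse_test p 1 y) + ennreal (coarse_test p (- 1) y))
          + (\<Sum>u\<in>near_bad. ennreal (fine_test u y)) + ennreal ?K \<partial>?S)"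
  proof (rule nn_integral_cong)
    fix y assume "y \<in> space ?S"
    then have y: "y i \<in> {0..1}" if "i < n" for i using that by (rule sample_space)
    have R0: "0 \<le> ?R u y" if "u \<in> far" for u
      using that y by (intro prod_nonneg) (auto simp: far_def intro!: root_ratio_nonneg)
    have "ennreal (bad_mass_bound y) = ennreal (\<Sum>u\<in>far. ?R u y)
        + ennreal (\<Sum>p\<in>indices J. coarse_test p 1 y + coarse_test p (- 1) y)
        + ennreal (\<Sum>u\<in>near_bad. fine_test u y) + ennreal ?K"
      unfolding bad_mass_bound_def
    proof (rule plus4)
      show "0 \<le> (\<Sum>u\<in>far. ?R u y)" by (rule sum_nonneg) (rule R0)
      show "0 \<le> (\<Sum>p\<in>indices J. coarse_test p 1 y + coarse_test p (- 1) y)"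
        by (intro sum_nonneg add_nonneg_nonneg coarse_test_nonneg)
      show "0 \<le> (\<Sum>u\<in>near_bad. fine_test u y)" by (intro sum_nonneg fine_test_nonneg)
    qed simp
    also have "ennreal (\<Sum>u\<in>far. ?R u y) = (\<Sum>u\<in>far. ennreal (?R u y))"
      by (rule sum_ennreal[symmetric]) (rule R0)
    also have "ennreal (\<Sum>u\<in>near_bad. fine_test u y) = (\<Sum>u\<in>near_bad. ennreal (fine_test u y))"
      by (rule sum_ennreal[symmetric]) (rule fine_test_nonneg)
    also have "ennreal (\<Sum>p\<in>indices J. coarse_test p 1 y + coarse_test p (- 1) y)
        = (\<Sum>p\<in>indices J. ennreal (coarse_test p 1 y) + ennreal (coarse_test p (- 1) y))"
      by (subst sum_ennreal[symmetric])
        (auto intro!: add_nonneg_nonneg coarse_test_nonneg sum.cong ennreal_plus)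
    finally show "ennreal (bad_mass_bound y) = (\<Sum>u\<in>far. ennreal (?R u y))
          + (\<Sum>p\<in>indices J. ennreal (coarse_test p 1 y) + ennreal (coarse_test p (- 1) y))
          + (\<Sum>u\<in>near_bad. ennreal (fine_test u y)) + ennreal ?K" .
  qed
  also have "\<dots> = (\<Sum>u\<in>far. \<integral>\<^sup>+y. ennreal (?R u y) \<partial>?S)
      + (\<Sum>p\<in>indices J. (\<integral>\<^sup>+y. ennreal (coarse_test p 1 y) \<partial>?S) + (\<integral>\<^sup>+y. ennreal (coarse_test p (- 1) y) \<partial>?S))
      + (\<Sum>u\<in>near_bad. \<integral>\<^sup>+y. ennreal (fine_test u y) \<partial>?S) + (\<integral>\<^sup>+y. ennreal ?K \<partial>?S)"
    using mR mC mF by (simp add: nn_integral_add nn_integral_sum)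
  also have "\<dots> \<le> (\<Sum>u\<in>far. ennreal ?E1) + (\<Sum>p\<in>indices J. ennreal ?E2 + ennreal ?E2)
      + (\<Sum>u\<in>near_bad. ennreal ?E3) + ennreal ?K"
  proof (intro add_mono sum_mono)
    fix u assume "u \<in> far"
    then have u: "u \<in> sieve c n \<delta> J" "(near_const C)\<^sup>2 * 2 ^ J * \<delta>\<^sup>2 < dist_sq u"
      by (auto simp: far_def near_def)
    have "7 * dist_sq center - dist_sq u / 4 \<le> - ((2 ^ J * \<delta>\<^sup>2) * (4 * C + 1))"
      using u(2) center_dist_sq unfolding near_const_sq by (simp add: algebra_simps)
    then have "real n * (7 * dist_sq center - dist_sq u / 4) \<le> real n * - ((2 ^ J * \<delta>\<^sup>2) * (4 * C + 1))"
      by (rule mult_left_mono) simp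
    then have "ennreal (exp (real n * (7 * dist_sq center - dist_sq u / 4))) \<le> ennreal ?E1"
      by (intro ennreal_leI) (simp add: mult.assoc)
    with root_ratio_moment[OF u(1)] show "(\<integral>\<^sup>+y. ennreal (?R u y) \<partial>?S) \<le> ennreal ?E1" by (rule order_trans)
  next
    fix p assume p: "p \<in> indices J"
    show "(\<integral>\<^sup>+y. ennreal (coarse_test p 1 y) \<partial>?S) \<le> ennreal ?E2"
      using coarse_test_moment[OF p, of 1] by simp
    show "(\<integral>\<^sup>+y. ennreal (coarse_test p (- 1) y) \<partial>?S) \<le> ennreal ?E2"
      using coarse_test_moment[OF p, of "- 1"] by simp
  next
    fix u assume "u \<in> near_bad"
    then show "(\<integral>\<^sup>+y. ennreal (fine_test u y) \<partial>?S) \<le> ennreal ?E3"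
      using fine_test_moment by simp
  next
    have "(\<integral>\<^sup>+y. ennreal (\<Prod>i<n. 1) \<partial>?S) = ennreal ((\<integral>x. 1 * (a x)\<^sup>2 \<partial>unit_measure) ^ n)"
      by (rule nn_integral_sample_prod[OF truth_summable truth_norm, where B=1]) auto
    then have "emeasure ?S (space ?S) = 1" using truth_norm by simp
    then show "(\<integral>\<^sup>+y. ennreal ?K \<partial>?S) \<le> ennreal ?K" by simp
  qed
  also have "\<dots> = ennreal (real (card far) * ?E1 + real (card (indices J)) * (?E2 + ?E2) + real (card near_bad) * ?E3 + ?K)"
    by (subst plus4) (simp_all add: ennreal_mult' ennreal_of_nat_eq_real_of_nat flip: mult_2)
  also have "\<dots> \<le> ennreal (real (card (sieve c n \<delta> J)) * ?E1 + 2 * real (card (indices J)) * ?E2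
      + real (card (sieve c n \<delta> J)) * ?E3 + ?K)"
  proof (rule ennreal_leI, intro add_mono mult_right_mono)
    show "real (card far) \<le> real (card (sieve c n \<delta> J))" "real (card near_bad) \<le> real (card (sieve c n \<delta> J))"
      by (auto intro!: card_mono simp: far_def near_bad_def)
  qed auto
  finally show ?thesis .
qed

end

section \<open>Sieve priors with prescribed multiplicities\<close>

lemma weighted_list_exists:
  fixes m :: "'a \<Rightarrow> nat" and th :: "'a \<Rightarrow> 'b"
  assumes fin: "finite U" and ne: "U \<noteq> {}" and m: "\<And>u. u \<in> U \<Longrightarrow> 0 < m u"
  obtains ts where "ts \<noteq> []" "set ts = th ` U"
    "\<And>F :: 'b \<Rightarrow> ennreal. (\<Sum>l<length ts. F (ts ! l)) = (\<Sum>u\<in>U. of_nat (m u) * F (th u))"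
proof -
  obtain us where us: "set us = U" "distinct us" using finite_distinct_list[OF fin] by blast
  define ts where "ts = concat (map (\<lambda>u. replicate (m u) (th u)) us)"
  have set_ts: "set ts = th ` U" using m us by (auto simp: ts_def)
  then have "ts \<noteq> []" using ne by auto
  moreover note set_ts
  moreover have "(\<Sum>l<length ts. F (ts ! l)) = (\<Sum>u\<in>U. of_nat (m u) * F (th u))" for F :: "'b \<Rightarrow> ennreal"
  proof -
    have "(\<Sum>l<length ts. F (ts ! l)) = sum_list (map F ts)"
      by (simp add: sum_list_sum_nth atLeast0LessThan)
    also have "\<dots> = sum_list (map (\<lambda>u. of_nat (m u) * F (th u)) us)"
      unfolding ts_def by (induction us) (simp_all add: sum_list_replicate)
    also have "\<dots> = (\<Sum>u\<in>U. of_nat (m u) * F (th u))"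
      using us by (simp add: sum_list_distinct_conv_sum_set)
    finally show ?thesis .
  qed
  ultimately show thesis by (rule that)
qed

lemma posterior_null:
  assumes "S \<inter> set_pmf \<pi> = {}"
  shows "emeasure (posterior I \<Psi> \<pi> n y) S = 0"
proof -
  have AE: "AE \<theta> in measure_pmf \<pi>. \<theta> \<notin> S" using assms by (auto simp: AE_measure_pmf_iff)
  then have "emeasure (measure_pmf \<pi>) S = 0"
    using emeasure_eq_0_AE[where M="measure_pmf \<pi>" and P="\<lambda>\<theta>. \<theta> \<in> S"] by simp
  moreover have "emeasure (density (measure_pmf \<pi>) f) S = 0" for f :: "_ \<Rightarrow> ennreal"
  proof -
    have "AE \<theta> in measure_pmf \<pi>. f \<theta> * indicator S \<theta> = 0" using AE by eventually_elim simp
    then have "(\<integral>\<^sup>+\<theta>. f \<theta> * indicator S \<theta> \<partial>measure_pmf \<pi>) = 0" by (subst nn_integral_0_iff_AE) auto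
    then show ?thesis by (subst emeasure_density) auto
  qed
  ultimately show ?thesis by (simp add: posterior_def)
qed

text \<open>
  Repeating an entry of the list realises any weights that are positive integers.
\<close>
lemma posterior_weighted:
  fixes m :: "'a \<Rightarrow> nat"
  assumes fin: "finite U" and ne: "U \<noteq> {}" and m: "\<And>u. u \<in> U \<Longrightarrow> 0 < m u"
    and th: "\<And>u. u \<in> U \<Longrightarrow> th u \<in> density_params I \<Psi>"
  obtains \<pi> where "sieve_prior I \<Psi> \<pi>" "set_pmf \<pi> = th ` U"
    "\<And>n y S. (\<And>u. u \<in> U \<Longrightarrow> 0 < likelihood I \<Psi> n y (th u)) \<Longrightarrow>
      emeasure (posterior I \<Psi> \<pi> n y) S
      = ennreal ((\<Sum>u | u \<in> U \<and> th u \<in> S. real (m u) * likelihood I \<Psi> n y (th u))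
          / (\<Sum>u\<in>U. real (m u) * likelihood I \<Psi> n y (th u)))"
proof -
  obtain ts where ts: "ts \<noteq> []" "set ts = th ` U"
    and sum_ts: "\<And>F :: _ \<Rightarrow> ennreal. (\<Sum>l<length ts. F (ts ! l)) = (\<Sum>u\<in>U. of_nat (m u) * F (th u))"
    by (rule weighted_list_exists[where th=th and m=m, OF fin ne]) (erule m, rule that)
  define \<pi> where "\<pi> = map_pmf (\<lambda>l. ts ! l) (pmf_of_set {..<length ts})"
  let ?n = "real (length ts)"
  have len: "0 < ?n" using ts(1) by simp
  have ne': "{..<length ts} \<noteq> {}" using ts(1) by (auto simp: lessThan_empty_iff)
  have "sieve_prior I \<Psi> \<pi>" unfolding sieve_prior_def
    by (rule exI[of _ ts], intro conjI ts(1) \<pi>_def) (use ts(2) th in auto)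
  moreover have "set_pmf \<pi> = th ` U"
  proof -
    have "set_pmf \<pi> = (\<lambda>l. ts ! l) ` {..<length ts}" using ne' by (simp add: \<pi>_def)
    also have "\<dots> = set ts" by (auto simp: set_conv_nth)
    finally show ?thesis using ts(2) by simp
  qed
  moreover have "emeasure (posterior I \<Psi> \<pi> n y) S
      = ennreal ((\<Sum>u | u \<in> U \<and> th u \<in> S. real (m u) * likelihood I \<Psi> n y (th u))
          / (\<Sum>u\<in>U. real (m u) * likelihood I \<Psi> n y (th u)))"
    if pos: "\<And>u. u \<in> U \<Longrightarrow> 0 < likelihood I \<Psi> n y (th u)" for n y S
  proof -
    let ?lik = "likelihood I \<Psi> n y"
    define T where "T = (\<Sum>u\<in>U. real (m u) * ?lik (th u))"
    have lik0: "0 \<le> ?lik (th u)" if "u \<in> U" for u using pos[OF that] by simp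
    have T: "0 < T" unfolding T_def using m pos by (intro sum_pos fin ne) auto
    have int: "(\<integral>\<^sup>+\<theta>. F \<theta> \<partial>measure_pmf \<pi>) = (\<Sum>u\<in>U. of_nat (m u) * F (th u)) / ennreal ?n" for F
      unfolding \<pi>_def using ne' by (simp add: nn_integral_pmf_of_set sum_ts ennreal_of_nat_eq_real_of_nat)
    have ev: "evidence I \<Psi> \<pi> n y = ennreal (T / ?n)"
    proof -
      have "(\<Sum>u\<in>U. of_nat (m u) * ennreal (?lik (th u))) = ennreal T"
        unfolding T_def using pos
        by (subst sum_ennreal[symmetric])
          (auto simp: ennreal_mult' ennreal_of_nat_eq_real_of_nat less_imp_le intro!: sum.cong)
      then show ?thesis unfolding evidence_def int using T len by (simp add: divide_ennreal)
    qed
    have "evidence I \<Psi> \<pi> n y \<noteq> 0" unfolding ev using T len by simp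
    then have "emeasure (posterior I \<Psi> \<pi> n y) S
        = (\<integral>\<^sup>+\<theta>. ennreal (?lik \<theta>) / evidence I \<Psi> \<pi> n y * indicator S \<theta> \<partial>measure_pmf \<pi>)"
      by (simp add: posterior_def emeasure_density)
    also have "\<dots> = (\<Sum>u\<in>U. of_nat (m u) * (ennreal (?lik (th u)) / ennreal (T / ?n) * indicator S (th u))) / ennreal ?n"
      unfolding int ev ..
    also have "(\<Sum>u\<in>U. of_nat (m u) * (ennreal (?lik (th u)) / ennreal (T / ?n) * indicator S (th u)))
        = (\<Sum>u\<in>U. ennreal (if th u \<in> S then real (m u) * ?lik (th u) / (T / ?n) else 0))"
    proof (rule sum.cong[OF refl])
      fix u assume u: "u \<in> U"
      have "of_nat (m u) * (ennreal (?lik (th u)) / ennreal (T / ?n)) = ennreal (real (m u) * ?lik (th u) / (T / ?n))"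
        using pos[OF u] T len
        by (simp add: divide_ennreal ennreal_of_nat_eq_real_of_nat flip: ennreal_mult)
      then show "of_nat (m u) * (ennreal (?lik (th u)) / ennreal (T / ?n) * indicator S (th u))
          = ennreal (if th u \<in> S then real (m u) * ?lik (th u) / (T / ?n) else 0)"
        by (auto simp: indicator_def)
    qed
    also have "\<dots> = ennreal (\<Sum>u\<in>U. if th u \<in> S then real (m u) * ?lik (th u) / (T / ?n) else 0)"
      using T len by (intro sum_ennreal) (auto intro!: divide_nonneg_nonneg mult_nonneg_nonneg lik0)
    also have "(\<Sum>u\<in>U. if th u \<in> S then real (m u) * ?lik (th u) / (T / ?n) else 0)
        = (\<Sum>u | u \<in> U \<and> th u \<in> S. real (m u) * ?lik (th u)) / (T / ?n)"
      unfolding sum_divide_distrib by (rule sum.inter_filter[OF fin, symmetric])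
    also have "ennreal \<dots> / ennreal ?n = ennreal ((\<Sum>u | u \<in> U \<and> th u \<in> S. real (m u) * ?lik (th u)) / (T / ?n) / ?n)"
      using T len by (intro divide_ennreal) (auto intro!: divide_nonneg_nonneg sum_nonneg mult_nonneg_nonneg lik0)
    also have "(\<Sum>u | u \<in> U \<and> th u \<in> S. real (m u) * ?lik (th u)) / (T / ?n) / ?n
        = (\<Sum>u | u \<in> U \<and> th u \<in> S. real (m u) * ?lik (th u)) / T"
      using len by simp
    finally show ?thesis unfolding T_def .
  qed
  ultimately show thesis by (rule that)
qed

context wavelet_system
begin

definition normalized :: "(nat \<times> nat \<Rightarrow> real) \<Rightarrow> nat \<times> nat \<Rightarrow> real" where
  "normalized u p = (1 / sqrt (sq_norm u)) * u p"

lemma sieve_sq_norm: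
  assumes "u \<in> sieve c n \<delta> J" "0 < c" shows "c\<^sup>2 / 4 \<le> sq_norm u"
proof -
  have "(\<integral>x. (c / 2)\<^sup>2 \<partial>unit_measure) \<le> sq_norm u"
    unfolding sq_norm_def
  proof (rule integral_unit_mono)
    show "integrable unit_measure (\<lambda>x. (synth I \<Psi> u x)\<^sup>2)"
      by (rule synth_sq_integrable[OF summable_supported[OF sieve_supported[OF assms(1)]]])
    fix x :: real assume "x \<in> {0..1}"
    then show "(c / 2)\<^sup>2 \<le> (synth I \<Psi> u x)\<^sup>2"
      using sieve_lower[OF assms(1)] assms(2) by (intro power_mono) auto
  qed simp
  then show ?thesis by (simp add: unit_measure.prob_space[simplified] power_divide)
qed

lemma normalized_density_params:
  assumes u: "u \<in> sieve c n \<delta> J" and c: "0 < c"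
  shows "normalized u \<in> density_params I \<Psi>"
proof -
  have "0 < c\<^sup>2 / 4" using c by simp
  then have q: "0 < sq_norm u" using sieve_sq_norm[OF u c] by linarith
  note s = sieve_supported[OF u]
  have "((\<lambda>p. (1 / sq_norm u) * (u p)\<^sup>2) has_sum (1 / sq_norm u) * sq_norm u) (Lam I)"
    unfolding sq_norm_supported[OF s] by (rule has_sum_cmult_right[OF has_sum_supported[OF s]])
  then have "normalized u \<in> unit_l2 I"
    using q by (simp add: unit_l2_def normalized_def power_divide)
  moreover have "0 \<le> synth I \<Psi> (normalized u) x" if x: "x \<in> {0..1}" for x
  proof -
    have "synth I \<Psi> (normalized u) x = 1 / sqrt (sq_norm u) * synth I \<Psi> u x"
      unfolding normalized_def[abs_def] by (rule synth_scale[OF summable_supported[OF s] x])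
    then show ?thesis using q sieve_lower[OF u x] c by simp
  qed
  ultimately show ?thesis by (simp add: density_params_def)
qed

text \<open>
  The multiplicity of \<open>u\<close> is \<open>K W(u)\<close> rounded up, where \<open>W(u) = sq_norm u ^ n * exp (- n * sq_norm u)\<close> and \<open>K\<close> is so
  large that \<open>K W(u) \<ge> 1\<close> for all \<open>u\<close>. Rounding costs the factor two.
\<close>

lemma sieve_prior_exists:
  assumes c: "0 < c" and ne: "sieve c n \<delta> J \<noteq> {}"
  obtains \<pi> where "sieve_prior I \<Psi> \<pi>" "set_pmf \<pi> = normalized ` sieve c n \<delta> J"
    "\<And>y S. (\<And>i. i < n \<Longrightarrow> y i \<in> {0..1}) \<Longrightarrow>
      emeasure (posterior I \<Psi> \<pi> n y) S
      \<le> ennreal (2 * (\<Sum>u | u \<in> sieve c n \<delta> J \<and> normalized u \<in> S. score n u y)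
          / (\<Sum>u\<in>sieve c n \<delta> J. score n u y))"
proof -
  let ?U = "sieve c n \<delta> J"
  define W where "W u = sq_norm u ^ n * exp (- (real n * sq_norm u))" for u
  have q: "0 < sq_norm u" if "u \<in> ?U" for u
  proof -
    have "0 < c\<^sup>2 / 4" using c by simp
    then show ?thesis using sieve_sq_norm[OF that c] by linarith
  qed
  have W: "0 < W u" if "u \<in> ?U" for u unfolding W_def using q[OF that] by simp
  (* any K with K W(u) at least 1 on the sieve will do *)
  define K where "K = (\<Sum>u\<in>?U. 1 / W u)"
  have KW: "1 \<le> K * W u" if "u \<in> ?U" for u
  proof -
    have "1 / W u \<le> K" unfolding K_def by (rule member_le_sum[OF that]) (auto intro: less_imp_le W)
    then show ?thesis using W[OF that] by (simp add: divide_le_eq)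
  qed
  have K: "0 < K" unfolding K_def using W by (intro sum_pos ne) auto
  define m where "m u = nat \<lceil>K * W u\<rceil>" for u
  have m: "0 < m u" "K * W u \<le> real (m u)" "real (m u) \<le> 2 * (K * W u)" if "u \<in> ?U" for u
  proof -
    have eq: "real (m u) = of_int \<lceil>K * W u\<rceil>" unfolding m_def using KW[OF that] by simp
    show "K * W u \<le> real (m u)" unfolding eq by (rule le_of_int_ceiling)
    show "real (m u) \<le> 2 * (K * W u)" unfolding eq using KW[OF that] by linarith
    show "0 < m u" unfolding m_def using KW[OF that] by simp
  qed
  obtain \<pi> where \<pi>: "sieve_prior I \<Psi> \<pi>" "set_pmf \<pi> = normalized ` ?U"
    and post: "\<And>n y S. (\<And>u. u \<in> ?U \<Longrightarrow> 0 < likelihood I \<Psi> n y (normalized u)) \<Longrightarrow>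
      emeasure (posterior I \<Psi> \<pi> n y) S
      = ennreal ((\<Sum>u | u \<in> ?U \<and> normalized u \<in> S. real (m u) * likelihood I \<Psi> n y (normalized u))
          / (\<Sum>u\<in>?U. real (m u) * likelihood I \<Psi> n y (normalized u)))"
    by (rule posterior_weighted[where m=m and th=normalized, OF finite_sieve ne m(1) normalized_density_params[OF _ c]]) auto
  have "emeasure (posterior I \<Psi> \<pi> n y) S
      \<le> ennreal (2 * (\<Sum>u | u \<in> ?U \<and> normalized u \<in> S. score n u y) / (\<Sum>u\<in>?U. score n u y))"
    if y: "\<And>i. i < n \<Longrightarrow> y i \<in> {0..1}" for y S
  proof -
    let ?lik = "\<lambda>u. likelihood I \<Psi> n y (normalized u)"
    have lik: "?lik u = (\<Prod>i<n. (synth I \<Psi> u (y i))\<^sup>2) / sq_norm u ^ n" if u: "u \<in> ?U" for u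
    proof -
      have "dens I \<Psi> (normalized u) (y i) = (synth I \<Psi> u (y i))\<^sup>2 / sq_norm u" if "i < n" for i
        using synth_scale[OF summable_supported[OF sieve_supported[OF u]] y[OF that], of "1 / sqrt (sq_norm u)"] q[OF u]
        by (simp add: dens_def normalized_def[abs_def] power_divide)
      then show ?thesis by (simp add: likelihood_def prod_dividef)
    qed
    have lik_pos: "0 < ?lik u" if u: "u \<in> ?U" for u
    proof -
      have "0 < (synth I \<Psi> u (y i))\<^sup>2" if "i < n" for i using sieve_lower[OF u y[OF that]] c by simp
      then show ?thesis unfolding lik[OF u] using q[OF u] by (intro divide_pos_pos prod_pos) auto
    qed
    have sc: "score n u y = W u * ?lik u" if u: "u \<in> ?U" for u
      unfolding lik[OF u] W_def score_def using q[OF u] by simp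
    have sc_pos: "0 < score n u y" if u: "u \<in> ?U" for u
      unfolding sc[OF u] using W[OF u] lik_pos[OF u] by simp
    have lo: "K * score n u y \<le> real (m u) * ?lik u" if u: "u \<in> ?U" for u
      using mult_right_mono[OF m(2)[OF u], of "?lik u"] lik_pos[OF u] by (simp add: sc[OF u] mult.assoc)
    have hi: "real (m u) * ?lik u \<le> 2 * K * score n u y" if u: "u \<in> ?U" for u
      using mult_right_mono[OF m(3)[OF u], of "?lik u"] lik_pos[OF u] by (simp add: sc[OF u] mult.assoc)
    let ?A = "\<Sum>u | u \<in> ?U \<and> normalized u \<in> S. score n u y" and ?B = "\<Sum>u\<in>?U. score n u y"
    have A: "0 \<le> ?A" by (intro sum_nonneg score_nonneg)
    have B: "0 < ?B" using sc_pos by (intro sum_pos ne) auto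
    have "(\<Sum>u | u \<in> ?U \<and> normalized u \<in> S. real (m u) * ?lik u) / (\<Sum>u\<in>?U. real (m u) * ?lik u)
        \<le> (2 * K * ?A) / (K * ?B)"
    proof (rule frac_le)
      show "0 \<le> 2 * K * ?A" using K A by simp
      show "(\<Sum>u | u \<in> ?U \<and> normalized u \<in> S. real (m u) * ?lik u) \<le> 2 * K * ?A"
        unfolding sum_distrib_left by (rule sum_mono) (auto intro: hi)
      show "0 < K * ?B" using K B by simp
      show "K * ?B \<le> (\<Sum>u\<in>?U. real (m u) * ?lik u)"
        unfolding sum_distrib_left by (rule sum_mono) (rule lo)
    qed
    also have "\<dots> = 2 * ?A / ?B" using K by simp
    finally show ?thesis by (subst post[OF lik_pos]) (auto intro: ennreal_leI)
  qed
  with \<pi> show thesis by (rule that)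
qed

section \<open>Loss and coefficient decay\<close>

text \<open>
  The factor \<open>136 (4 + 4 L)\<close> comes from the distance between \<open>u\<close> and the truth, the rest from normalising \<open>u\<close>.
\<close>
definition risk_const :: "real \<Rightarrow> real \<Rightarrow> real" where
  "risk_const c L = 2 / c * (136 * (4 + 4 * L)) * (1 + (C\<^sup>2 * (136 * (4 + 4 * L)) + 2 * C) * (4 * L))"

lemma loss_inf_eq:
  assumes "summable (level_norm (\<lambda>p. v p - w p))"
  shows "loss_inf I v w = ennreal (\<Sum>j. level_norm (\<lambda>p. v p - w p) j)"
proof -
  have "loss_inf I v w = (\<Sum>j. ennreal (level_norm (\<lambda>p. v p - w p) j))"
    by (simp add: loss_inf_def level_norm_def)
  then show ?thesis using suminf_ennreal2[OF level_norm_nonneg assms] by simp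
qed

end

lemma geometric_tail:
  fixes \<beta> :: real
  assumes "1/2 \<le> \<beta>"
  shows "summable (\<lambda>j. 2 powr (- real (j + m) * \<beta>))"
    and "(\<Sum>j. 2 powr (- real (j + m) * \<beta>)) \<le> 4 * 2 powr (- real m * \<beta>)"
proof -
  let ?q = "2 powr (- \<beta>)"
  have "(2::real) powr (- \<beta>) \<le> 2 powr (- (1/2))" using assms by simp
  also have "2 powr (- (1/2)) = 1 / sqrt 2" by (simp add: powr_minus_divide powr_half_sqrt)
  also have "\<dots> \<le> 3 / 4"
    using real_le_rsqrt[of "4/3" 2] by (simp add: divide_simps power2_eq_square)
  finally have q: "?q \<le> 3 / 4" .
  have q0: "0 < ?q" by simp
  have eq: "2 powr (- real (j + m) * \<beta>) = 2 powr (- real m * \<beta>) * ?q ^ j" for j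
    by (simp add: powr_realpow[symmetric] powr_powr algebra_simps flip: powr_add)
  have s: "summable (\<lambda>j. ?q ^ j)" using q q0 by (intro summable_geometric) auto
  show "summable (\<lambda>j. 2 powr (- real (j + m) * \<beta>))" unfolding eq by (rule summable_mult[OF s])
  have "(\<Sum>j. ?q ^ j) = 1 / (1 - ?q)" using q q0 by (intro suminf_geometric) auto
  also have "\<dots> \<le> 4" using q by (simp add: divide_simps)
  finally have "2 powr (- real m * \<beta>) * (\<Sum>j. ?q ^ j) \<le> 2 powr (- real m * \<beta>) * 4"
    by (rule mult_left_mono) simp
  then show "(\<Sum>j. 2 powr (- real (j + m) * \<beta>)) \<le> 4 * 2 powr (- real m * \<beta>)"
    unfolding eq suminf_mult[OF s] by simp
qed

text \<open>
  The two bounds on \<open>h j\<close> balance at the level with \<open>2\<^bsup>j\<^esup> = X = \<delta>\<^bsup>-2/(2\<beta>+1)\<^esup>\<close>. Below it the first one grows geometrically,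
  above it the second one decays, so that the sum is of the order of the terms at the crossover.
\<close>
lemma truncated_decay_sum:
  fixes \<beta> \<delta> L :: real
  assumes \<beta>: "1/2 \<le> \<beta>" and \<delta>: "0 < \<delta>" "\<delta> \<le> 1" and L: "0 \<le> L"
    and h0: "\<And>j. 0 \<le> h j" and h1: "\<And>j. h j \<le> 2 powr (real j / 2) * \<delta>"
    and h2: "\<And>j. h j \<le> L * 2 powr (- real j * \<beta>)"
  shows "summable h" and "(\<Sum>j. h j) \<le> (4 + 4 * L) * \<delta> powr (2 * \<beta> / (2 * \<beta> + 1))"
proof -
  have b: "0 < 2 * \<beta> + 1" using \<beta> by simp
  (* the number of coefficients at the crossover level *)
  define X where "X = \<delta> powr (- 2 / (2 * \<beta> + 1))"
  define R where "R = \<delta> powr (2 * \<beta> / (2 * \<beta> + 1))"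
  have X0: "0 < X" using \<delta> by (simp add: X_def)
  show s: "summable h"
    by (rule summable_comparison_test'[OF summable_mult[OF geometric_tail(1)[OF \<beta>, of 0], of L], where N=0])
      (use h0 h2 in simp)
  have ex: "\<exists>m::nat. X \<le> 2 ^ m"
    using real_arch_pow[of 2 X] by (auto intro: less_imp_le)
  define m where "m = (LEAST m::nat. X \<le> 2 ^ m)"
  have m: "X \<le> 2 ^ m" unfolding m_def by (rule LeastI_ex[OF ex])
  have below: "2 ^ k < X" if "k < m" for k using not_less_Least[of k "\<lambda>m. X \<le> 2 ^ m"] that by (simp add: m_def not_le)
  have sqrtX: "X powr (1/2) * \<delta> = R"
  proof -
    have "X powr (1/2) * \<delta> = \<delta> powr (- 2 / (2 * \<beta> + 1) * (1/2)) * \<delta> powr 1"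
      using \<delta> by (simp add: X_def powr_powr)
    also have "\<dots> = \<delta> powr (- 2 / (2 * \<beta> + 1) * (1/2) + 1)" by (rule powr_add[symmetric])
    also have "- 2 / (2 * \<beta> + 1) * (1/2) + 1 = 2 * \<beta> / (2 * \<beta> + 1)" using b by (simp add: field_simps)
    finally show ?thesis by (simp add: R_def)
  qed
  have Xb: "X powr (- \<beta>) = R"
    by (simp add: X_def R_def powr_powr)
  have "(\<Sum>j<m. h j) \<le> 4 * R"
  proof (cases m)
    case 0 then show ?thesis by (simp add: R_def)
  next
    case (Suc k)
    have "(\<Sum>j<m. h j) \<le> (\<Sum>j<m. 2 powr (real j / 2) * \<delta>)" by (rule sum_mono[OF h1])
    also have "\<dots> = (\<Sum>j\<le>k. 2 powr (real j / 2)) * \<delta>"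
      by (simp add: Suc lessThan_Suc_atMost sum_distrib_right)
    also have "\<dots> \<le> 4 * 2 powr (real k / 2) * \<delta>"
      using sum_sqrt2_powers[of k] \<delta> by (intro mult_right_mono) auto
    also have "2 powr (real k / 2) = (2 ^ k) powr (1/2)"
      by (simp add: powr_realpow[symmetric] powr_powr)
    also have "4 * (2 ^ k) powr (1/2) * \<delta> \<le> 4 * X powr (1/2) * \<delta>"
      using below[of k] Suc \<delta> by (intro mult_right_mono mult_left_mono powr_mono2) auto
    also have "\<dots> = 4 * R" using sqrtX by simp
    finally show ?thesis .
  qed
  moreover have "(\<Sum>j. h (j + m)) \<le> 4 * L * R"
  proof -
    have "(\<Sum>j. h (j + m)) \<le> (\<Sum>j. L * 2 powr (- real (j + m) * \<beta>))"
      by (rule suminf_le[OF h2 summable_ignore_initial_segment[OF s] summable_mult[OF geometric_tail(1)[OF \<beta>]]])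
    also have "\<dots> = L * (\<Sum>j. 2 powr (- real (j + m) * \<beta>))"
      by (rule suminf_mult[OF geometric_tail(1)[OF \<beta>]])
    also have "\<dots> \<le> L * (4 * 2 powr (- real m * \<beta>))"
      by (rule mult_left_mono[OF geometric_tail(2)[OF \<beta>] L])
    also have "2 powr (- real m * \<beta>) = (2 ^ m) powr (- \<beta>)"
      by (simp add: powr_realpow[symmetric] powr_powr)
    also have "L * (4 * (2 ^ m) powr (- \<beta>)) \<le> L * (4 * X powr (- \<beta>))"
      using m X0 \<beta> L by (intro mult_left_mono powr_mono2') auto
    finally show ?thesis by (simp add: Xb)
  qed
  ultimately show "(\<Sum>j. h j) \<le> (4 + 4 * L) * \<delta> powr (2 * \<beta> / (2 * \<beta> + 1))"
    using suminf_split_initial_segment[OF s, of m] by (simp add: R_def algebra_simps)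
qed

context wavelet_system
begin

lemma H_class_level_norm:
  assumes "\<theta> \<in> H_class I \<beta> L"
  shows "level_norm \<theta> j \<le> L * 2 powr (- real j * \<beta>)"
proof (rule level_norm_le)
  fix k assume "k \<in> I j"
  then have "\<bar>\<theta> (j, k)\<bar> \<le> L * 2 powr (- real j * (\<beta> + 1/2))"
    using assms by (auto simp: H_class_def Lam_def)
  then have "2 powr (real j / 2) * \<bar>\<theta> (j, k)\<bar> \<le> 2 powr (real j / 2) * (L * 2 powr (- real j * (\<beta> + 1/2)))"
    by (rule mult_left_mono) simp
  also have "\<dots> = L * (2 powr (real j / 2) * 2 powr (- real j * (\<beta> + 1/2)))" by simp
  also have "2 powr (real j / 2) * 2 powr (- real j * (\<beta> + 1/2)) = 2 powr (- real j * \<beta>)"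
    by (simp add: ring_distribs flip: powr_add)
  finally show "2 powr (real j / 2) * \<bar>\<theta> (j, k)\<bar> \<le> L * 2 powr (- real j * \<beta>)" .
qed

lemma H_class_summable:
  assumes "\<theta> \<in> H_class I \<beta> L" "1/2 \<le> \<beta>" "0 \<le> L"
  shows "summable (level_norm \<theta>)"
    and "(\<Sum>j. level_norm \<theta> (j + m)) \<le> 4 * L * 2 powr (- real m * \<beta>)"
proof -
  show s: "summable (level_norm \<theta>)"
    by (rule summable_comparison_test'[OF summable_mult[OF geometric_tail(1)[OF assms(2), of 0], of L], where N=0])
      (use H_class_level_norm[OF assms(1)] level_norm_nonneg in simp)
  have "(\<Sum>j. level_norm \<theta> (j + m)) \<le> (\<Sum>j. L * 2 powr (- real (j + m) * \<beta>))"
    by (rule suminf_le[OF H_class_level_norm[OF assms(1)] summable_ignore_initial_segment[OF s]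
          summable_mult[OF geometric_tail(1)[OF assms(2)]]])
  also have "\<dots> = L * (\<Sum>j. 2 powr (- real (j + m) * \<beta>))"
    by (rule suminf_mult[OF geometric_tail(1)[OF assms(2)]])
  also have "\<dots> \<le> L * (4 * 2 powr (- real m * \<beta>))"
    by (rule mult_left_mono[OF geometric_tail(2)[OF assms(2)] assms(3)])
  finally show "(\<Sum>j. level_norm \<theta> (j + m)) \<le> 4 * L * 2 powr (- real m * \<beta>)" by simp
qed

lemma H'_class_truth:
  assumes \<theta>: "\<theta> \<in> H'_class I \<Psi> c \<beta> L" and \<beta>: "1/2 \<le> \<beta>" and L: "0 \<le> L"
  shows "summable (level_norm \<theta>)"
    and "(\<integral>x. (synth I \<Psi> \<theta> x)\<^sup>2 \<partial>unit_measure) = 1"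
    and "\<And>x. x \<in> {0..1} \<Longrightarrow> c < synth I \<Psi> \<theta> x"
    and "\<And>p. p \<in> Lam I \<Longrightarrow> \<bar>\<theta> p\<bar> \<le> 1"
proof -
  have H: "\<theta> \<in> H_class I \<beta> L" "\<theta> \<in> unit_l2 I" using \<theta> by (auto simp: H'_class_def)
  show s: "summable (level_norm \<theta>)" by (rule H_class_summable(1)[OF H(1) \<beta> L])
  show one: "(\<integral>x. (synth I \<Psi> \<theta> x)\<^sup>2 \<partial>unit_measure) = 1"
    by (rule parseval_synth[OF s]) (use H(2) in \<open>simp add: unit_l2_def\<close>)
  show "c < synth I \<Psi> \<theta> x" if "x \<in> {0..1}" for x using \<theta> that by (simp add: H'_class_def)
  fix p assume "p \<in> Lam I"
  then obtain j k where p: "p = (j, k)" "k \<in> I j" by (auto simp: Lam_def)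
  have "(\<theta> (j, k))\<^sup>2 \<le> 1"
    using coeff_sq_le[OF synth_measurable synth_bound[OF s] p(2)] synth_coeff[OF s p(2)] one by simp
  then show "\<bar>\<theta> p\<bar> \<le> 1" using p by (simp add: abs_square_le_1)
qed

end

context sieve_core
begin

text \<open>
  A truth below \<open>\<delta> / 16\<close> is rounded to \<open>0\<close>, and a nonzero grid value would then be a bad
  displacement. For a larger truth the first bound implies the second; this is where \<open>136 = 16 * 17 / 2\<close> comes from.
\<close>
lemma good_coeff:
  assumes u: "u \<in> sieve c n \<delta> J" and good: "\<not> (\<exists>p. bad u p)" and p: "p \<in> indices J"
  shows "\<bar>u p - \<theta>0 p\<bar> \<le> 136 * \<delta>" "\<bar>u p - \<theta>0 p\<bar> \<le> 136 * \<bar>\<theta>0 p\<bar>"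
proof -
  have cl: "\<bar>center p - \<theta>0 p\<bar> \<le> \<delta> / 2" by (rule center_close[OF p])
  have nb: "u p = center p \<or> \<bar>u p - center p\<bar> < 16 * \<bar>center p - \<theta>0 p\<bar>"
  proof -
    have "\<not> bad u p" using good by blast
    then show ?thesis using p by (auto simp: bad_def not_le)
  qed
  have uc: "\<bar>u p - center p\<bar> \<le> 16 * \<bar>center p - \<theta>0 p\<bar>" using nb by auto
  have d: "\<bar>u p - \<theta>0 p\<bar> \<le> 17 * \<bar>center p - \<theta>0 p\<bar>"
    using uc abs_triangle_ineq[of "u p - center p" "center p - \<theta>0 p"] by simp
  have d': "\<bar>u p - \<theta>0 p\<bar> \<le> 17 * (\<delta> / 2)"
    by (rule order_trans[OF d mult_left_mono[OF cl]]) simp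
  show "\<bar>u p - \<theta>0 p\<bar> \<le> 136 * \<delta>" by (rule order_trans[OF d']) (use \<delta>_pos in simp)
  show "\<bar>u p - \<theta>0 p\<bar> \<le> 136 * \<bar>\<theta>0 p\<bar>"
  proof (cases "\<bar>\<theta>0 p\<bar> < \<delta> / 16")
    case False then show ?thesis by (intro order_trans[OF d']) simp
  next
    case True
    then have "\<bar>\<theta>0 p / \<delta>\<bar> < 1 / 16" using \<delta>_pos by (simp add: field_simps)
    then have "\<bar>\<theta>0 p / \<delta> - of_int 0\<bar> < 1 / 2" unfolding of_int_0 diff_0_right by linarith
    then have "round (\<theta>0 p / \<delta>) = 0" by (rule round_unique')
    then have c0: "center p = 0" using p by (simp add: center_def)
    obtain m :: int where m: "u p = \<delta> * of_int m" using sieve_grid[OF u p] by (auto simp: grid_def)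
    have "u p = 0"
    proof (rule ccontr)
      assume nz: "u p \<noteq> 0"
      then have "\<bar>u p\<bar> < 16 * \<bar>\<theta>0 p\<bar>" using nb c0 by simp
      then have "\<bar>u p\<bar> < \<delta>" using True by linarith
      moreover have "\<bar>u p\<bar> = \<delta> * \<bar>of_int m\<bar>" unfolding m using \<delta>_pos by (simp add: abs_mult)
      moreover have "m \<noteq> 0" using nz m by auto
      then have "\<delta> * 1 \<le> \<delta> * \<bar>of_int m\<bar>" using \<delta>_pos by (intro mult_left_mono) auto
      ultimately show False by linarith
    qed
    then show ?thesis by simp
  qed
qed

text \<open>
  Normalising costs no more than the distance itself: \<open>\<bar>\<parallel>u\<parallel>\<^sup>2 - 1\<bar>\<close> is at most a constant times the uniform
  distance between the synthesised functions.
\<close>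
lemma good_loss:
  assumes u: "u \<in> sieve c n \<delta> J" and good: "\<not> (\<exists>p. bad u p)"
    and H: "\<theta>0 \<in> H_class I \<beta> L" and \<beta>: "1/2 \<le> \<beta>" and L: "0 \<le> L" and \<delta>1: "\<delta> \<le> 1"
    and beyond: "\<And>j. J < j \<Longrightarrow> L * 2 powr (- real j * (\<beta> + 1/2)) \<le> \<delta>"
  shows "loss_inf I (normalized u) \<theta>0 \<le> ennreal (risk_const c L * \<delta> powr (2 * \<beta> / (2 * \<beta> + 1)))"
proof -
  let ?e = "\<lambda>p. u p - \<theta>0 p"
  let ?R = "\<delta> powr (2 * \<beta> / (2 * \<beta> + 1))"
  let ?K = "136 * (4 + 4 * L)"
  note su = summable_supported[OF sieve_supported[OF u]]
  have se: "summable (level_norm ?e)" by (rule summable_level_norm_diff[OF su truth_summable])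
  have H': "\<bar>\<theta>0 (j, k)\<bar> \<le> L * 2 powr (- real j * (\<beta> + 1/2))" if "k \<in> I j" for j k
    using H that by (auto simp: H_class_def Lam_def)
  have coeff: "\<bar>?e (j, k)\<bar> \<le> 136 * \<delta> \<and> \<bar>?e (j, k)\<bar> \<le> 136 * \<bar>\<theta>0 (j, k)\<bar>" if k: "k \<in> I j" for j k
  proof (cases "j \<le> J")
    case True
    then have "(j, k) \<in> indices J" using k by (simp add: indices_iff)
    then show ?thesis using good_coeff[OF u good] by blast
  next
    case False
    then have "u (j, k) = 0" using sieve_supported[OF u] by (simp add: supported_def indices_iff)
    moreover have "\<bar>\<theta>0 (j, k)\<bar> \<le> \<delta>" using H'[OF k] beyond[of j] False by linarith
    ultimately show ?thesis using \<delta>_pos by simp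
  qed
  have lev1: "level_norm ?e j \<le> 2 powr (real j / 2) * (136 * \<delta>)" for j
    by (rule level_norm_le) (use coeff in \<open>auto intro!: mult_left_mono\<close>)
  have lev2: "level_norm ?e j \<le> 136 * (L * 2 powr (- real j * \<beta>))" for j
  proof (rule level_norm_le)
    fix k assume k: "k \<in> I j"
    have "2 powr (real j / 2) * \<bar>?e (j, k)\<bar> \<le> 2 powr (real j / 2) * (136 * \<bar>\<theta>0 (j, k)\<bar>)"
      using coeff[OF k] by (intro mult_left_mono) auto
    also have "\<dots> = 136 * (2 powr (real j / 2) * \<bar>\<theta>0 (j, k)\<bar>)" by simp
    also have "\<dots> \<le> 136 * (L * 2 powr (- real j * \<beta>))"
      using order_trans[OF coeff_le_level_norm[OF k] H_class_level_norm[OF H]] by simp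
    finally show "2 powr (real j / 2) * \<bar>?e (j, k)\<bar> \<le> 136 * (L * 2 powr (- real j * \<beta>))" .
  qed
  define l where "l = (\<Sum>j. level_norm ?e j)"
  have l0: "0 \<le> l" unfolding l_def by (rule suminf_nonneg[OF se level_norm_nonneg])
  have lR: "l \<le> ?K * ?R"
  proof -
    have "0 \<le> level_norm ?e j / 136" "level_norm ?e j / 136 \<le> 2 powr (real j / 2) * \<delta>"
      "level_norm ?e j / 136 \<le> L * 2 powr (- real j * \<beta>)" for j
      using lev1[of j] lev2[of j] level_norm_nonneg[of ?e j] by auto
    then have "(\<Sum>j. level_norm ?e j / 136) \<le> (4 + 4 * L) * ?R"
      by (rule truncated_decay_sum(2)[OF \<beta> \<delta>_pos \<delta>1 L])
    moreover have "(\<Sum>j. level_norm ?e j / 136) = l / 136"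
      unfolding l_def by (rule suminf_divide[OF se])
    ultimately show ?thesis by (simp add: algebra_simps)
  qed
  have R1: "?R \<le> 1" using \<delta>_pos \<delta>1 \<beta> by (intro powr_le1) auto
  have K0: "0 \<le> ?K" using L by simp
  have lK: "l \<le> ?K" using lR mult_left_mono[OF R1 K0] by linarith
  let ?q = "sqrt (sq_norm u)"
  have q2: "(c / 2)\<^sup>2 \<le> sq_norm u" using sieve_sq_norm[OF u c_pos] by (simp add: power_divide)
  have qc: "c / 2 \<le> ?q" by (rule real_le_rsqrt[OF q2])
  have q0: "0 < ?q" using qc c_pos by linarith
  have sup: "\<bar>synth I \<Psi> u x - a x\<bar> \<le> C * l" if x: "x \<in> {0..1}" for x
    using synth_bound[OF se x] synth_diff[OF su truth_summable x] by (simp add: l_def)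
  have Cl: "0 \<le> C * l" using l0 by simp
  have sqd: "\<bar>sq_norm u - 1\<bar> \<le> (C * l)\<^sup>2 + 2 * (C * l)"
  proof -
    have i: "integrable unit_measure (\<lambda>x. (synth I \<Psi> u x)\<^sup>2 - (a x)\<^sup>2)"
      by (intro Bochner_Integration.integrable_diff synth_sq_integrable su truth_summable)
    have "sq_norm u - 1 = (\<integral>x. (synth I \<Psi> u x)\<^sup>2 - (a x)\<^sup>2 \<partial>unit_measure)"
      using synth_sq_integrable[OF su] synth_sq_integrable[OF truth_summable] truth_norm by (simp add: sq_norm_def)
    then have "\<bar>sq_norm u - 1\<bar> \<le> (\<integral>x. \<bar>(synth I \<Psi> u x)\<^sup>2 - (a x)\<^sup>2\<bar> \<partial>unit_measure)"
      using integral_abs_bound by metis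
    also have "\<dots> \<le> (\<integral>x. (C * l)\<^sup>2 + C * l * (1 + (a x)\<^sup>2) \<partial>unit_measure)"
    proof (rule integral_unit_mono[OF integrable_abs[OF i]])
      show "integrable unit_measure (\<lambda>x. (C * l)\<^sup>2 + C * l * (1 + (a x)\<^sup>2))"
        using synth_sq_integrable[OF truth_summable] by simp
      fix x :: real assume x: "x \<in> {0..1}"
      define e where "e = synth I \<Psi> u x - a x"
      have e: "\<bar>e\<bar> \<le> C * l" unfolding e_def by (rule sup[OF x])
      have "(synth I \<Psi> u x)\<^sup>2 - (a x)\<^sup>2 = e\<^sup>2 + 2 * a x * e" by (simp add: e_def power2_eq_square algebra_simps)
      then have "\<bar>(synth I \<Psi> u x)\<^sup>2 - (a x)\<^sup>2\<bar> \<le> e\<^sup>2 + \<bar>2 * a x * e\<bar>"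
        using abs_triangle_ineq[of "e\<^sup>2" "2 * a x * e"] by simp
      also have "\<bar>2 * a x * e\<bar> = \<bar>e\<bar> * (2 * \<bar>a x\<bar>)" by (simp add: abs_mult)
      also have "\<dots> \<le> \<bar>e\<bar> * (1 + (a x)\<^sup>2)"
        using zero_le_power2[of "\<bar>a x\<bar> - 1"] by (intro mult_left_mono) (auto simp: power2_diff)
      also have "\<dots> \<le> C * l * (1 + (a x)\<^sup>2)" by (rule mult_right_mono[OF e]) simp
      also have "e\<^sup>2 \<le> (C * l)\<^sup>2" by (rule sq_le_sq[OF e])
      finally show "\<bar>(synth I \<Psi> u x)\<^sup>2 - (a x)\<^sup>2\<bar> \<le> (C * l)\<^sup>2 + C * l * (1 + (a x)\<^sup>2)" by simp
    qed
    also have "\<dots> = (C * l)\<^sup>2 + 2 * (C * l)"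
      using synth_sq_integrable[OF truth_summable] truth_norm by (simp add: unit_measure.prob_space[simplified])
    finally show ?thesis .
  qed
  have q1: "\<bar>1 / ?q - 1\<bar> \<le> 2 / c * ((C * l)\<^sup>2 + 2 * (C * l))"
  proof -
    have "sq_norm u - 1 = (?q - 1) * (?q + 1)" using q0 by (simp add: algebra_simps)
    then have "\<bar>?q - 1\<bar> * (?q + 1) = \<bar>sq_norm u - 1\<bar>" using q0 by (simp add: abs_mult)
    moreover have "\<bar>?q - 1\<bar> * 1 \<le> \<bar>?q - 1\<bar> * (?q + 1)" using q0 by (intro mult_left_mono) auto
    ultimately have "\<bar>?q - 1\<bar> \<le> \<bar>sq_norm u - 1\<bar>" by simp
    then have d: "\<bar>?q - 1\<bar> \<le> (C * l)\<^sup>2 + 2 * (C * l)" using sqd by (rule order_trans)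
    have "\<bar>1 / ?q - 1\<bar> = \<bar>?q - 1\<bar> / ?q"
    proof -
      have "1 / ?q - 1 = - ((?q - 1) / ?q)" using q0 by (simp add: field_simps)
      then show ?thesis using q0 by (simp add: abs_divide)
    qed
    also have "\<dots> \<le> ((C * l)\<^sup>2 + 2 * (C * l)) / (c / 2)"
      using d qc c_pos Cl by (intro frac_le) auto
    also have "\<dots> = 2 / c * ((C * l)\<^sup>2 + 2 * (C * l))"
    proof -
      have "z / (c / 2) = 2 / c * z" for z :: real by simp
      then show ?thesis .
    qed
    finally show ?thesis .
  qed
  let ?v = "\<lambda>p. normalized u p - \<theta>0 p"
  have lev: "level_norm ?v j \<le> 2 / c * level_norm ?e j
      + 2 / c * ((C * l)\<^sup>2 + 2 * (C * l)) * level_norm \<theta>0 j" for j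
  proof (rule level_norm_le)
    fix k assume k: "k \<in> I j"
    let ?w = "2 powr (real j / 2)"
    have "normalized u (j, k) - \<theta>0 (j, k) = 1 / ?q * ?e (j, k) + (1 / ?q - 1) * \<theta>0 (j, k)"
      by (simp add: normalized_def algebra_simps)
    then have "\<bar>normalized u (j, k) - \<theta>0 (j, k)\<bar> \<le> 1 / ?q * \<bar>?e (j, k)\<bar> + \<bar>1 / ?q - 1\<bar> * \<bar>\<theta>0 (j, k)\<bar>"
      using q0 abs_triangle_ineq[of "1 / ?q * ?e (j, k)" "(1 / ?q - 1) * \<theta>0 (j, k)"] by (simp add: abs_mult)
    also have "\<dots> \<le> 2 / c * \<bar>?e (j, k)\<bar> + 2 / c * ((C * l)\<^sup>2 + 2 * (C * l)) * \<bar>\<theta>0 (j, k)\<bar>"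
    proof (intro add_mono mult_right_mono)
      have "1 / ?q \<le> 1 / (c / 2)" by (rule frac_le) (use qc c_pos in auto)
      then show "1 / ?q \<le> 2 / c" by simp
    qed (use q1 in auto)
    finally have "?w * \<bar>normalized u (j, k) - \<theta>0 (j, k)\<bar>
        \<le> ?w * (2 / c * \<bar>?e (j, k)\<bar> + 2 / c * ((C * l)\<^sup>2 + 2 * (C * l)) * \<bar>\<theta>0 (j, k)\<bar>)"
      by (rule mult_left_mono) simp
    also have "\<dots> = 2 / c * (?w * \<bar>?e (j, k)\<bar>) + 2 / c * ((C * l)\<^sup>2 + 2 * (C * l)) * (?w * \<bar>\<theta>0 (j, k)\<bar>)"
      by (simp only: distrib_left mult_ac)
    also have "\<dots> \<le> 2 / c * level_norm ?e j + 2 / c * ((C * l)\<^sup>2 + 2 * (C * l)) * level_norm \<theta>0 j"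
      using c_pos Cl by (intro add_mono mult_left_mono coeff_le_level_norm[OF k]) auto
    finally show "?w * \<bar>normalized u (j, k) - \<theta>0 (j, k)\<bar>
        \<le> 2 / c * level_norm ?e j + 2 / c * ((C * l)\<^sup>2 + 2 * (C * l)) * level_norm \<theta>0 j" .
  qed
  let ?b = "\<lambda>j. 2 / c * level_norm ?e j + 2 / c * ((C * l)\<^sup>2 + 2 * (C * l)) * level_norm \<theta>0 j"
  have sb: "summable ?b" by (rule summable_add[OF summable_mult[OF se] summable_mult[OF truth_summable]])
  have sv: "summable (level_norm ?v)"
    by (rule summable_comparison_test'[OF sb, where N=0]) (use lev level_norm_nonneg in simp)
  have "(\<Sum>j. level_norm ?v j) \<le> (\<Sum>j. ?b j)" by (rule suminf_le[OF lev sv sb])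
  also have "\<dots> = 2 / c * l + 2 / c * ((C * l)\<^sup>2 + 2 * (C * l)) * (\<Sum>j. level_norm \<theta>0 j)"
    by (simp only: suminf_add[OF summable_mult[OF se] summable_mult[OF truth_summable], symmetric]
        suminf_mult[OF se] suminf_mult[OF truth_summable] l_def)
  also have "\<dots> \<le> 2 / c * l + 2 / c * ((C\<^sup>2 * ?K + 2 * C) * l) * (4 * L)"
  proof (intro add_mono mult_mono mult_left_mono)
    have "(C * l)\<^sup>2 = C\<^sup>2 * l * l" by (simp add: power2_eq_square)
    also have "\<dots> \<le> C\<^sup>2 * ?K * l" using lK l0 by (intro mult_right_mono mult_left_mono) auto
    finally show "(C * l)\<^sup>2 + 2 * (C * l) \<le> (C\<^sup>2 * ?K + 2 * C) * l" by (simp add: algebra_simps)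
    show "(\<Sum>j. level_norm \<theta>0 j) \<le> 4 * L" using H_class_summable(2)[OF H \<beta> L, of 0] by simp
    show "0 \<le> (\<Sum>j. level_norm \<theta>0 j)" by (rule suminf_nonneg[OF truth_summable level_norm_nonneg])
  qed (use c_pos l0 K0 in \<open>auto intro!: mult_nonneg_nonneg add_nonneg_nonneg divide_nonneg_nonneg\<close>)
  also have "\<dots> = 2 / c * (1 + (C\<^sup>2 * ?K + 2 * C) * (4 * L)) * l" by (simp add: algebra_simps)
  also have "\<dots> \<le> 2 / c * (1 + (C\<^sup>2 * ?K + 2 * C) * (4 * L)) * (?K * ?R)"
    using c_pos L K0 by (intro mult_left_mono[OF lR]) (auto intro!: mult_nonneg_nonneg add_nonneg_nonneg)
  also have "\<dots> = risk_const c L * ?R" by (simp only: risk_const_def mult_ac)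
  finally show ?thesis unfolding loss_inf_eq[OF sv] by (rule ennreal_leI)
qed

end

section \<open>Resolution and mesh of the sieve\<close>

text \<open>
  The constant gives \<open>n \<delta>\<^sup>2 / 4096 = 16 log n\<close>, enough to sum the coarse tests over all coordinates.
\<close>
definition mesh :: "nat \<Rightarrow> real" where
  "mesh n = 256 * sqrt (ln (real n) / real n)"

text \<open>
  Slightly below \<open>n\<^bsup>1/2\<^esup>\<close>: the fine tests need \<open>J\<^sup>2 N\<^sup>2 log n = o(n)\<close> and uniform consistency needs \<open>J\<^sup>2 N (n / log n)\<^bsup>-1/2\<^esup> = o(1)\<close>.
  Both hold by a power of the logarithm.
\<close>
definition top_level :: "nat \<Rightarrow> nat" where
  "top_level n = nat \<lfloor>log 2 (sqrt (real n) / ln (real n) ^ 4)\<rfloor>"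

lemma top_level_eventually:
  "\<forall>\<^sub>F n in sequentially. 2 ^ top_level n \<le> sqrt (real n) / ln (real n) ^ 4
     \<and> sqrt (real n) / ln (real n) ^ 4 < 2 * 2 ^ top_level n
     \<and> real (top_level n) \<le> 2 * ln (real n)"
proof -
  have "\<forall>\<^sub>F n in sequentially. 1 \<le> sqrt (real n) / ln (real n) ^ 4" by real_asymp
  moreover have "\<forall>\<^sub>F n in sequentially. sqrt (real n) / ln (real n) ^ 4 \<le> real n" by real_asymp
  moreover have "\<forall>\<^sub>F n in sequentially. 2 \<le> n" by (rule eventually_ge_at_top)
  ultimately show ?thesis
  proof eventually_elim
    case (elim n)
    define x where "x = sqrt (real n) / ln (real n) ^ 4"
    have x: "1 \<le> x" "x \<le> real n" using elim by (auto simp: x_def)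
    have log0: "0 \<le> log 2 x" using x by simp
    have T: "real (top_level n) = of_int \<lfloor>log 2 x\<rfloor>"
      using log0 by (simp add: top_level_def x_def)
    have "2 ^ top_level n = 2 powr real (top_level n)" by (simp add: powr_realpow)
    also have "\<dots> \<le> 2 powr log 2 x" unfolding T by (intro powr_mono) auto
    also have "\<dots> = x" using x by simp
    finally have 1: "2 ^ top_level n \<le> x" .
    have "x = 2 powr log 2 x" using x by simp
    also have "\<dots> < 2 powr (real (top_level n) + 1)" unfolding T by (intro powr_less_mono) linarith+
    also have "\<dots> = 2 * 2 ^ top_level n" by (simp add: powr_add powr_realpow)
    finally have 2: "x < 2 * 2 ^ top_level n" .
    have "real (top_level n) \<le> log 2 x" unfolding T by linarith
    also have "\<dots> \<le> log 2 (real n)" using x by simp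
    also have "\<dots> = ln (real n) / ln 2" by (simp add: log_def)
    also have "\<dots> \<le> ln (real n) / (1/2)"
    proof (rule divide_left_mono)
      show "1 / 2 \<le> ln (2::real)" using exp_half_le2 by (subst ln_ge_iff) auto
    qed (use elim in auto)
    finally show ?case using 1 2 by (simp add: x_def)
  qed
qed

text \<open>
  The last three conjuncts are uniform consistency, the bound by the mesh for coefficients beyond the top level, which uses
  \<open>b > 1/2\<close>, and the condition that pays for the union bound over the sieve.
\<close>
lemma sieve_parameters_eventually:
  fixes \<kappa>0 \<kappa>1 b K D :: real
  assumes \<kappa>: "0 < \<kappa>0" "0 < \<kappa>1" and b: "1/2 < b" and K: "0 \<le> K"
  shows "\<forall>\<^sub>F n in sequentially. 3 \<le> n \<and> K \<le> real n \<and> 2 ^ top_level n \<le> real n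
    \<and> 0 < mesh n \<and> mesh n \<le> 1 \<and> 2 \<le> real n * mesh n
    \<and> (real (top_level n) + 2)\<^sup>2 * 2 ^ top_level n * mesh n \<le> \<kappa>0
    \<and> D \<le> 2 powr (real (top_level n) * (b + 1/2)) * mesh n
    \<and> (real (top_level n) + 2)\<^sup>2 * (2 ^ top_level n)\<^sup>2 * K * ln (real n) \<le> real n * \<kappa>1"
proof -
  let ?x = "\<lambda>n::nat. sqrt (real n) / ln (real n) ^ 4"
  have "((\<lambda>n. (2 * ln (real n) + 2)\<^sup>2 * ?x n * mesh n) \<longlongrightarrow> 0) sequentially"
    unfolding mesh_def by real_asymp
  then have e1: "\<forall>\<^sub>F n in sequentially. (2 * ln (real n) + 2)\<^sup>2 * ?x n * mesh n < \<kappa>0"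
    using \<kappa>(1) by (rule order_tendstoD(2))
  have "((\<lambda>n. (2 * ln (real n) + 2)\<^sup>2 * (?x n)\<^sup>2 * K * ln (real n) / real n) \<longlongrightarrow> 0) sequentially"
    by real_asymp
  then have e2: "\<forall>\<^sub>F n in sequentially. (2 * ln (real n) + 2)\<^sup>2 * (?x n)\<^sup>2 * K * ln (real n) / real n < \<kappa>1"
    using \<kappa>(2) by (rule order_tendstoD(2))
  have "filterlim (\<lambda>n. (?x n / 2) powr (b + 1/2) * mesh n) at_top sequentially"
    unfolding mesh_def using b by real_asymp
  then have e3: "\<forall>\<^sub>F n in sequentially. D \<le> (?x n / 2) powr (b + 1/2) * mesh n"
    by (simp add: filterlim_at_top)
  have e4: "\<forall>\<^sub>F n in sequentially. K \<le> real n" by real_asymp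
  have e5: "\<forall>\<^sub>F n in sequentially. mesh n \<le> 1" unfolding mesh_def by real_asymp
  have e6: "\<forall>\<^sub>F n in sequentially. 2 \<le> real n * mesh n" unfolding mesh_def by real_asymp
  have e7: "\<forall>\<^sub>F n in sequentially. 3 \<le> n" by (rule eventually_ge_at_top)
  have e8: "\<forall>\<^sub>F n in sequentially. ?x n \<le> real n" by real_asymp
  show ?thesis using e1 e2 e3 e4 e5 e6 e7 e8 top_level_eventually
  proof eventually_elim
    case (elim n)
    let ?J = "top_level n" and ?N = "2 ^ top_level n :: real"
    have n: "0 < real n" "0 < ln (real n)" using elim(7) by auto
    have m0: "0 < mesh n" using n by (simp add: mesh_def)
    have N: "?N \<le> ?x n" "?x n < 2 * ?N" "real ?J \<le> 2 * ln (real n)" using elim(9) by auto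
    have x0: "0 < ?x n" using n by simp
    have J2: "(real ?J + 2)\<^sup>2 \<le> (2 * ln (real n) + 2)\<^sup>2" using N(3) by (intro power_mono) auto
    have "(real ?J + 2)\<^sup>2 * ?N * mesh n \<le> (2 * ln (real n) + 2)\<^sup>2 * ?x n * mesh n"
      using J2 N(1) m0 x0 by (intro mult_right_mono mult_mono) auto
    then have c1: "(real ?J + 2)\<^sup>2 * ?N * mesh n \<le> \<kappa>0" using elim(1) by linarith
    have "(real ?J + 2)\<^sup>2 * ?N\<^sup>2 * K * ln (real n) \<le> (2 * ln (real n) + 2)\<^sup>2 * (?x n)\<^sup>2 * K * ln (real n)"
      using J2 power_mono[OF N(1), of 2] n K by (intro mult_right_mono mult_mono) auto
    also have "\<dots> \<le> real n * \<kappa>1" using elim(2) n by (simp add: divide_less_eq mult.commute)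
    finally have c2: "(real ?J + 2)\<^sup>2 * ?N\<^sup>2 * K * ln (real n) \<le> real n * \<kappa>1" .
    have "(?x n / 2) powr (b + 1/2) \<le> ?N powr (b + 1/2)"
      using N(2) x0 b by (intro powr_mono2) auto
    also have "?N powr (b + 1/2) = 2 powr (real ?J * (b + 1/2))"
      by (simp add: powr_realpow[symmetric] powr_powr)
    finally have "(?x n / 2) powr (b + 1/2) * mesh n \<le> 2 powr (real ?J * (b + 1/2)) * mesh n"
      using m0 by (intro mult_right_mono) auto
    then have c3: "D \<le> 2 powr (real ?J * (b + 1/2)) * mesh n" using elim(3) by linarith
    have c0: "?N \<le> real n" using N(1) elim(8) by linarith
    show ?case by (intro conjI elim(4-7) m0 c0 c1 c2 c3)
  qed
qed

context sieve_core
begin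

lemma posterior_bad_bound:
  assumes post: "\<And>y S. (\<And>i. i < n \<Longrightarrow> y i \<in> {0..1}) \<Longrightarrow>
      emeasure (posterior I \<Psi> \<pi> n y) S
      \<le> ennreal (2 * (\<Sum>u | u \<in> sieve c n \<delta> J \<and> normalized u \<in> S. score n u y)
          / (\<Sum>u\<in>sieve c n \<delta> J. score n u y))"
    and S: "\<And>u. u \<in> sieve c n \<delta> J \<Longrightarrow> normalized u \<in> S \<Longrightarrow> \<exists>p. bad u p"
    and total: "real (card (sieve c n \<delta> J)) * exp (- (real n * (2 ^ J * \<delta>\<^sup>2) * (4 * C + 1)))
      + 2 * real (card (indices J)) * exp (- (real n * \<delta>\<^sup>2 / 4096))
      + real (card (sieve c n \<delta> J)) * exp (- (real n * fine_rate))
      + real (card (indices J)) * real (2 * n + 1) * exp (- (real n * \<delta>\<^sup>2 / 2)) \<le> b"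
  shows "(\<integral>\<^sup>+y. emeasure (posterior I \<Psi> \<pi> n y) S \<partial>sample_law I \<Psi> n \<theta>0) \<le> ennreal (2 * b)"
proof -
  have "(\<integral>\<^sup>+y. emeasure (posterior I \<Psi> \<pi> n y) S \<partial>sample_law I \<Psi> n \<theta>0)
      \<le> (\<integral>\<^sup>+y. 2 * ennreal (bad_mass_bound y) \<partial>sample_law I \<Psi> n \<theta>0)"
  proof (rule nn_integral_mono)
    fix y assume "y \<in> space (sample_law I \<Psi> n \<theta>0)"
    then have y: "y i \<in> {0..1}" if "i < n" for i using that by (rule sample_space)
    let ?A = "\<Sum>u | u \<in> sieve c n \<delta> J \<and> normalized u \<in> S. score n u y"
    let ?B = "\<Sum>u\<in>sieve c n \<delta> J. score n u y"
    have "0 < score n center y"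
      unfolding score_def using center_pos[OF y] by (intro mult_pos_pos prod_pos) force+
    also have "\<dots> \<le> ?B" by (rule member_le_sum[OF center_in_sieve]) (auto simp: score_nonneg)
    finally have B: "0 < ?B" .
    have "?A \<le> (\<Sum>u\<in>bad_set. score n u y)"
      by (rule sum_mono2) (use S in \<open>auto simp: bad_set_def score_nonneg\<close>)
    also have "\<dots> \<le> bad_mass_bound y * ?B" by (rule bad_mass_le[OF y])
    finally have "2 * ?A / ?B \<le> 2 * bad_mass_bound y" using B by (simp add: divide_le_eq)
    then have "ennreal (2 * ?A / ?B) \<le> ennreal (2 * bad_mass_bound y)" by (rule ennreal_leI)
    also have "\<dots> = 2 * ennreal (bad_mass_bound y)" by (simp add: ennreal_mult')
    finally have "ennreal (2 * ?A / ?B) \<le> 2 * ennreal (bad_mass_bound y)" .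
    then show "emeasure (posterior I \<Psi> \<pi> n y) S \<le> 2 * ennreal (bad_mass_bound y)"
      using post[where S=S, OF y] by (rule order_trans[rotated])
  qed
  also have "\<dots> = 2 * (\<integral>\<^sup>+y. ennreal (bad_mass_bound y) \<partial>sample_law I \<Psi> n \<theta>0)"
    using bad_mass_measurable by (intro nn_integral_cmult) measurable
  also have "\<dots> \<le> 2 * ennreal b"
    by (intro mult_left_mono order_trans[OF bad_mass_moment] ennreal_leI total) auto
  also have "\<dots> = ennreal (2 * b)" by (simp add: ennreal_mult')
  finally show ?thesis .
qed

lemma total_bound:
  assumes n: "3 \<le> n" "4 * C + 4 \<le> real n" "2 ^ J \<le> real n" and \<delta>: "\<delta> = mesh n"
    and rate: "(real J + 2)\<^sup>2 * (2 ^ J)\<^sup>2 * (4 * C + 4) * ln (real n) \<le> real n * (c\<^sup>2 / (256 * (38 * C)\<^sup>2) / 64)"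
  shows "real (card (sieve c n \<delta> J)) * exp (- (real n * (2 ^ J * \<delta>\<^sup>2) * (4 * C + 1)))
      + 2 * real (card (indices J)) * exp (- (real n * \<delta>\<^sup>2 / 4096))
      + real (card (sieve c n \<delta> J)) * exp (- (real n * fine_rate))
      + real (card (indices J)) * real (2 * n + 1) * exp (- (real n * \<delta>\<^sup>2 / 2)) \<le> 4 * exp (- 4 * ln (real n))"
proof -
  let ?N = "2 ^ J :: real" and ?l = "ln (real n)"
  define k where "k = card (indices J)"
  have l: "0 < ?l" using n(1) by simp
  have N1: "1 \<le> ?N" by simp
  have n\<delta>: "real n * \<delta>\<^sup>2 = 65536 * ?l"
    unfolding \<delta> mesh_def power_mult_distrib using n(1) by simp
  have k: "real k \<le> 2 * C * ?N" unfolding k_def by (rule card_indices)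
  have en: "exp (real m * ?l) = real n ^ m" for m
    using n(1) by (simp add: exp_of_nat_mult)
  have n21: "real (2 * n + 1) \<le> real n ^ 2"
  proof -
    have "2 * n + 1 \<le> 3 * n" using n(1) by simp
    also have "\<dots> \<le> n * n" using n(1) by simp
    finally have "real (2 * n + 1) \<le> real (n * n)" by (rule of_nat_mono)
    then show ?thesis by (simp add: power2_eq_square)
  qed
  have cs: "real (card (sieve c n \<delta> J)) \<le> exp (4 * C * ?N * ?l)"
  proof -
    have "real (card (sieve c n \<delta> J)) \<le> real ((2 * n + 1) ^ k)"
      unfolding k_def by (rule of_nat_mono[OF card_sieve])
    also have "\<dots> = real (2 * n + 1) ^ k" by (rule of_nat_power)
    also have "\<dots> \<le> (real n ^ 2) ^ k" by (rule power_mono[OF n21]) simp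
    also have "\<dots> = exp (real (2 * k) * ?l)" unfolding en by (simp add: power_mult)
    also have "\<dots> \<le> exp (4 * C * ?N * ?l)"
      using mult_right_mono[OF k, of "2 * ?l"] l by (simp add: mult_ac)
    finally show ?thesis .
  qed
  have k1: "2 * real k \<le> exp (2 * ?l)"
  proof -
    have "2 * real k \<le> (4 * C) * ?N" using k by simp
    also have "\<dots> \<le> real n * real n" using n by (intro mult_mono) auto
    also have "\<dots> = exp (2 * ?l)" using en[of 2] by (simp add: power2_eq_square)
    finally show ?thesis .
  qed
  have "real (card (sieve c n \<delta> J)) * exp (- (real n * (?N * \<delta>\<^sup>2) * (4 * C + 1))) \<le> exp (- 4 * ?l)"
  proof -
    have "real n * (?N * \<delta>\<^sup>2) * (4 * C + 1) = (real n * \<delta>\<^sup>2) * ?N * (4 * C + 1)"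
      by (simp only: mult_ac)
    then have "real n * (?N * \<delta>\<^sup>2) * (4 * C + 1) = 65536 * ?l * ?N * (4 * C + 1)"
      unfolding n\<delta> .
    then have "real (card (sieve c n \<delta> J)) * exp (- (real n * (?N * \<delta>\<^sup>2) * (4 * C + 1)))
        \<le> exp (4 * C * ?N * ?l) * exp (- (65536 * ?l * ?N * (4 * C + 1)))"
      by (simp only: mult_right_mono[OF cs] exp_ge_zero)
    also have "\<dots> = exp (- (?N * ?l * (65536 + 65535 * (4 * C))))"
      unfolding exp_add[symmetric] by (rule arg_cong[where f=exp]) (simp add: algebra_simps)
    also have "\<dots> \<le> exp (- (1 * ?l * 4))"
    proof -
      have "1 * ?l * 4 \<le> ?N * ?l * (65536 + 65535 * (4 * C))"
        using N1 l by (intro mult_mono) auto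
      then show ?thesis by simp
    qed
    finally show ?thesis by (simp add: mult.commute)
  qed
  moreover have "2 * real k * exp (- (real n * \<delta>\<^sup>2 / 4096)) \<le> exp (- 4 * ?l)"
  proof -
    have "2 * real k * exp (- (real n * \<delta>\<^sup>2 / 4096)) \<le> exp (2 * ?l) * exp (- (16 * ?l))"
      unfolding n\<delta> using mult_right_mono[OF k1, of "exp (- (16 * ?l))"] by simp
    also have "\<dots> \<le> exp (- 4 * ?l)" unfolding exp_add[symmetric] using l by simp
    finally show ?thesis .
  qed
  moreover have "real (card (sieve c n \<delta> J)) * exp (- (real n * fine_rate)) \<le> exp (- 4 * ?l)"
  proof -
    have d: "0 < (real J + 2)\<^sup>2 * ?N" by simp
    have "real n * fine_rate = (real n * (c\<^sup>2 / (256 * (38 * C)\<^sup>2) / 64)) / ((real J + 2)\<^sup>2 * ?N)"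
      by (simp add: fine_rate_def)
    also have "\<dots> \<ge> ((real J + 2)\<^sup>2 * ?N\<^sup>2 * (4 * C + 4) * ?l) / ((real J + 2)\<^sup>2 * ?N)"
      by (rule divide_right_mono[OF rate]) simp
    also have "((real J + 2)\<^sup>2 * ?N\<^sup>2 * (4 * C + 4) * ?l) / ((real J + 2)\<^sup>2 * ?N) = ?N * (4 * C + 4) * ?l"
      using d by (simp add: power2_eq_square[of ?N])
    finally have fr: "?N * (4 * C + 4) * ?l \<le> real n * fine_rate" .
    have "real (card (sieve c n \<delta> J)) * exp (- (real n * fine_rate))
        \<le> exp (4 * C * ?N * ?l) * exp (- (?N * (4 * C + 4) * ?l))"
      using fr by (intro mult_mono[OF cs]) auto
    also have "\<dots> = exp (- (?N * (4 * ?l)))"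
      unfolding exp_add[symmetric] by (rule arg_cong[where f=exp]) (simp add: algebra_simps)
    also have "\<dots> \<le> exp (- (1 * (4 * ?l)))"
      using mult_right_mono[OF N1, of "4 * ?l"] l by simp
    finally show ?thesis by simp
  qed
  moreover have "real k * real (2 * n + 1) * exp (- (real n * \<delta>\<^sup>2 / 2)) \<le> exp (- 4 * ?l)"
  proof -
    have "real k \<le> 2 * real k" by simp
    then have "real k \<le> exp (2 * ?l)" using k1 by (rule order_trans)
    moreover have "real (2 * n + 1) \<le> exp (2 * ?l)" using n21 en[of 2] by simp
    ultimately have "real k * real (2 * n + 1) \<le> exp (2 * ?l) * exp (2 * ?l)"
      by (rule mult_mono) auto
    then have "real k * real (2 * n + 1) * exp (- (real n * \<delta>\<^sup>2 / 2)) \<le> exp (2 * ?l) * exp (2 * ?l) * exp (- (32768 * ?l))"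
      unfolding n\<delta> by (simp add: mult_right_mono)
    also have "\<dots> \<le> exp (- 4 * ?l)" unfolding exp_add[symmetric] using l by simp
    finally show ?thesis .
  qed
  ultimately show ?thesis unfolding k_def by linarith
qed

end

lemma mesh_powr_le:
  assumes "2 \<le> n" and \<beta>: "0 < \<beta>"
  shows "mesh n powr (2 * \<beta> / (2 * \<beta> + 1)) \<le> 256 * (real n / ln (real n)) powr (- \<beta> / (2 * \<beta> + 1))"
proof -
  let ?g = "2 * \<beta> / (2 * \<beta> + 1)"
  define z where "z = real n / ln (real n)"
  have z: "0 < z" using assms by (simp add: z_def)
  have "sqrt (ln (real n) / real n) = z powr (- (1/2))"
    using z by (simp add: z_def powr_minus powr_half_sqrt real_sqrt_divide)
  then have "mesh n powr ?g = 256 powr ?g * (z powr (- (1/2))) powr ?g"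
    by (simp add: mesh_def powr_mult)
  also have "(z powr (- (1/2))) powr ?g = z powr (- \<beta> / (2 * \<beta> + 1))" by (simp add: powr_powr)
  also have "256 powr ?g * z powr (- \<beta> / (2 * \<beta> + 1)) \<le> 256 powr 1 * z powr (- \<beta> / (2 * \<beta> + 1))"
    using \<beta> by (intro mult_right_mono powr_mono) auto
  finally show ?thesis by (simp add: z_def)
qed

lemma rate_ge:
  assumes "2 \<le> n" and \<beta>: "0 < \<beta>"
  shows "(real n / ln (real n)) powr (- (1/2)) \<le> (real n / ln (real n)) powr (- \<beta> / (2 * \<beta> + 1))"
proof (rule powr_mono)
  have "ln (real n) \<le> real n" using assms(1) ln_le_minus_one[of "real n"] by simp
  moreover have "0 < ln (real n)" using assms(1) by simp
  ultimately show "1 \<le> real n / ln (real n)" by (simp add: le_divide_eq)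
  show "- (1/2) \<le> - \<beta> / (2 * \<beta> + 1)" using \<beta> by (simp add: field_simps)
qed

section \<open>The adaptive prior\<close>

context wavelet_system
begin

lemma H'_class_density_params:
  assumes "\<theta> \<in> H'_class I \<Psi> c \<beta> L" "0 < c" shows "\<theta> \<in> density_params I \<Psi>"
proof -
  have "0 \<le> synth I \<Psi> \<theta> x" if "x \<in> {0..1}" for x
    using assms that less_trans[of 0 c "synth I \<Psi> \<theta> x"] by (simp add: H'_class_def less_imp_le)
  then show ?thesis using assms by (simp add: H'_class_def density_params_def)
qed

lemma loss_inf_le_sum:
  assumes "summable (level_norm \<theta>)" and "\<theta>0 \<in> H_class I \<beta> L" "1/2 \<le> \<beta>" "0 \<le> L"
  shows "loss_inf I \<theta> \<theta>0 \<le> ennreal ((\<Sum>j. level_norm \<theta> j) + 4 * L)"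
proof -
  note s0 = H_class_summable(1)[OF assms(2-4)]
  note sd = summable_level_norm_diff[OF assms(1) s0]
  have "(\<Sum>j. level_norm (\<lambda>p. \<theta> p - \<theta>0 p) j) \<le> (\<Sum>j. level_norm \<theta> j + level_norm \<theta>0 j)"
    by (rule suminf_le[OF level_norm_diff_le sd summable_add[OF assms(1) s0]])
  also have "\<dots> = (\<Sum>j. level_norm \<theta> j) + (\<Sum>j. level_norm \<theta>0 j)"
    by (rule suminf_add[OF assms(1) s0, symmetric])
  also have "\<dots> \<le> (\<Sum>j. level_norm \<theta> j) + 4 * L"
    using H_class_summable(2)[OF assms(2-4), of 0] by simp
  finally show ?thesis unfolding loss_inf_eq[OF sd] by (rule ennreal_leI)
qed


definition nth_sieve :: "real \<Rightarrow> nat \<Rightarrow> (nat \<times> nat \<Rightarrow> real) set" where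
  "nth_sieve c n = sieve c n (mesh n) (top_level n)"

definition posterior_by_score ::
  "real \<Rightarrow> nat \<Rightarrow> (nat \<times> nat \<Rightarrow> real) pmf \<Rightarrow> bool" where
  "posterior_by_score c n \<pi> \<longleftrightarrow> (\<forall>y S. (\<forall>i<n. y i \<in> {0..1}) \<longrightarrow>
     emeasure (posterior I \<Psi> \<pi> n y) S
       \<le> ennreal (2 * (\<Sum>u | u \<in> nth_sieve c n \<and> normalized u \<in> S. score n u y)
          / (\<Sum>u\<in>nth_sieve c n. score n u y)))"

text \<open>
  When the sieve is empty, the prior sits at an element of some class \<open>H'_class\<close> with \<open>\<beta> \<ge> 1/2\<close> if there is one, because
  its loss is then finite; otherwise the risk bound is void and any parameter will do.
\<close>
lemma adaptive_prior_exists: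
  assumes c: "0 < c" and ne: "density_params I \<Psi> \<noteq> {}"
  obtains \<pi> where "\<And>n. sieve_prior I \<Psi> (\<pi> n)" "\<And>n. finite (set_pmf (\<pi> n))"
    "\<And>n. nth_sieve c n \<noteq> {} \<Longrightarrow> posterior_by_score c n (\<pi> n)"
    "\<And>n \<theta> \<beta> L \<theta>0. \<theta> \<in> set_pmf (\<pi> n) \<Longrightarrow> \<theta>0 \<in> H'_class I \<Psi> c \<beta> L \<Longrightarrow> 1/2 \<le> \<beta> \<Longrightarrow> 0 \<le> L \<Longrightarrow>
      summable (level_norm \<theta>)"
proof -
  let ?trig = "\<exists>\<theta>0 \<beta> L. \<theta>0 \<in> H'_class I \<Psi> c \<beta> L \<and> 1/2 \<le> \<beta> \<and> 0 \<le> L"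
  obtain \<theta>d where \<theta>d: "\<theta>d \<in> density_params I \<Psi>" "?trig \<Longrightarrow> summable (level_norm \<theta>d)"
  proof (cases ?trig)
    case True
    then obtain \<theta>0 \<beta> L where *: "\<theta>0 \<in> H'_class I \<Psi> c \<beta> L" "1/2 \<le> \<beta>" "0 \<le> L" by blast
    show thesis by (rule that[OF H'_class_density_params[OF *(1) c]]) (rule H'_class_truth(1)[OF *])
  next
    case False
    then show thesis using ne that by blast
  qed
  have "\<exists>\<pi>. sieve_prior I \<Psi> \<pi> \<and> finite (set_pmf \<pi>)
      \<and> (nth_sieve c n \<noteq> {} \<longrightarrow> posterior_by_score c n \<pi>)
      \<and> (?trig \<longrightarrow> (\<forall>\<theta>\<in>set_pmf \<pi>. summable (level_norm \<theta>)))" for n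
  proof (cases "nth_sieve c n = {}")
    case True
    have "pmf_of_set {..<length [\<theta>d]} = return_pmf 0"
      by (simp add: lessThan_Suc pmf_of_set_singleton)
    then have "sieve_prior I \<Psi> (return_pmf \<theta>d)"
      unfolding sieve_prior_def using \<theta>d(1) by (intro exI[of _ "[\<theta>d]"]) simp
    then show ?thesis using True \<theta>d(2) by (intro exI[of _ "return_pmf \<theta>d"]) simp
  next
    case False
    obtain \<pi> where \<pi>: "sieve_prior I \<Psi> \<pi>" "set_pmf \<pi> = normalized ` nth_sieve c n"
      and post: "\<And>y S. (\<And>i. i < n \<Longrightarrow> y i \<in> {0..1}) \<Longrightarrow>
        emeasure (posterior I \<Psi> \<pi> n y) S
        \<le> ennreal (2 * (\<Sum>u | u \<in> nth_sieve c n \<and> normalized u \<in> S. score n u y)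
          / (\<Sum>u\<in>nth_sieve c n. score n u y))"
      by (rule sieve_prior_exists[OF c False[unfolded nth_sieve_def], folded nth_sieve_def]) (rule that, assumption, assumption, blast)
    have "summable (level_norm (normalized u))" if u: "u \<in> nth_sieve c n" for u
    proof (rule summable_supported)
      show "supported (top_level n) (normalized u)"
        using sieve_supported[OF u[unfolded nth_sieve_def]] by (simp add: supported_def normalized_def)
    qed
    moreover have "posterior_by_score c n \<pi>" unfolding posterior_by_score_def using post by blast
    moreover have "finite (set_pmf \<pi>)" unfolding \<pi>(2) nth_sieve_def by simp
    ultimately show ?thesis using \<pi> by (intro exI[of _ \<pi>]) auto
  qed
  then obtain \<pi> where \<pi>: "\<And>n. sieve_prior I \<Psi> (\<pi> n) \<and> finite (set_pmf (\<pi> n))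
      \<and> (nth_sieve c n \<noteq> {} \<longrightarrow> posterior_by_score c n (\<pi> n))
      \<and> (?trig \<longrightarrow> (\<forall>\<theta>\<in>set_pmf (\<pi> n). summable (level_norm \<theta>)))" by metis
  show thesis
  proof (rule that[of \<pi>])
    fix n \<theta> \<beta> L \<theta>0
    assume *: "\<theta> \<in> set_pmf (\<pi> n)" "\<theta>0 \<in> H'_class I \<Psi> c \<beta> L" "1/2 \<le> \<beta>" "0 \<le> L"
    then have ?trig by blast
    with \<pi>[of n] * show "summable (level_norm \<theta>)" by blast
  qed (use \<pi> in blast)+
qed

lemma risk_const_nonneg: "0 < c \<Longrightarrow> 0 \<le> L \<Longrightarrow> 0 \<le> risk_const c L"
  unfolding risk_const_def by (intro mult_nonneg_nonneg add_nonneg_nonneg) auto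

lemma posterior_risk_large_n:
  assumes c: "0 < c" and b: "1/2 < \<beta>1" "\<beta>1 \<le> \<beta>" and L: "0 \<le> L"
    and \<theta>0: "\<theta>0 \<in> H'_class I \<Psi> c \<beta> L"
    and \<pi>: "nth_sieve c n \<noteq> {} \<Longrightarrow> posterior_by_score c n \<pi>"
    and n: "3 \<le> n" "4 * C + 4 \<le> real n" "2 ^ top_level n \<le> real n"
    and mesh: "0 < mesh n" "mesh n \<le> 1" "2 \<le> real n * mesh n"
    and small: "(real (top_level n) + 2)\<^sup>2 * 2 ^ top_level n * mesh n \<le> c / (64 * C ^ 3 * (near_const C + 1226))"
    and tail: "4 * L \<le> 2 powr (real (top_level n) * (\<beta>1 + 1/2)) * mesh n"
    and rate: "(real (top_level n) + 2)\<^sup>2 * (2 ^ top_level n)\<^sup>2 * (4 * C + 4) * ln (real n)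
      \<le> real n * (c\<^sup>2 / (256 * (38 * C)\<^sup>2) / 64)"
    and M: "256 * risk_const c L < M"
  shows "(\<integral>\<^sup>+y. emeasure (posterior I \<Psi> \<pi> n y)
      {\<theta>. loss_inf I \<theta> \<theta>0 \<ge> ennreal (M * (real n / ln (real n)) powr (- \<beta> / (2 * \<beta> + 1)))}
      \<partial>sample_law I \<Psi> n \<theta>0) \<le> ennreal (real n powr (- 1))"
proof -
  let ?J = "top_level n" and ?\<delta> = "mesh n"
  let ?r = "(real n / ln (real n)) powr (- \<beta> / (2 * \<beta> + 1))"
  let ?S = "{\<theta>. loss_inf I \<theta> \<theta>0 \<ge> ennreal (M * ?r)}"
  have \<beta>: "1/2 \<le> \<beta>" "0 < \<beta>" using b by auto
  have H: "\<theta>0 \<in> H_class I \<beta> L" using \<theta>0 by (simp add: H'_class_def)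
  have tail_j: "4 * L * 2 powr (- real j * (\<beta> + 1/2)) \<le> ?\<delta>" if "?J \<le> j" for j
  proof -
    have "real ?J * (\<beta>1 + 1/2) \<le> real j * (\<beta> + 1/2)" using that b by (intro mult_mono) auto
    then have "4 * L * 2 powr (- real j * (\<beta> + 1/2)) \<le> 4 * L * 2 powr (- (real ?J * (\<beta>1 + 1/2)))"
      using L by (intro mult_left_mono powr_mono) auto
    also have "\<dots> \<le> (2 powr (real ?J * (\<beta>1 + 1/2)) * ?\<delta>) * 2 powr (- (real ?J * (\<beta>1 + 1/2)))"
      by (rule mult_right_mono[OF tail]) simp
    also have "\<dots> = (2 powr (real ?J * (\<beta>1 + 1/2)) * 2 powr (- (real ?J * (\<beta>1 + 1/2)))) * ?\<delta>"
      by (simp only: mult_ac)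
    also have "\<dots> = ?\<delta>" by (simp flip: powr_add)
    finally show ?thesis .
  qed
  interpret sieve_core I \<Psi> C ?J n ?\<delta> c \<theta>0
  proof
    show "summable (level_norm \<theta>0)" "(\<integral>x. (synth I \<Psi> \<theta>0 x)\<^sup>2 \<partial>unit_measure) = 1"
      by (rule H'_class_truth[OF \<theta>0 \<beta>(1) L])+
    show "c < synth I \<Psi> \<theta>0 x" if "x \<in> {0..1}" for x using H'_class_truth(3)[OF \<theta>0 \<beta>(1) L that] .
    show "\<bar>\<theta>0 p\<bar> \<le> 1" if "p \<in> Lam I" for p using H'_class_truth(4)[OF \<theta>0 \<beta>(1) L that] .
    have "(\<Sum>j. level_norm \<theta>0 (j + Suc ?J)) \<le> 4 * L * 2 powr (- real (Suc ?J) * \<beta>)"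
      by (rule H_class_summable(2)[OF H \<beta>(1) L])
    also have "\<dots> \<le> 4 * L * 2 powr (- real ?J * \<beta>)"
      using L \<beta> by (intro mult_left_mono powr_mono) (auto simp: algebra_simps)
    also have "\<dots> = 2 powr (real ?J / 2) * (4 * L * 2 powr (- real ?J * (\<beta> + 1/2)))"
    proof -
      have "2 powr (- real ?J * \<beta>) = 2 powr (real ?J / 2) * 2 powr (- real ?J * (\<beta> + 1/2))"
        by (simp add: algebra_simps flip: powr_add)
      then show ?thesis by (simp only: mult_ac)
    qed
    also have "\<dots> \<le> 2 powr (real ?J / 2) * ?\<delta>"
      by (rule mult_left_mono[OF tail_j]) auto
    finally show "(\<Sum>j. level_norm \<theta>0 (j + Suc ?J)) \<le> 2 powr (real ?J / 2) * ?\<delta>" .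
  qed (use c mesh small in auto)
  have ne: "nth_sieve c n \<noteq> {}" using center_in_sieve by (auto simp: nth_sieve_def)
  have post: "emeasure (posterior I \<Psi> \<pi> n y) S
      \<le> ennreal (2 * (\<Sum>u | u \<in> sieve c n ?\<delta> ?J \<and> normalized u \<in> S. score n u y)
          / (\<Sum>u\<in>sieve c n ?\<delta> ?J. score n u y))" if "\<And>i. i < n \<Longrightarrow> y i \<in> {0..1}" for y S
    using \<pi>[OF ne] that unfolding posterior_by_score_def nth_sieve_def by blast
  have "\<exists>p. bad u p" if u: "u \<in> sieve c n ?\<delta> ?J" and S: "normalized u \<in> ?S" for u
  proof (rule ccontr)
    assume good: "\<not> (\<exists>p. bad u p)"
    have r: "0 < ?r" using n(1) by simp
    have "loss_inf I (normalized u) \<theta>0 \<le> ennreal (risk_const c L * ?\<delta> powr (2 * \<beta> / (2 * \<beta> + 1)))"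
    proof (rule good_loss[OF u good H \<beta>(1) L mesh(2)])
      fix j assume "?J < j"
      then have "4 * L * 2 powr (- real j * (\<beta> + 1/2)) \<le> ?\<delta>" by (intro tail_j) simp
      moreover have "0 \<le> L * 2 powr (- real j * (\<beta> + 1/2))" using L by simp
      ultimately show "L * 2 powr (- real j * (\<beta> + 1/2)) \<le> ?\<delta>" by linarith
    qed
    also have "risk_const c L * ?\<delta> powr (2 * \<beta> / (2 * \<beta> + 1)) < M * ?r"
    proof -
      have "risk_const c L * ?\<delta> powr (2 * \<beta> / (2 * \<beta> + 1)) \<le> risk_const c L * (256 * ?r)"
        using mesh_powr_le[OF _ \<beta>(2), of n] n(1) risk_const_nonneg[OF c L] by (simp add: mult_left_mono)
      also have "\<dots> = 256 * risk_const c L * ?r" by simp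
      also have "\<dots> < M * ?r" by (rule mult_strict_right_mono[OF M r])
      finally show ?thesis .
    qed
    then have "ennreal (risk_const c L * ?\<delta> powr (2 * \<beta> / (2 * \<beta> + 1))) < ennreal (M * ?r)"
      by (intro ennreal_lessI)
        (use M risk_const_nonneg[OF c L] r in \<open>auto intro!: mult_pos_pos\<close>)
    finally show False using S by auto
  qed
  then have "(\<integral>\<^sup>+y. emeasure (posterior I \<Psi> \<pi> n y) ?S \<partial>sample_law I \<Psi> n \<theta>0)
      \<le> ennreal (2 * (4 * exp (- 4 * ln (real n))))"
    using post by (intro posterior_bad_bound total_bound n rate refl) auto
  also have "2 * (4 * exp (- 4 * ln (real n))) \<le> real n powr (- 1)"
  proof -
    have n0: "0 < real n" using n(1) by simp
    have "8 \<le> real n * real n * real n"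
    proof -
      have "(2::real) * 2 * 2 \<le> real n * real n * real n" using n(1) by (intro mult_mono) auto
      then show ?thesis by simp
    qed
    then have "8 * exp (- 4 * ln (real n)) \<le> (real n * real n * real n) * exp (- 4 * ln (real n))"
      by (rule mult_right_mono) simp
    also have "real n * real n * real n = exp (3 * ln (real n))"
      using n0 exp_of_nat_mult[of 3 "ln (real n)"] by (simp add: power3_eq_cube)
    also have "exp (3 * ln (real n)) * exp (- 4 * ln (real n)) = exp (- ln (real n))"
      unfolding exp_add[symmetric] by (rule arg_cong[where f=exp]) simp
    also have "\<dots> = real n powr (- 1)" using n0 by (simp add: powr_def)
    finally show ?thesis by simp
  qed
  then have "ennreal (2 * (4 * exp (- 4 * ln (real n)))) \<le> ennreal (real n powr (- 1))" by (rule ennreal_leI)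
  finally show ?thesis .
qed

text \<open>
  For fixed \<open>n\<close> the losses are bounded uniformly over the class, and for large \<open>M\<close> the event contains no point of
  the prior.
\<close>
lemma posterior_risk_small_n:
  assumes \<pi>: "\<And>\<theta>. \<theta> \<in> set_pmf \<pi> \<Longrightarrow> summable (level_norm \<theta>)" and fin: "finite (set_pmf \<pi>)"
    and \<theta>0: "\<theta>0 \<in> H'_class I \<Psi> c \<beta> L" and \<beta>: "1/2 \<le> \<beta>" and L: "0 \<le> L" and n: "2 \<le> n"
    and M: "(\<Sum>\<theta>\<in>set_pmf \<pi>. \<Sum>j. level_norm \<theta> j) + 4 * L + 1
      \<le> M * (real n / ln (real n)) powr (- (1/2))"
  shows "(\<integral>\<^sup>+y. emeasure (posterior I \<Psi> \<pi> n y)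
      {\<theta>. loss_inf I \<theta> \<theta>0 \<ge> ennreal (M * (real n / ln (real n)) powr (- \<beta> / (2 * \<beta> + 1)))}
      \<partial>sample_law I \<Psi> n \<theta>0) = 0"
proof -
  let ?r = "(real n / ln (real n)) powr (- \<beta> / (2 * \<beta> + 1))"
  let ?S = "{\<theta>. loss_inf I \<theta> \<theta>0 \<ge> ennreal (M * ?r)}"
  let ?B = "\<Sum>\<theta>\<in>set_pmf \<pi>. \<Sum>j. level_norm \<theta> j"
  have H: "\<theta>0 \<in> H_class I \<beta> L" using \<theta>0 by (simp add: H'_class_def)
  have sn: "0 \<le> (\<Sum>j. level_norm \<theta> j)" if "\<theta> \<in> set_pmf \<pi>" for \<theta>
    by (rule suminf_nonneg[OF \<pi>[OF that] level_norm_nonneg])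
  have B0: "0 \<le> ?B" by (rule sum_nonneg[OF sn])
  have r0: "0 < (real n / ln (real n)) powr (- (1/2))" using n by simp
  have "0 < M * (real n / ln (real n)) powr (- (1/2))" using M B0 L by linarith
  then have M0: "0 < M" using r0 by (simp add: zero_less_mult_iff)
  have "M * (real n / ln (real n)) powr (- (1/2)) \<le> M * ?r"
    using \<beta> by (intro mult_left_mono rate_ge[OF n]) (use M0 in auto)
  then have big: "?B + 4 * L < M * ?r" using M by linarith
  have "?S \<inter> set_pmf \<pi> = {}"
  proof (rule ccontr)
    assume "?S \<inter> set_pmf \<pi> \<noteq> {}"
    then obtain \<theta> where \<theta>: "\<theta> \<in> set_pmf \<pi>" "ennreal (M * ?r) \<le> loss_inf I \<theta> \<theta>0" by auto
    note \<theta>(2)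
    also have "loss_inf I \<theta> \<theta>0 \<le> ennreal ((\<Sum>j. level_norm \<theta> j) + 4 * L)"
      by (rule loss_inf_le_sum[OF \<pi>[OF \<theta>(1)] H \<beta> L])
    also have "\<dots> \<le> ennreal (?B + 4 * L)"
      by (intro ennreal_leI add_right_mono member_le_sum[OF \<theta>(1) _ fin]) (use sn in auto)
    also have "\<dots> < ennreal (M * ?r)"
      by (intro ennreal_lessI big) (use big B0 L in linarith)
    finally show False by simp
  qed
  then show ?thesis by (simp add: posterior_null)
qed

end

theorem proposition3:
  fixes r :: nat
    and I :: "nat \<Rightarrow> nat set"
    and \<Psi> :: "nat \<Rightarrow> nat \<Rightarrow> real \<Rightarrow> real"
    and c :: real
  assumes "interval_wavelet_basis r I \<Psi>"
    and "c > 0"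
  shows "\<exists>\<pi> :: nat \<Rightarrow> (nat \<times> nat \<Rightarrow> real) pmf.
    (\<forall>n. sieve_prior I \<Psi> (\<pi> n)) \<and>
    (\<forall>\<beta>1 \<beta>2 L :: real. 1/2 < \<beta>1 \<and> \<beta>1 \<le> \<beta>2 \<and> L > 0 \<longrightarrow>
      (\<exists>M B :: real. M > 0 \<and> B > 0 \<and>
        (\<forall>n::nat. n \<ge> 2 \<longrightarrow> (\<forall>\<beta> \<in> {\<beta>1..\<beta>2}.
          (SUP \<theta>0 \<in> H'_class I \<Psi> c \<beta> L.
             \<integral>\<^sup>+ y. emeasure (posterior I \<Psi> (\<pi> n) n y)
                      {\<theta>. loss_inf I \<theta> \<theta>0 \<ge>
                           ennreal (M * (real n / ln (real n)) powr (- \<beta> / (2 * \<beta> + 1)))}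
               \<partial>sample_law I \<Psi> n \<theta>0)
          \<le> ennreal (real n powr (- B))))))"
proof -
  obtain C where "wavelet_system I \<Psi> C" using wavelet_system_of_interval_basis[OF assms(1)] .
  then interpret wavelet_system I \<Psi> C .
  obtain \<pi> where \<pi>: "\<And>n. sieve_prior I \<Psi> (\<pi> n)" "\<And>n. finite (set_pmf (\<pi> n))"
    "\<And>n. nth_sieve c n \<noteq> {} \<Longrightarrow> posterior_by_score c n (\<pi> n)"
    "\<And>n \<theta> \<beta> L \<theta>0. \<theta> \<in> set_pmf (\<pi> n) \<Longrightarrow> \<theta>0 \<in> H'_class I \<Psi> c \<beta> L \<Longrightarrow> 1/2 \<le> \<beta> \<Longrightarrow> 0 \<le> L \<Longrightarrow>
      summable (level_norm \<theta>)"
    using adaptive_prior_exists[OF assms(2) density_params_nonempty[OF assms(1)]] by metis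
  show ?thesis
  proof (intro exI[of _ \<pi>] conjI allI impI \<pi>(1))
    fix \<beta>1 \<beta>2 L :: real
    assume "1/2 < \<beta>1 \<and> \<beta>1 \<le> \<beta>2 \<and> L > 0"
    then have b1: "1/2 < \<beta>1" and L: "0 \<le> L" by auto
    have near: "0 < near_const C + 1226"
      unfolding near_const_def using C_nonneg by (intro add_nonneg_pos mult_nonneg_nonneg real_sqrt_ge_zero) auto
    have C3: "0 < C ^ 3" "0 < C\<^sup>2" using one_le_C by auto
    have \<kappa>: "0 < c / (64 * C ^ 3 * (near_const C + 1226))" "0 < c\<^sup>2 / (256 * (38 * C)\<^sup>2) / 64"
      using assms(2) near C3 by (auto simp: power_mult_distrib intro!: divide_pos_pos mult_pos_pos)
    have "0 \<le> 4 * C + 4" using C_nonneg by linarith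
    from sieve_parameters_eventually[OF \<kappa> b1 this, of "4 * L"]
    obtain n0 where n0: "\<And>n. n0 \<le> n \<Longrightarrow> 3 \<le> n \<and> 4 * C + 4 \<le> real n \<and> 2 ^ top_level n \<le> real n
      \<and> 0 < mesh n \<and> mesh n \<le> 1 \<and> 2 \<le> real n * mesh n
      \<and> (real (top_level n) + 2)\<^sup>2 * 2 ^ top_level n * mesh n \<le> c / (64 * C ^ 3 * (near_const C + 1226))
      \<and> 4 * L \<le> 2 powr (real (top_level n) * (\<beta>1 + 1/2)) * mesh n
      \<and> (real (top_level n) + 2)\<^sup>2 * (2 ^ top_level n)\<^sup>2 * (4 * C + 4) * ln (real n)
        \<le> real n * (c\<^sup>2 / (256 * (38 * C)\<^sup>2) / 64)"
      unfolding eventually_sequentially by blast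
    (* M exceeds Q n for every n below n0, so that the event is empty there. *)
    define Q where "Q n = \<bar>((\<Sum>\<theta>\<in>set_pmf (\<pi> n). \<Sum>j. level_norm \<theta> j) + 4 * L + 1)
      / (real n / ln (real n)) powr (- (1/2))\<bar>" for n
    define M where "M = 256 * risk_const c L + 1 + (\<Sum>n<n0. Q n)"
    have Q0: "0 \<le> Q n" for n by (simp add: Q_def)
    have M1: "256 * risk_const c L < M" unfolding M_def using sum_nonneg[of "{..<n0}" Q] Q0 by simp
    have M0: "0 < M" using M1 risk_const_nonneg[OF assms(2) L] by linarith
    have MQ: "Q n \<le> M" if "n < n0" for n
    proof -
      have "Q n \<le> (\<Sum>n<n0. Q n)" by (rule member_le_sum) (use that Q0 in auto)
      then show ?thesis unfolding M_def using risk_const_nonneg[OF assms(2) L] by linarith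
    qed
    show "\<exists>M B :: real. M > 0 \<and> B > 0 \<and>
        (\<forall>n::nat. n \<ge> 2 \<longrightarrow> (\<forall>\<beta> \<in> {\<beta>1..\<beta>2}.
          (SUP \<theta>0 \<in> H'_class I \<Psi> c \<beta> L.
             \<integral>\<^sup>+ y. emeasure (posterior I \<Psi> (\<pi> n) n y)
                      {\<theta>. loss_inf I \<theta> \<theta>0 \<ge>
                           ennreal (M * (real n / ln (real n)) powr (- \<beta> / (2 * \<beta> + 1)))}
               \<partial>sample_law I \<Psi> n \<theta>0)
          \<le> ennreal (real n powr (- B))))"
    proof (rule exI[of _ M], rule exI[of _ 1], intro conjI allI impI ballI SUP_least)
      fix n :: nat and \<beta> \<theta>0
      assume n: "2 \<le> n" and "\<beta> \<in> {\<beta>1..\<beta>2}" and \<theta>0: "\<theta>0 \<in> H'_class I \<Psi> c \<beta> L"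
      then have \<beta>: "\<beta>1 \<le> \<beta>" "1/2 \<le> \<beta>" using b1 by auto
      show "(\<integral>\<^sup>+ y. emeasure (posterior I \<Psi> (\<pi> n) n y)
          {\<theta>. loss_inf I \<theta> \<theta>0 \<ge> ennreal (M * (real n / ln (real n)) powr (- \<beta> / (2 * \<beta> + 1)))}
          \<partial>sample_law I \<Psi> n \<theta>0) \<le> ennreal (real n powr (- 1))"
      proof (cases "n0 \<le> n")
        case True
        note N = n0[OF True]
        show ?thesis
          by (rule posterior_risk_large_n[OF assms(2) b1 \<beta>(1) L \<theta>0 \<pi>(3)]) (use N M1 in auto)
      next
        case False
        have r0: "0 < (real n / ln (real n)) powr (- (1/2))" using n by simp
        have "((\<Sum>\<theta>\<in>set_pmf (\<pi> n). \<Sum>j. level_norm \<theta> j) + 4 * L + 1)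
            / (real n / ln (real n)) powr (- (1/2)) \<le> Q n" unfolding Q_def by (rule abs_ge_self)
        also have "Q n \<le> M" using MQ False by simp
        finally have "(\<Sum>\<theta>\<in>set_pmf (\<pi> n). \<Sum>j. level_norm \<theta> j) + 4 * L + 1
            \<le> M * (real n / ln (real n)) powr (- (1/2))"
          using r0 by (simp only: pos_divide_le_eq)
        from posterior_risk_small_n[OF \<pi>(4)[OF _ \<theta>0 \<beta>(2) L] \<pi>(2) \<theta>0 \<beta>(2) L n this]
        show ?thesis by simp
      qed
    qed (use M0 in auto)
  qed
qed

end
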